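(* Assume $m>4$ and $f\in C^2_c(\mathbb{R}^m\times\mathbb{B}^m,\mathcal{H}_k(\mathbb{R}))$. Then any bounded solution $g\in C^2(\mathbb{R}^m\times\mathbb{B}^m,\mathcal{H}_k(\mathbb{R}))$ of $\mathcal{D}_kg=f$ in $\mathbb{R}^m\times\mathbb{B}^m$ has the form $$g(\boldsymbol{y},\boldsymbol{v})=\int_{\mathbb{R}^m}\int_{\mathbb{S}^{m-1}}H_k(\boldsymbol{x},\boldsymbol{y},\boldsymbol{u},\boldsymbol{v})\,f(\boldsymbol{x},\boldsymbol{u})\,dS(\boldsymbol{u})\,d\boldsymbol{x}+h(\boldsymbol{v}),\qquad \boldsymbol{y}\in\mathbb{R}^m,\ \boldsymbol{v}\in\mathbb{B}^m,$$ for some $h\in\mathcal{H}_k(\mathbb{R})$, where $H_k$ is the fundamental solution of the bosonic Laplacian $\mathcal{D}_k$.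
   Context: Let $k\ge 1$ be an integer. $\mathbb{B}^m$ is the unit ball and $\mathbb{S}^{m-1}$ the unit sphere of $\mathbb{R}^m$; $dS$ is the (unnormalized) surface measure on $\mathbb{S}^{m-1}$. $\mathcal{H}_k(\mathbb{R})$ is the space of real-valued harmonic polynomials on $\mathbb{R}^m$, homogeneous of degree $k$. For an open $\Omega\subset\mathbb{R}^m$, $C^2(\Omega\times\mathbb{B}^m,\mathcal{H}_k(\mathbb{R}))$ is the space of $C^2$ functions $f(\boldsymbol{x},\boldsymbol{u})$ on $\Omega\times\mathbb{B}^m$ such that for each fixed $\boldsymbol{x}$ the function $\boldsymbol{u}\mapsto f(\boldsymbol{x},\boldsymbol{u})$ is (the restriction of) an element of $\mathcal{H}_k(\mathbb{R})$; being polynomial in $\boldsymbol{u}$, $f$ is defined for all $\boldsymbol{u}\in\mathbb{R}^m$. $C^2_c(\mathbb{R}^m\times\mathbb{B}^m,\mathcal{H}_k(\mathbb{R}))$ consists of those $f\in C^2(\mathbb{R}^m\times\mathbb{B}^m,\mathcal{H}_k(\mathbb{R}))$ having compact support with respect to $\boldsymbol{x}$. A solution is bounded if it is a bounded function on $\mathbb{R}^m\times\mathbb{B}^m$. The bosonic Laplacian acting on functions of $(\boldsymbol{x},\boldsymbol{u})$ with values in $\mathcal{H}_k(\mathbb{R})$ is $$\mathcal{D}_k=\Delta_{\boldsymbol{x}}-\frac{4\langle \boldsymbol{u},D_{\boldsymbol{x}}\rangle\langle D_{\boldsymbol{u}},D_{\boldsymbol{x}}\rangle}{m+2k-2}+\frac{4|\boldsymbol{u}|^2\langle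 D_{\boldsymbol{u}},D_{\boldsymbol{x}}\rangle^2}{(m+2k-2)(m+2k-4)},$$ where $\langle \boldsymbol{u},D_{\boldsymbol{x}}\rangle=\sum_{j=1}^m u_j\partial_{x_j}$ and $\langle D_{\boldsymbol{u}},D_{\boldsymbol{x}}\rangle=\sum_{j=1}^m\partial_{u_j}\partial_{x_j}$. $Z_k(\boldsymbol{u},\boldsymbol{v})$ is the reproducing kernel of $\mathcal{H}_k(\mathbb{R})$: $h(\boldsymbol{v})=\int_{\mathbb{S}^{m-1}}Z_k(\boldsymbol{u},\boldsymbol{v})h(\boldsymbol{u})\,dS(\boldsymbol{u})$ for all $h\in\mathcal{H}_k(\mathbb{R})$. The fundamental solution of $\mathcal{D}_k$ is $$H_k(\boldsymbol{x},\boldsymbol{y},\boldsymbol{u},\boldsymbol{v})=c_{m,k}\,|\boldsymbol{y}-\boldsymbol{x}|^{2-m}\,Z_k\!\left(\frac{(\boldsymbol{y}-\boldsymbol{x})\boldsymbol{u}(\boldsymbol{y}-\boldsymbol{x})}{|\boldsymbol{y}-\boldsymbol{x}|^2},\boldsymbol{v}\right),$$ where products of vectors are taken in the Clifford algebra with $e_ie_j+e_je_i=-2\delta_{ij}$, so that for $\boldsymbol{a}\neq0$, $\frac{\boldsymbol{a}\boldsymbol{u}\boldsymbol{a}}{|\boldsymbol{a}|^2}=\boldsymbol{u}-2\frac{\langle\boldsymbol{a},\boldsymbol{u}\rangle}{|\boldsymbol{a}|^2}\boldsymbol{a}$. Here $c_{m,k}$ is the real normalizing constant (depending only on $m,k$)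 for which $H_k$ is a fundamental solution, i.e. $\mathcal{D}_kH_k(\boldsymbol{x},\boldsymbol{y},\boldsymbol{u},\boldsymbol{v})=\delta(\boldsymbol{y}-\boldsymbol{x})Z_k(\boldsymbol{u},\boldsymbol{v})$ in the distributional sense. *)

theory Defs
  imports "HOL-Analysis.Analysis"
begin

section \<open>Differentiability classes and partial derivatives\<close>

text \<open>\<open>C\<^sup>n\<close> on an open set \<open>S\<close>: all iterated directional derivatives up to order \<open>n\<close>
  exist (in the Frechet sense) and are continuous on \<open>S\<close>.\<close>

primrec Cn_on :: "nat \<Rightarrow> ('a::euclidean_space) set \<Rightarrow> ('a \<Rightarrow> real) \<Rightarrow> bool" where
  "Cn_on 0 S f \<longleftrightarrow> continuous_on S f"
| "Cn_on (Suc n) S f \<longleftrightarrow>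
     (\<forall>x\<in>S. f differentiable (at x)) \<and>
     (\<forall>w. Cn_on n S (\<lambda>x. frechet_derivative f (at x) w))"

definition partial :: "'n::finite \<Rightarrow> (real^'n \<Rightarrow> real) \<Rightarrow> real^'n \<Rightarrow> real" where
  "partial j p x = deriv (\<lambda>t. p (x + t *\<^sub>R axis j 1)) 0"

definition laplacian :: "(real^'n::finite \<Rightarrow> real) \<Rightarrow> real^'n \<Rightarrow> real" where
  "laplacian p x = (\<Sum>j\<in>UNIV. partial j (partial j p) x)"

section \<open>Function spaces\<close>

definition harm_poly :: "nat \<Rightarrow> (real^'n::finite \<Rightarrow> real) set" where
  "harm_poly k = {p. real_polynomial_function p \<and>
                     (\<forall>c x. p (c *\<^sub>R x) = c ^ k * p x) \<and>
                     (\<forall>x. laplacian p x = 0)}"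

text \<open>A function with values in \<open>\<H>\<^sub>k\<close> is represented by its unique polynomial extension
  to all vectors \<open>u\<close>; regularity is only required on \<open>\<Omega> \<times> \<B>\<^sup>m\<close>.\<close>

definition C2_harm :: "(real^'n::finite) set \<Rightarrow> nat \<Rightarrow> (real^'n \<Rightarrow> real^'n \<Rightarrow> real) set" where
  "C2_harm \<Omega> k = {f. Cn_on 2 (\<Omega> \<times> ball 0 1) (\<lambda>(x, u). f x u) \<and> (\<forall>x\<in>\<Omega>. f x \<in> harm_poly k)}"

definition C2c_harm :: "nat \<Rightarrow> (real^'n::finite \<Rightarrow> real^'n \<Rightarrow> real) set" where
  "C2c_harm k = {f \<in> C2_harm UNIV k. compact (closure {x. \<exists>u\<in>ball 0 1. f x u \<noteq> 0})}"

definition test_functions :: "(real^'n::finite \<Rightarrow> real) set" where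
  "test_functions = {\<phi>. (\<forall>n. Cn_on n UNIV \<phi>) \<and> compact (closure {x. \<phi> x \<noteq> 0})}"

section \<open>The bosonic Laplacian\<close>

text \<open>The operators are parametrised by the meaning \<open>d j\<close> of \<open>\<partial>\<^bsub>x\<^sub>j\<^esub>\<close>, so that the same formula
  applies to functions of \<open>(x, u)\<close> (the type \<open>'x\<close> is then that of points) and to
  distributions in \<open>x\<close> depending on the parameter \<open>u\<close> (\<open>'x\<close> is then the type of test
  functions).\<close>

definition du :: "'n::finite \<Rightarrow> ('x \<Rightarrow> real^'n \<Rightarrow> real) \<Rightarrow> 'x \<Rightarrow> real^'n \<Rightarrow> real" where
  "du j F = (\<lambda>x u. partial j (F x) u)"

definition u_Dx ::
  "('n::finite \<Rightarrow> ('x \<Rightarrow> real^'n \<Rightarrow> real) \<Rightarrow> 'x \<Rightarrow> real^'n \<Rightarrow> real)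
    \<Rightarrow> ('x \<Rightarrow> real^'n \<Rightarrow> real) \<Rightarrow> 'x \<Rightarrow> real^'n \<Rightarrow> real" where
  "u_Dx d F = (\<lambda>x u. \<Sum>j\<in>UNIV. u $ j * d j F x u)"

definition Du_Dx ::
  "('n::finite \<Rightarrow> ('x \<Rightarrow> real^'n \<Rightarrow> real) \<Rightarrow> 'x \<Rightarrow> real^'n \<Rightarrow> real)
    \<Rightarrow> ('x \<Rightarrow> real^'n \<Rightarrow> real) \<Rightarrow> 'x \<Rightarrow> real^'n \<Rightarrow> real" where
  "Du_Dx d F = (\<lambda>x u. \<Sum>j\<in>UNIV. du j (d j F) x u)"

definition bosonic_op ::
  "('n::finite \<Rightarrow> ('x \<Rightarrow> real^'n \<Rightarrow> real) \<Rightarrow> 'x \<Rightarrow> real^'n \<Rightarrow> real)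
    \<Rightarrow> nat \<Rightarrow> ('x \<Rightarrow> real^'n \<Rightarrow> real) \<Rightarrow> 'x \<Rightarrow> real^'n \<Rightarrow> real" where
  "bosonic_op d k F = (\<lambda>x u. let m = real CARD('n) in
       (\<Sum>j\<in>UNIV. d j (d j F) x u)
     - 4 * u_Dx d (Du_Dx d F) x u / (m + 2 * real k - 2)
     + 4 * (norm u)\<^sup>2 * Du_Dx d (Du_Dx d F) x u
         / ((m + 2 * real k - 2) * (m + 2 * real k - 4)))"

definition dx :: "'n::finite \<Rightarrow> (real^'n \<Rightarrow> real^'n \<Rightarrow> real) \<Rightarrow> real^'n \<Rightarrow> real^'n \<Rightarrow> real" where
  "dx j F = (\<lambda>x u. partial j (\<lambda>x'. F x' u) x)"

definition dx_distr ::
  "'n::finite \<Rightarrow> ((real^'n \<Rightarrow> real) \<Rightarrow> real^'n \<Rightarrow> real) \<Rightarrow> (real^'n \<Rightarrow> real) \<Rightarrow> real^'n \<Rightarrow> real" where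
  "dx_distr j T = (\<lambda>\<phi> u. - T (partial j \<phi>) u)"

definition bosonic_laplacian ::
  "nat \<Rightarrow> (real^'n::finite \<Rightarrow> real^'n \<Rightarrow> real) \<Rightarrow> real^'n \<Rightarrow> real^'n \<Rightarrow> real" where
  "bosonic_laplacian = bosonic_op dx"

definition bosonic_laplacian_distr ::
  "nat \<Rightarrow> ((real^'n::finite \<Rightarrow> real) \<Rightarrow> real^'n \<Rightarrow> real) \<Rightarrow> (real^'n \<Rightarrow> real) \<Rightarrow> real^'n \<Rightarrow> real" where
  "bosonic_laplacian_distr = bosonic_op dx_distr"

section \<open>Surface measure, reproducing kernel, fundamental solution\<close>

text \<open>The unnormalized surface measure on the unit sphere, obtained from Lebesgue measure by
  polar coordinates: \<open>\<sigma>(A) = m \<cdot> vol {x. 0 < |x| < 1, x/|x| \<in> A}\<close>. It is a Borel measure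
  on the whole space, concentrated on the sphere; the excluded point \<open>0\<close> is null.\<close>

definition sphere_measure :: "(real^'n::finite) measure" where
  "sphere_measure = scale_measure (of_nat CARD('n))
     (distr (restrict_space lborel (ball 0 1 - {0})) borel (\<lambda>x. x /\<^sub>R norm x))"

lemma emeasure_sphere_measure:
  fixes A :: "(real^'n::finite) set"
  assumes "A \<in> sets borel"
  shows "emeasure sphere_measure A =
    of_nat CARD('n) * emeasure lborel {x. x \<noteq> 0 \<and> norm x < 1 \<and> x /\<^sub>R norm x \<in> A}"
proof -
  let ?B = "ball 0 1 - {0} :: (real^'n) set"
  have m: "(\<lambda>x. x /\<^sub>R norm x) \<in> measurable (restrict_space lborel ?B) (borel :: (real^'n) measure)"
    by (intro measurable_restrict_space1) auto
  have "(\<lambda>x. x /\<^sub>R norm x) -` A \<inter> space (restrict_space lborel ?B)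
      = {x. x \<noteq> 0 \<and> norm x < 1 \<and> x /\<^sub>R norm x \<in> A}"
    by (auto simp: space_restrict_space)
  then show ?thesis
    using m assms
    by (simp add: sphere_measure_def emeasure_distr emeasure_restrict_space)
       (subst emeasure_restrict_space, auto)
qed

text \<open>The kernel is harmonic in its first argument and, by uniqueness, determined for all
  vectors \<open>u\<close>, \<open>v\<close>, not only those on the sphere.\<close>

definition repr_kernel :: "nat \<Rightarrow> real^'n::finite \<Rightarrow> real^'n \<Rightarrow> real" where
  "repr_kernel k = (THE Z. \<forall>v. (\<lambda>u. Z u v) \<in> harm_poly k \<and>
     (\<forall>h\<in>harm_poly k. h v = (LINT u|sphere_measure. Z u v * h u)))"

text \<open>For \<open>a \<noteq> 0\<close> this is the Clifford product \<open>a u a / |a|\<^sup>2\<close>, i.e. the reflection of \<open>u\<close> in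
  the hyperplane orthogonal to \<open>a\<close>.\<close>

definition clifford_reflect :: "real^'n::finite \<Rightarrow> real^'n \<Rightarrow> real^'n" where
  "clifford_reflect a u = u - (2 * (a \<bullet> u) / (norm a)\<^sup>2) *\<^sub>R a"

definition unnormalized_kernel ::
  "nat \<Rightarrow> real^'n::finite \<Rightarrow> real^'n \<Rightarrow> real^'n \<Rightarrow> real^'n \<Rightarrow> real" where
  "unnormalized_kernel k x y u v =
     norm (y - x) powr (2 - real CARD('n)) * repr_kernel k (clifford_reflect (y - x) u) v"

text \<open>\<open>K x y u v\<close> satisfies \<open>\<D>\<^sub>k K = \<delta>(y - x) Z\<^sub>k(u, v)\<close>: for fixed \<open>y\<close> and \<open>v\<close> this is an
  identity of distributions in \<open>x\<close> depending on the parameter \<open>u\<close>.\<close>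

definition is_fundamental_solution ::
  "nat \<Rightarrow> (real^'n::finite \<Rightarrow> real^'n \<Rightarrow> real^'n \<Rightarrow> real^'n \<Rightarrow> real) \<Rightarrow> bool" where
  "is_fundamental_solution k K \<longleftrightarrow>
     (\<forall>y v. \<forall>\<phi>\<in>test_functions. \<forall>u.
        bosonic_laplacian_distr k (\<lambda>\<psi> u. LINT x|lborel. K x y u v * \<psi> x) \<phi> u
          = \<phi> y * repr_kernel k u v)"

definition norm_const :: "'n::finite itself \<Rightarrow> nat \<Rightarrow> real" where
  "norm_const _ k = (THE c. is_fundamental_solution k
     (\<lambda>x y u v :: real^'n. c * unnormalized_kernel k x y u v))"

definition fundamental_solution ::
  "nat \<Rightarrow> real^'n::finite \<Rightarrow> real^'n \<Rightarrow> real^'n \<Rightarrow> real^'n \<Rightarrow> real" where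
  "fundamental_solution k x y u v = norm_const TYPE('n) k * unnormalized_kernel k x y u v"

end

theory Submission
  imports Defs
begin

text \<open>Integrating the reproducing kernel over the sphere turns the inner integral into
  \<open>|a|\<^bsup>2-m\<^esup> f(y + a, R\<^sub>a v)\<close>, where \<open>a = x - y\<close> and \<open>R\<^sub>a\<close> is the reflection along \<open>a\<close>. After expansion in a
  basis of \<open>\<H>\<^sub>k\<close>, the action of \<open>\<D>\<^sub>k\<close> under this integral is a sum of terms
  \<open>M\<^sub>i\<^sub>j(a) \<partial>\<^sub>i\<partial>\<^sub>j\<phi>(y + a)\<close> with kernels \<open>M\<^sub>i\<^sub>j\<close> homogeneous of degree \<open>2 - m\<close>. The flux
  \<open>J\<^sub>j = \<Sum>\<^sub>i \<partial>\<^sub>iM\<^sub>i\<^sub>j\<close> is divergence free off the origin, so integrating by parts twice against a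
  radial cutoff at scales \<open>\<epsilon>\<close> and \<open>R\<close> leaves two boundary terms. The inner one tends to a constant
  times \<open>\<phi>(y) p(v)\<close>; the constant is found by deforming the reflection to the identity and is
  nonzero because \<open>m > 4\<close>. This gives the fundamental solution, hence its normalisation, and also
  the representation of a bounded solution up to the outer boundary term. For a bounded \<open>g\<close> the
  difference of the outer terms at \<open>y\<close> and at \<open>0\<close> tends to \<open>0\<close> as \<open>R \<rightarrow> \<infinity>\<close>, so the remainder does
  not depend on \<open>y\<close>.\<close>

text \<open>The operator is met in two positions. In the representation formula it acts on the
  solution and is evaluated at the reflected vector, which gives \<open>kerA\<close>; in the
  equation for the fundamental solution it acts on the reflected reproducing kernel, and the chain
  rule gives \<open>kerB\<close>. The kernels differ, but their fluxes have the same radial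
  component, \<open>flux_density\<close>; this is why the normalising constant found with
  \<open>kerB\<close> is the one that \<open>kerA\<close> requires. Boundary integrals in
  \<open>x\<close> never occur: derivatives of a smooth cutoff take their place, so that translation
  and scaling of Lebesgue measure and the vanishing of the integral of a derivative suffice. By
  homogeneity the cutoff leaves the same compactly supported function \<open>K\<close> at every
  scale. At scale \<open>R\<close> a shift by \<open>y\<close> becomes a shift of \<open>K\<close>
  by \<open>y / R\<close>; hence boundedness of the solution is enough at infinity, without gradient
  estimates. The constant equals \<open>- (m - 2) * (m - 4) / (m + 2 * k - 4)\<close> times the area
  of the unit sphere; the argument needs only that it is nonzero.\<close>

section \<open>Gradients and partial derivatives of polynomials\<close>

definition grad :: "(real^'n::finite \<Rightarrow> real) \<Rightarrow> real^'n \<Rightarrow> real^'n" where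
  "grad q x = (\<chi> j. partial j q x)"

lemma GDERIV_I:
  "(f has_derivative f') (at x) \<Longrightarrow> (\<And>h. f' h = h \<bullet> D) \<Longrightarrow> GDERIV f x :> D"
  unfolding gderiv_def by (metis ext)

text \<open>The inner map keeps a Frechet derivative because it is a curve at some uses and a map
  between vector spaces at others.\<close>

lemma GDERIV_chain:
  assumes "GDERIV f (g x) :> D" "(g has_derivative g') (at x)"
  shows "((\<lambda>x. f (g x)) has_derivative (\<lambda>h. g' h \<bullet> D)) (at x)"
  using has_derivative_compose[OF assms(2) assms(1)[unfolded gderiv_def]] .

lemma partial_GDERIV:
  assumes "GDERIV f x :> D"
  shows "partial j f x = D $ j"
    and "((\<lambda>t. f (x + t *\<^sub>R axis j 1)) has_real_derivative D $ j) (at 0)"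
proof -
  have "((\<lambda>t. f (x + t *\<^sub>R axis j 1)) has_derivative (\<lambda>h. (h *\<^sub>R axis j 1) \<bullet> D)) (at 0)"
    by (rule GDERIV_chain[of f "\<lambda>t. x + t *\<^sub>R axis j 1"])
      (use assms in \<open>auto intro!: derivative_eq_intros\<close>)
  moreover have "(\<lambda>h. (h *\<^sub>R axis j 1) \<bullet> D) = (*) (D $ j)"
    by (auto simp: inner_axis' fun_eq_iff)
  ultimately show *: "((\<lambda>t. f (x + t *\<^sub>R axis j 1)) has_real_derivative D $ j) (at 0)"
    by (simp add: has_field_derivative_def)
  show "partial j f x = D $ j"
    unfolding partial_def by (rule DERIV_imp_deriv[OF *])
qed

lemma grad_GDERIV: "GDERIV f x :> D \<Longrightarrow> grad f x = D"
  by (simp add: grad_def partial_GDERIV vec_eq_iff)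

lemma real_polynomial_function_grad:
  assumes "real_polynomial_function (q :: real^'n::finite \<Rightarrow> real)"
  shows "GDERIV q x :> grad q x" and "real_polynomial_function (partial j q)"
proof -
  have "(\<forall>x. GDERIV q x :> grad q x) \<and> (\<forall>j. real_polynomial_function (partial j q))"
    using assms
  proof induction
    case (linear f)
    have *: "GDERIV f x :> (\<chi> j. f (axis j 1))" for x
    proof (rule GDERIV_I[where f' = f])
      show "(f has_derivative f) (at x)"
        by (rule bounded_linear_imp_has_derivative[OF linear])
      fix h :: "real^'n"
      have "f h = f (\<Sum>j\<in>UNIV. (h $ j) *\<^sub>R axis j 1)"
        by (subst basis_expansion[symmetric]) (simp add: scalar_mult_eq_scaleR)
      also have "\<dots> = (\<Sum>j\<in>UNIV. h $ j * f (axis j 1))"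
        using linear by (simp add: bounded_linear.linear linear_sum linear_scale o_def)
      finally show "f h = h \<bullet> (\<chi> j. f (axis j 1))"
        by (simp add: inner_vec_def)
    qed
    have "partial j f = (\<lambda>x. f (axis j 1))" for j
      using partial_GDERIV(1)[OF *] by auto
    then show ?case
      using * by (auto simp: grad_GDERIV[OF *])
  next
    case (const c)
    have *: "GDERIV (\<lambda>x. c) x :> 0" for x :: "real^'n" by (rule GDERIV_const)
    have "partial j (\<lambda>x. c) = (\<lambda>x :: real^'n. 0)" for j
      using partial_GDERIV(1)[OF *] by auto
    then show ?case
      using * by (auto simp: grad_GDERIV[OF *])
  next
    case (add f g)
    have *: "GDERIV (\<lambda>x. f x + g x) x :> grad f x + grad g x" for x
      using add by (auto intro: GDERIV_add)
    have "partial j (\<lambda>x. f x + g x) = (\<lambda>x. partial j f x + partial j g x)" for j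
      using partial_GDERIV(1)[OF *] by (auto simp: grad_def)
    then show ?case
      using * add by (auto simp: grad_GDERIV[OF *])
  next
    case (mult f g)
    have *: "GDERIV (\<lambda>x. f x * g x) x :> f x *\<^sub>R grad g x + g x *\<^sub>R grad f x" for x
      using mult by (auto intro: GDERIV_mult)
    have "partial j (\<lambda>x. f x * g x) = (\<lambda>x. f x * partial j g x + g x * partial j f x)" for j
      using partial_GDERIV(1)[OF *] by (auto simp: grad_def)
    then show ?case
      using * mult by (auto simp: grad_GDERIV[OF *] intro!: real_polynomial_function.intros(3,4))
  qed
  then show "GDERIV q x :> grad q x" and "real_polynomial_function (partial j q)"
    by auto
qed

lemma poly_continuous:
  assumes "real_polynomial_function q" "continuous_on S f"
  shows "continuous_on S (\<lambda>x. q (f x))"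
proof (rule continuous_on_compose2[OF _ assms(2) subset_UNIV])
  show "continuous_on UNIV q"
    using assms(1) by (simp add: continuous_polymonial_function continuous_at_imp_continuous_on
        real_polynomial_function_eq)
qed

lemma partial_ops:
  assumes "GDERIV f x :> grad f x" "GDERIV g x :> grad g x"
  shows "partial j (\<lambda>x. f x + g x) x = partial j f x + partial j g x"
    and "partial j (\<lambda>x. f x - g x) x = partial j f x - partial j g x"
    and "partial j (\<lambda>x. f x * g x) x = f x * partial j g x + g x * partial j f x"
  using partial_GDERIV(1)[OF GDERIV_add[OF assms]] partial_GDERIV(1)[OF GDERIV_diff[OF assms]]
    partial_GDERIV(1)[OF GDERIV_mult[OF assms]]
  by (simp_all add: grad_def)

lemmas partial_poly_ops =
  partial_ops[OF real_polynomial_function_grad(1) real_polynomial_function_grad(1)]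

lemma partial_const [simp]: "partial j (\<lambda>x. c) = (\<lambda>x. 0)"
  using partial_GDERIV(1)[OF GDERIV_const[of c]] by auto

lemma partial_linear: "bounded_linear f \<Longrightarrow> partial j f = (\<lambda>x. f (axis j 1))"
  by (rule ext, subst partial_def, rule DERIV_imp_deriv)
     (auto simp: bounded_linear.linear linear_add linear_scale intro!: derivative_eq_intros)

lemma partial_cmult:
  "real_polynomial_function q \<Longrightarrow> partial j (\<lambda>x. c * q x) = (\<lambda>x. c * partial j q x)"
  by (rule ext, subst partial_poly_ops(3)) auto

lemma partial_sum_poly:
  assumes "\<And>i. i \<in> I \<Longrightarrow> real_polynomial_function (q i)"
  shows "partial j (\<lambda>x. \<Sum>i\<in>I. q i x) = (\<lambda>x. \<Sum>i\<in>I. partial j (q i) x)"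
  using assms
proof (induction I rule: infinite_finite_induct)
  case (insert i I)
  then show ?case
    by (auto simp: partial_poly_ops real_polynomial_function_sum)
qed auto

lemma partial_commute:
  assumes "real_polynomial_function q"
  shows "partial i (partial j q) x = partial j (partial i q) x"
proof -
  have "\<forall>i j x. partial i (partial j q) x = partial j (partial i q) x"
    using assms
  proof induction
    case (linear f)
    then show ?case by (simp add: partial_linear)
  next
    case (const c)
    then show ?case by simp
  next
    case (add f g)
    have "partial j (\<lambda>x. f x + g x) = (\<lambda>x. partial j f x + partial j g x)" for j
      using add by (intro ext partial_poly_ops)
    then show ?case
      using add by (simp add: partial_poly_ops real_polynomial_function_grad)
  next
    case (mult f g)
    have "partial j (\<lambda>x. f x * g x) = (\<lambda>x. f x * partial j g x + g x * partial j f x)" for j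
      using mult by (intro ext partial_poly_ops)
    then show ?case
      using mult by (simp add: partial_poly_ops real_polynomial_function_grad
          real_polynomial_function.intros)
  qed
  then show ?thesis by blast
qed

text \<open>Harmonic homogeneous polynomials of degree \<open>d\<close>, with homogeneity expressed by Euler's
  equation: with a real degree the class is closed under partial derivatives, the degree dropping
  to \<open>d - 1\<close> without truncation at \<open>0\<close>.\<close>

definition euler_harm :: "real \<Rightarrow> (real^'n::finite \<Rightarrow> real) \<Rightarrow> bool" where
  "euler_harm d q \<longleftrightarrow> real_polynomial_function q \<and> (\<forall>x. x \<bullet> grad q x = d * q x) \<and>
     (\<forall>x. laplacian q x = 0)"

lemma euler_harm_poly:
  assumes "euler_harm d q"
  shows "real_polynomial_function q" "real_polynomial_function (partial i q)"
    "real_polynomial_function (partial j (partial i q))"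
  using assms by (simp_all add: euler_harm_def real_polynomial_function_grad(2))

text \<open>Differentiating Euler's equation produces one extra copy of \<open>partial j q\<close>,
  which lowers the degree by one; the Laplacian commutes with \<open>partial j\<close>.\<close>

lemma euler_harm_partial:
  assumes "euler_harm d q"
  shows "euler_harm (d - 1) (partial j q)"
proof -
  have pq: "real_polynomial_function q" and eu: "\<And>x. x \<bullet> grad q x = d * q x"
    and la: "\<And>x. laplacian q x = 0"
    using assms by (auto simp: euler_harm_def)
  note pg = real_polynomial_function_grad
  have comp: "real_polynomial_function (\<lambda>x :: real^'n. x $ l)" for l
    by (intro real_polynomial_function.intros bounded_linear_vec_nth)
  have "(\<lambda>x. \<Sum>l\<in>UNIV. x $ l * partial l q x) = (\<lambda>x. d * q x)"
    using eu by (auto simp: inner_vec_def grad_def)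
  then have "partial j (\<lambda>x. \<Sum>l\<in>UNIV. x $ l * partial l q x) x = partial j (\<lambda>x. d * q x) x" for x
    by simp
  then have "(\<Sum>l\<in>UNIV. x $ l * partial j (partial l q) x + partial l q x * (axis j 1 $ l)) = d * partial j q x" for x
    using pq
    by (simp add: partial_sum_poly partial_cmult real_polynomial_function.intros comp pg partial_poly_ops
        partial_linear[OF bounded_linear_vec_nth])
  moreover have "(\<Sum>l\<in>UNIV. partial l q x * (axis j 1 $ l)) = partial j q x" for x
    by (simp add: axis_def if_distrib cong: if_cong)
  ultimately have "(\<Sum>l\<in>UNIV. x $ l * partial j (partial l q) x) + partial j q x = d * partial j q x" for x
    by (simp add: sum.distrib)
  then have "(\<Sum>l\<in>UNIV. x $ l * partial j (partial l q) x) = (d - 1) * partial j q x" for x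
    by (simp add: left_diff_distrib eq_diff_eq)
  then have e: "x \<bullet> grad (partial j q) x = (d - 1) * partial j q x" for x
    by (simp add: inner_vec_def grad_def partial_commute[OF pq, of _ j])
  have "(\<lambda>x. \<Sum>l\<in>UNIV. partial l (partial l q) x) = (\<lambda>x. 0)"
    using la by (auto simp: laplacian_def)
  then have "partial j (\<lambda>x. \<Sum>l\<in>UNIV. partial l (partial l q) x) x = 0" for x
    by simp
  moreover have "partial j (partial l (partial l q)) x = partial l (partial l (partial j q)) x" for l x
  proof -
    have "partial j (partial l q) = partial l (partial j q)"
      using partial_commute[OF pq] by blast
    then show ?thesis
      by (simp add: partial_commute[OF pg(2)[OF pq], of j l l])
  qed
  ultimately have "laplacian (partial j q) x = 0" for x
    by (simp add: partial_sum_poly pg pq laplacian_def)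
  with e show ?thesis
    by (simp add: euler_harm_def pg pq)
qed

lemma harm_poly_euler:
  assumes "q \<in> harm_poly k"
  shows "euler_harm (real k) q"
proof -
  have pq: "real_polynomial_function q" and h: "\<And>c x. q (c *\<^sub>R x) = c ^ k * q x"
    using assms by (auto simp: harm_poly_def)
  have "x \<bullet> grad q x = real k * q x" for x
  proof -
    have "((\<lambda>c. q (c *\<^sub>R x)) has_derivative (\<lambda>c. (c *\<^sub>R x) \<bullet> grad q x)) (at 1)"
      by (rule GDERIV_chain[of q "\<lambda>c. c *\<^sub>R x"])
        (use real_polynomial_function_grad(1)[OF pq, of x] in
          \<open>auto intro!: derivative_eq_intros\<close>)
    then have "((\<lambda>c. q (c *\<^sub>R x)) has_real_derivative (x \<bullet> grad q x)) (at 1)"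
      by (rule has_derivative_imp_has_field_derivative) simp
    moreover have "((\<lambda>c. q (c *\<^sub>R x)) has_real_derivative (real k * q x)) (at 1)"
      unfolding h by (auto intro!: derivative_eq_intros)
    ultimately show ?thesis by (rule DERIV_unique)
  qed
  then show ?thesis
    using assms by (auto simp: harm_poly_def euler_harm_def)
qed

text \<open>Differentiated homogeneity carries a factor \<open>c\<close> on both sides, so only
  \<open>c \<noteq> 0\<close> is immediate; the value \<open>c = 0\<close> follows by continuity in
  \<open>c\<close>.\<close>

lemma harm_poly_partial:
  assumes "q \<in> harm_poly (Suc k)"
  shows "partial j q \<in> harm_poly k"
proof -
  have pq: "real_polynomial_function q" and h: "\<And>c x. q (c *\<^sub>R x) = c ^ Suc k * q x"
    using assms by (auto simp: harm_poly_def)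
  note pp = real_polynomial_function_grad(2)[OF pq, of j]
  have nz: "partial j q (c *\<^sub>R x) = c ^ k * partial j q x" if "c \<noteq> 0" for c x
  proof -
    have g: "GDERIV (\<lambda>x. q (c *\<^sub>R x)) x :> c *\<^sub>R grad q (c *\<^sub>R x)"
    proof (rule GDERIV_I)
      show "((\<lambda>x. q (c *\<^sub>R x)) has_derivative (\<lambda>h. (c *\<^sub>R h) \<bullet> grad q (c *\<^sub>R x))) (at x)"
        by (rule GDERIV_chain[of q "\<lambda>x. c *\<^sub>R x"])
          (use real_polynomial_function_grad(1)[OF pq, of "c *\<^sub>R x"] in
            \<open>auto intro!: derivative_eq_intros\<close>)
    qed auto
    have "c * partial j q (c *\<^sub>R x) = partial j (\<lambda>x. q (c *\<^sub>R x)) x"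
      using partial_GDERIV(1)[OF g] by (simp add: grad_def)
    also have "\<dots> = c ^ Suc k * partial j q x"
      unfolding h by (simp add: partial_cmult pq del: power_Suc)
    finally show ?thesis using that by simp
  qed
  have "partial j q (c *\<^sub>R x) = c ^ k * partial j q x" for c x
  proof (cases "c = 0")
    case True
    have "continuous_on UNIV (\<lambda>c. partial j q (c *\<^sub>R x) - c ^ k * partial j q x)"
      by (intro continuous_intros poly_continuous[OF pp])
    then have cont: "isCont (\<lambda>c. partial j q (c *\<^sub>R x) - c ^ k * partial j q x) 0"
      by (simp add: continuous_on_eq_continuous_at)
    have "((\<lambda>c. partial j q (c *\<^sub>R x) - c ^ k * partial j q x) \<longlongrightarrow> 0) (at 0)"
      by (rule tendsto_eventually) (auto simp: eventually_at_filter nz)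
    with cont have "partial j q (0 *\<^sub>R x) - 0 ^ k * partial j q x = 0"
      unfolding isCont_def by (rule LIM_unique)
    with True show ?thesis by simp
  qed (rule nz)
  moreover have "laplacian (partial j q) x = 0" for x
    using euler_harm_partial[OF harm_poly_euler[OF assms]] by (simp add: euler_harm_def)
  ultimately show ?thesis
    using pp by (simp add: harm_poly_def)
qed

section \<open>Functions smooth off the origin\<close>

text \<open>An algebra of explicit functions stands in for smoothness off the origin: closure under
  \<open>partial\<close> is then an induction. The rule \<open>smooth0_cong\<close> leaves the value
  at the origin free, which absorbs the conventions for \<open>powr\<close> and division at
  zero.\<close>

inductive smooth0 :: "(real^'n::finite \<Rightarrow> real) \<Rightarrow> bool" where
  smooth0_powr: "smooth0 (\<lambda>a. norm a powr c)"
| smooth0_poly: "real_polynomial_function P \<Longrightarrow> smooth0 P"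
| smooth0_add: "smooth0 f \<Longrightarrow> smooth0 g \<Longrightarrow> smooth0 (\<lambda>a. f a + g a)"
| smooth0_mult: "smooth0 f \<Longrightarrow> smooth0 g \<Longrightarrow> smooth0 (\<lambda>a. f a * g a)"
| smooth0_cong: "smooth0 f \<Longrightarrow> (\<And>a. a \<noteq> 0 \<Longrightarrow> g a = f a) \<Longrightarrow> smooth0 g"

lemma norm_powr_minus_2: "norm (a::real^'n::finite) powr (c - 2) = norm a powr c / (a \<bullet> a)"
  by (cases "a = 0") (auto simp: powr_diff dot_square_norm powr_realpow)

lemma GDERIV_norm_powr:
  fixes a :: "real^'n::finite"
  assumes "a \<noteq> 0"
  shows "GDERIV (\<lambda>a. norm a powr c) a :> (c * norm a powr c / (a \<bullet> a)) *\<^sub>R a"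
proof -
  have "GDERIV (\<lambda>a. norm a powr c) a :> (c * norm a powr (c - 1)) *\<^sub>R sgn a"
    using assms by (intro GDERIV_DERIV_compose[OF GDERIV_norm]) (auto intro: has_real_derivative_powr)
  moreover have "(c * norm a powr (c - 1)) *\<^sub>R sgn a = (c * norm a powr c / (a \<bullet> a)) *\<^sub>R a"
    using assms by (simp add: sgn_div_norm powr_diff dot_square_norm power2_eq_square divide_inverse)
  ultimately show ?thesis by simp
qed

lemma GDERIV_cong:
  assumes "GDERIV f a :> D" "a \<noteq> 0" "\<And>b. b \<noteq> 0 \<Longrightarrow> g b = f b"
  shows "GDERIV g a :> D"
  unfolding gderiv_def
  by (rule has_derivative_transform_within_open[OF assms(1)[unfolded gderiv_def], of "- {0}"])
     (use assms in auto)

lemma smooth0_GDERIV_aux: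
  assumes "smooth0 f"
  shows "(\<forall>a. a \<noteq> 0 \<longrightarrow> GDERIV f a :> grad f a) \<and> (\<forall>i. smooth0 (partial i f))"
  using assms
proof induction
  case (smooth0_powr c)
  have *: "GDERIV (\<lambda>a::real^'n. norm a powr c) a :> (c * norm a powr (c - 2)) *\<^sub>R a" if "a \<noteq> 0" for a
    using GDERIV_norm_powr[OF that, of c] by (simp add: norm_powr_minus_2)
  have "smooth0 (\<lambda>a :: real^'n. (c * a $ i) * norm a powr (c - 2))" for i
    by (intro smooth0.intros real_polynomial_function.intros bounded_linear_vec_nth)
  then have "smooth0 (partial i (\<lambda>a::real^'n. norm a powr c))" for i
    by (rule smooth0_cong[where f = "\<lambda>a. (c * a $ i) * norm a powr (c - 2)"])
      (use partial_GDERIV(1)[OF *] in \<open>simp add: mult_ac\<close>)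
  then show ?case
    using * by (auto simp: grad_GDERIV[OF *])
next
  case (smooth0_poly P)
  then show ?case by (auto intro: smooth0.intros real_polynomial_function_grad)
next
  case (smooth0_add f g)
  have *: "GDERIV (\<lambda>a. f a + g a) a :> grad f a + grad g a" if "a \<noteq> 0" for a
    using smooth0_add that by (auto intro: GDERIV_add)
  have "smooth0 (\<lambda>a. partial i f a + partial i g a)" for i
    using smooth0_add by (auto intro: smooth0.intros)
  then have "smooth0 (partial i (\<lambda>a. f a + g a))" for i
    by (rule smooth0_cong) (use partial_GDERIV(1)[OF *] in \<open>simp add: grad_def\<close>)
  then show ?case
    using * by (auto simp: grad_GDERIV[OF *])
next
  case (smooth0_mult f g)
  have *: "GDERIV (\<lambda>a. f a * g a) a :> f a *\<^sub>R grad g a + g a *\<^sub>R grad f a" if "a \<noteq> 0" for a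
    using smooth0_mult that by (auto intro: GDERIV_mult)
  have "smooth0 (\<lambda>a. f a * partial i g a + g a * partial i f a)" for i
    using smooth0_mult by (auto intro!: smooth0.smooth0_mult smooth0.smooth0_add)
  then have "smooth0 (partial i (\<lambda>a. f a * g a))" for i
    by (rule smooth0_cong) (use partial_GDERIV(1)[OF *] in \<open>simp add: grad_def\<close>)
  then show ?case
    using * by (auto simp: grad_GDERIV[OF *])
next
  case (smooth0_cong f g)
  have *: "GDERIV g a :> grad f a" if "a \<noteq> 0" for a
    using smooth0_cong that by (auto intro: GDERIV_cong)
  have "smooth0 (partial i g)" for i
    by (rule smooth0.smooth0_cong[of "partial i f"])
      (use smooth0_cong partial_GDERIV(1)[OF *] in \<open>auto simp: grad_def\<close>)
  then show ?case
    using * by (auto simp: grad_GDERIV[OF *])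
qed

lemma smooth0_GDERIV: "smooth0 f \<Longrightarrow> a \<noteq> 0 \<Longrightarrow> GDERIV f a :> grad f a"
  and smooth0_partial: "smooth0 f \<Longrightarrow> smooth0 (partial i f)"
  using smooth0_GDERIV_aux by blast+

lemma smooth0_continuous: "smooth0 f \<Longrightarrow> continuous_on (- {0}) f"
  by (rule continuous_at_imp_continuous_on)
     (auto dest!: smooth0_GDERIV simp: gderiv_def intro: has_derivative_continuous)

lemma smooth0_const: "smooth0 (\<lambda>a. c)"
  by (intro smooth0_poly real_polynomial_function.intros)

lemma smooth0_nth: "smooth0 (\<lambda>a. a $ i)"
  by (intro smooth0_poly real_polynomial_function.intros bounded_linear_vec_nth)

lemma smooth0_inner: "smooth0 (\<lambda>a. v \<bullet> a)"
  by (intro smooth0_poly real_polynomial_function.intros bounded_linear_inner_right)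

lemma smooth0_inv: "smooth0 (\<lambda>a. 1 / (a \<bullet> a))"
  by (rule smooth0_cong[OF smooth0_powr[of "-2"]])
     (simp add: powr_minus dot_square_norm powr_realpow divide_simps)

lemma smooth0_divide: "smooth0 f \<Longrightarrow> smooth0 (\<lambda>a. f a / (a \<bullet> a))"
  using smooth0_mult[OF _ smooth0_inv, of f] by simp

lemma smooth0_minus: "smooth0 f \<Longrightarrow> smooth0 (\<lambda>a. - f a)"
  using smooth0_mult[OF smooth0_const[of "-1"], of f] by simp

lemma smooth0_diff: "smooth0 f \<Longrightarrow> smooth0 g \<Longrightarrow> smooth0 (\<lambda>a. f a - g a)"
  using smooth0_add[OF _ smooth0_minus, of f g] by simp

lemma smooth0_sum: "(\<And>i. i \<in> I \<Longrightarrow> smooth0 (f i)) \<Longrightarrow> smooth0 (\<lambda>a. \<Sum>i\<in>I. f i a)"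
  by (induction I rule: infinite_finite_induct) (auto intro: smooth0_const smooth0_add)

lemmas smooth0_intros = smooth0_const smooth0_nth smooth0_inner smooth0_divide smooth0_minus
  smooth0_diff smooth0_sum smooth0_add smooth0_mult smooth0_powr

lemma partial_smooth0:
  assumes "smooth0 f" "smooth0 g" "a \<noteq> 0"
  shows "partial j (\<lambda>x. f x + g x) a = partial j f a + partial j g a"
    and "partial j (\<lambda>x. f x - g x) a = partial j f a - partial j g a"
    and "partial j (\<lambda>x. f x * g x) a = f a * partial j g a + g a * partial j f a"
  using partial_ops[OF smooth0_GDERIV smooth0_GDERIV] assms by blast+

lemma partial_smooth0_sum:
  assumes "\<And>i. i \<in> I \<Longrightarrow> smooth0 (f i)" "a \<noteq> 0"
  shows "partial j (\<lambda>x. \<Sum>i\<in>I. f i x) a = (\<Sum>i\<in>I. partial j (f i) a)"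
  using assms
  by (induction I rule: infinite_finite_induct) (auto simp: partial_smooth0 smooth0_sum)

lemma partial_smooth0_cmult:
  "smooth0 f \<Longrightarrow> a \<noteq> 0 \<Longrightarrow> partial j (\<lambda>x. c * f x) a = c * partial j f a"
  by (subst partial_smooth0(3)) (auto intro: smooth0_intros)

lemma partial_nth: "partial j (\<lambda>x. x $ i) = (\<lambda>a. axis j 1 $ i)"
  by (rule partial_linear[OF bounded_linear_vec_nth])

lemma partial_inner: "partial j (\<lambda>x. v \<bullet> x) = (\<lambda>a. v $ j)"
  by (subst partial_linear[OF bounded_linear_inner_right]) (simp add: inner_axis)

lemma partial_norm_powr:
  "a \<noteq> 0 \<Longrightarrow> partial j (\<lambda>a. norm a powr c) a = c * norm a powr c / (a \<bullet> a) * a $ j"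
  by (subst partial_GDERIV(1)[OF GDERIV_norm_powr]) auto

lemma partial_cong0:
  assumes "a \<noteq> 0" "\<And>b. b \<noteq> 0 \<Longrightarrow> f b = g b" "smooth0 f"
  shows "partial j f a = partial j g a"
proof -
  have "GDERIV g a :> grad f a"
    using GDERIV_cong[OF smooth0_GDERIV[OF assms(3,1)] assms(1)] assms(2) by metis
  from partial_GDERIV(1)[OF this] show ?thesis by (simp add: grad_def)
qed

section \<open>Homogeneous functions off the origin\<close>

definition homog0 :: "real \<Rightarrow> (real^'n::finite \<Rightarrow> real) \<Rightarrow> bool" where
  "homog0 c f \<longleftrightarrow> (\<forall>t a. t > 0 \<longrightarrow> a \<noteq> 0 \<longrightarrow> f (t *\<^sub>R a) = t powr c * f a)"

lemma homog0_partial: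
  fixes f :: "real^'n::finite \<Rightarrow> real"
  assumes "smooth0 f" "homog0 c f"
  shows "homog0 (c - 1) (partial j f)"
  unfolding homog0_def
proof (intro allI impI)
  fix t :: real and a :: "real^'n" assume t: "t > 0" and a: "a \<noteq> 0"
  have "GDERIV (\<lambda>a. f (t *\<^sub>R a)) a :> t *\<^sub>R grad f (t *\<^sub>R a)"
  proof (rule GDERIV_I)
    show "((\<lambda>a. f (t *\<^sub>R a)) has_derivative (\<lambda>h. (t *\<^sub>R h) \<bullet> grad f (t *\<^sub>R a))) (at a)"
      by (rule GDERIV_chain[of f "\<lambda>a. t *\<^sub>R a"])
        (use smooth0_GDERIV[OF assms(1), of "t *\<^sub>R a"] t a in \<open>auto intro!: derivative_eq_intros\<close>)
  qed auto
  then have 1: "partial j (\<lambda>a. f (t *\<^sub>R a)) a = t * partial j f (t *\<^sub>R a)"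
    by (simp add: partial_GDERIV(1) grad_def)
  have "GDERIV (\<lambda>a. f (t *\<^sub>R a)) a :> grad (\<lambda>a. t powr c * f a) a"
    by (rule GDERIV_cong[OF smooth0_GDERIV])
      (use assms(2) t a in \<open>auto intro!: smooth0_intros assms simp: homog0_def\<close>)
  then have 2: "partial j (\<lambda>a. f (t *\<^sub>R a)) a = t powr c * partial j f a"
    using partial_smooth0_cmult[OF assms(1) a] by (simp add: partial_GDERIV(1) grad_def)
  show "partial j f (t *\<^sub>R a) = t powr (c - 1) * partial j f a"
    using 1 2 t by (simp add: powr_diff field_simps)
qed

lemma homog0_euler:
  assumes "smooth0 f" "homog0 c f" "a \<noteq> 0"
  shows "a \<bullet> grad f a = c * f a"
proof -
  have "((\<lambda>t. f (t *\<^sub>R a)) has_derivative (\<lambda>h. (h *\<^sub>R a) \<bullet> grad f a)) (at 1)"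
    by (rule GDERIV_chain[of f "\<lambda>t. t *\<^sub>R a"])
      (use smooth0_GDERIV[OF assms(1,3)] in \<open>auto intro!: derivative_eq_intros\<close>)
  then have "((\<lambda>t. f (t *\<^sub>R a)) has_real_derivative (a \<bullet> grad f a)) (at 1)"
    by (rule has_derivative_imp_has_field_derivative) simp
  then have "((\<lambda>t. t powr c * f a) has_real_derivative (a \<bullet> grad f a)) (at 1)"
    by (rule has_field_derivative_transform_within_open[of _ _ _ "{0<..}"])
      (use assms in \<open>auto simp: homog0_def\<close>)
  moreover have "((\<lambda>t. t powr c * f a) has_real_derivative c * f a) (at 1)"
    by (auto intro!: derivative_eq_intros)
  ultimately show ?thesis by (rule DERIV_unique)
qed

lemma homog0_mult: "homog0 c f \<Longrightarrow> homog0 d g \<Longrightarrow> homog0 (c + d) (\<lambda>a. f a * g a)"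
  by (auto simp: homog0_def powr_add)

lemma homog0_add: "homog0 c f \<Longrightarrow> homog0 c g \<Longrightarrow> homog0 c (\<lambda>a. f a + g a)"
  by (auto simp: homog0_def algebra_simps)

lemma homog0_cmult: "homog0 c f \<Longrightarrow> homog0 c (\<lambda>a. r * f a)"
  by (auto simp: homog0_def)

lemma homog0_divide: "homog0 c f \<Longrightarrow> homog0 (c - 2) (\<lambda>a. f a / (a \<bullet> a))"
  by (auto simp: homog0_def powr_diff powr_realpow power2_eq_square)

lemma homog0_sum: "(\<And>i. i \<in> I \<Longrightarrow> homog0 c (f i)) \<Longrightarrow> homog0 c (\<lambda>a. \<Sum>i\<in>I. f i a)"
  by (auto simp: homog0_def sum_distrib_left)

lemma homog0_powr: "homog0 c (\<lambda>a. norm a powr c)"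
  by (auto simp: homog0_def powr_mult)

lemma homog0_nth: "homog0 1 (\<lambda>a. a $ i)"
  by (auto simp: homog0_def)

lemma homog0_inner: "homog0 1 (\<lambda>a. v \<bullet> a)"
  by (auto simp: homog0_def)

text \<open>Euler's relation again. In degree \<open>- m\<close> the field
  \<open>a $ i * f a\<close> is divergence free, the case on which the averages below rest.\<close>

lemma div_radial:
  fixes f :: "real^'n::finite \<Rightarrow> real"
  assumes "smooth0 f" "homog0 c f" "a \<noteq> 0"
  shows "(\<Sum>i\<in>UNIV. partial i (\<lambda>a. a $ i * f a) a) = (real CARD('n) + c) * f a"
proof -
  have "(\<Sum>i\<in>UNIV. partial i (\<lambda>a. a $ i * f a) a) =
      (\<Sum>i\<in>UNIV. a $ i * partial i f a + f a)"
    using assms by (intro sum.cong) (auto simp: partial_smooth0 smooth0_intros partial_nth axis_def)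
  also have "\<dots> = a \<bullet> grad f a + real CARD('n) * f a"
    by (simp add: sum.distrib inner_vec_def grad_def)
  finally show ?thesis
    using homog0_euler[OF assms] by (simp add: algebra_simps)
qed

section \<open>Polynomials of a reflected argument\<close>

text \<open>For \<open>t = 2\<close> this is the reflection; the parameter \<open>t\<close> deforms it to the identity.\<close>

definition tilt :: "real \<Rightarrow> real^'n::finite \<Rightarrow> real^'n \<Rightarrow> real^'n" where
  "tilt t v a = v - (t * (v \<bullet> a) / (a \<bullet> a)) *\<^sub>R a"

lemma tilt_2: "tilt 2 v a = clifford_reflect a v"
  by (simp add: tilt_def clifford_reflect_def dot_square_norm inner_commute)

lemma smooth0_tilt:
  assumes "real_polynomial_function q"
  shows "smooth0 (\<lambda>a. q (tilt t v a))"
  using assms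
proof induction
  case (linear f)
  have "(\<lambda>a. f (tilt t v a)) = (\<lambda>a. f v - (t * (v \<bullet> a) / (a \<bullet> a)) * f a)"
    using linear by (auto simp: tilt_def bounded_linear.linear linear_diff linear_scale)
  moreover have "smooth0 (\<lambda>a. f v - (t * (v \<bullet> a) / (a \<bullet> a)) * f a)"
    using linear by (intro smooth0_intros smooth0_poly real_polynomial_function.intros)
  ultimately show ?case by simp
qed (auto intro: smooth0_intros)

lemma homog0_tilt: "homog0 0 (\<lambda>a. q (tilt t v a))"
  by (auto simp: homog0_def tilt_def)

section \<open>Directional derivatives at a tilted argument\<close>

text \<open>The derivatives of \<open>q\<close> at \<open>w\<close> in the direction
  \<open>a\<close>, of first order here and of second order in \<open>D2\<close>. Base point and
  direction are separate arguments because the base point will be \<open>tilt t v a\<close>, itself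
  a function of \<open>a\<close>.\<close>

definition D1 :: "(real^'n::finite \<Rightarrow> real) \<Rightarrow> real^'n \<Rightarrow> real^'n \<Rightarrow> real" where
  "D1 q w a = (\<Sum>l\<in>UNIV. a $ l * partial l q w)"

definition D2 :: "(real^'n::finite \<Rightarrow> real) \<Rightarrow> real^'n \<Rightarrow> real^'n \<Rightarrow> real" where
  "D2 q w a = (\<Sum>l\<in>UNIV. a $ l * D1 (partial l q) w a)"

lemma D1_inner: "D1 q w a = a \<bullet> grad q w"
  by (simp add: D1_def inner_vec_def grad_def)

lemma smooth0_D1: "real_polynomial_function q \<Longrightarrow> smooth0 (\<lambda>a. D1 q (tilt t v a) a)"
  unfolding D1_def by (intro smooth0_intros smooth0_tilt real_polynomial_function_grad)

lemma smooth0_D2: "real_polynomial_function q \<Longrightarrow> smooth0 (\<lambda>a. D2 q (tilt t v a) a)"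
  unfolding D2_def by (intro smooth0_intros smooth0_D1 real_polynomial_function_grad)

lemma homog0_D1: "homog0 1 (\<lambda>a. D1 q (tilt t v a) a)"
  using homog0_sum[OF homog0_mult[OF homog0_nth homog0_tilt]] by (simp add: D1_def)

lemma homog0_D2: "homog0 2 (\<lambda>a. D2 q (tilt t v a) a)"
  using homog0_sum[OF homog0_mult[OF homog0_nth homog0_D1]] by (simp add: D2_def)

lemma partial_tilt:
  assumes q: "real_polynomial_function q" and a: "a \<noteq> 0"
  shows "partial j (\<lambda>a. q (tilt t v a)) a =
    - (t / (a \<bullet> a)) * (D1 q (tilt t v a) a * (v $ j - 2 * (v \<bullet> a) / (a \<bullet> a) * a $ j)
      + (v \<bullet> a) * partial j q (tilt t v a))"
proof -
  let ?w = "tilt t v a" and ?n = "a \<bullet> a" and ?s = "v \<bullet> a"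
  have n: "?n \<noteq> 0" using a by simp
  have "(tilt t v has_derivative (\<lambda>h. - (t / ?n) *\<^sub>R ((v \<bullet> h) *\<^sub>R a + ?s *\<^sub>R h
      - (2 * ?s * (a \<bullet> h) / ?n) *\<^sub>R a))) (at a)"
    unfolding tilt_def using n
    by (auto intro!: derivative_eq_intros ext simp: inner_commute)
       (simp add: vec_eq_iff inner_commute field_simps power2_eq_square)
  note GDERIV_chain[OF real_polynomial_function_grad(1)[OF q] this]
  then have "GDERIV (\<lambda>a. q (tilt t v a)) a :>
    - (t / ?n) *\<^sub>R ((D1 q ?w a) *\<^sub>R (v - (2 * ?s / ?n) *\<^sub>R a) + ?s *\<^sub>R grad q ?w)"
    by (rule GDERIV_I) (simp add: D1_inner inner_simps inner_commute n field_simps)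
  from partial_GDERIV(1)[OF this] show ?thesis
    by (simp add: grad_def)
qed

text \<open>The first term comes from differentiating the direction \<open>a\<close>, the rest from
  the moving base point; commuting partial derivatives turns the latter into \<open>D2 q\<close> and
  \<open>D1 (partial j q)\<close>.\<close>

lemma partial_D1:
  assumes q: "real_polynomial_function q" and a: "a \<noteq> 0"
  shows "partial j (\<lambda>a. D1 q (tilt t v a) a) a = partial j q (tilt t v a)
    - (t / (a \<bullet> a)) * (D2 q (tilt t v a) a * (v $ j - 2 * (v \<bullet> a) / (a \<bullet> a) * a $ j)
      + (v \<bullet> a) * D1 (partial j q) (tilt t v a) a)"
proof -
  let ?w = "tilt t v a" and ?n = "a \<bullet> a" and ?s = "v \<bullet> a"
  have "partial j (\<lambda>a. D1 q (tilt t v a) a) a =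
     (\<Sum>l\<in>UNIV. a $ l * partial j (\<lambda>a. partial l q (tilt t v a)) a + partial l q ?w * axis j 1 $ l)"
    using a q unfolding D1_def
    by (subst partial_smooth0_sum)
      (auto simp: partial_smooth0 partial_nth smooth0_nth smooth0_tilt real_polynomial_function_grad
        intro!: smooth0_intros sum.cong)
  also have "\<dots> = (\<Sum>l\<in>UNIV. a $ l * partial j (\<lambda>a. partial l q (tilt t v a)) a) + partial j q ?w"
    by (simp add: sum.distrib) (simp add: axis_def if_distrib cong: if_cong)
  also have "(\<Sum>l\<in>UNIV. a $ l * partial j (\<lambda>a. partial l q (tilt t v a)) a) =
    (\<Sum>l\<in>UNIV. - (t / ?n) * (v $ j - 2 * ?s / ?n * a $ j) * (a $ l * D1 (partial l q) ?w a)
       + - (t / ?n) * ?s * (a $ l * partial l (partial j q) ?w))"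
    using a q by (intro sum.cong refl)
      (simp add: partial_tilt real_polynomial_function_grad partial_commute[of q j] algebra_simps)
  also have "\<dots> = - (t / ?n) * (v $ j - 2 * ?s / ?n * a $ j) * D2 q ?w a
      + - (t / ?n) * ?s * D1 (partial j q) ?w a"
    by (simp only: sum.distrib sum_distrib_left[symmetric] D2_def[of q] D1_def[of "partial j q"])
  finally show ?thesis
    by (simp add: algebra_simps)
qed

section \<open>Contractions and divergences of tilted polynomials\<close>

context
  fixes q :: "real^'n::finite \<Rightarrow> real" and d t :: real and v a w :: "real^'n"
  assumes q: "euler_harm d q" and a: "a \<noteq> 0"
  defines "w \<equiv> tilt t v a"
begin

text \<open>Since \<open>v\<close> is \<open>w\<close> plus a multiple of \<open>a\<close>,
  contraction with \<open>v\<close> splits into Euler's equation at \<open>w\<close> and a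
  derivative along \<open>a\<close>.\<close>

lemma sum_v_partial:
  "(\<Sum>i\<in>UNIV. v $ i * partial i q w) = d * q w + t * (v \<bullet> a) / (a \<bullet> a) * D1 q w a"
proof -
  have "(\<Sum>i\<in>UNIV. v $ i * partial i q w) = v \<bullet> grad q w"
    by (simp add: inner_vec_def grad_def)
  also have "\<dots> = w \<bullet> grad q w + t * (v \<bullet> a) / (a \<bullet> a) * (a \<bullet> grad q w)"
    by (simp add: w_def tilt_def inner_diff_left)
  finally show ?thesis
    using q by (simp add: euler_harm_def D1_inner)
qed

end

lemma sum_v_D1:
  assumes q: "euler_harm d q" and a: "a \<noteq> 0"
  shows "(\<Sum>i\<in>UNIV. v $ i * D1 (partial i q) (tilt t v a) a) =
    (d - 1) * D1 q (tilt t v a) a + t * (v \<bullet> a) / (a \<bullet> a) * D2 q (tilt t v a) a"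
proof -
  let ?w = "tilt t v a"
  have "(\<Sum>i\<in>UNIV. v $ i * D1 (partial i q) ?w a) =
      (\<Sum>i\<in>UNIV. \<Sum>l\<in>UNIV. a $ l * (v $ i * partial i (partial l q) ?w))"
    using q by (simp add: D1_def sum_distrib_left mult_ac euler_harm_def partial_commute[of q])
  also have "\<dots> = (\<Sum>l\<in>UNIV. a $ l * (\<Sum>i\<in>UNIV. v $ i * partial i (partial l q) ?w))"
    by (subst sum.swap) (simp add: sum_distrib_left)
  also have "\<dots> = (\<Sum>l\<in>UNIV. (d - 1) * (a $ l * partial l q ?w)
      + t * (v \<bullet> a) / (a \<bullet> a) * (a $ l * D1 (partial l q) ?w a))"
    by (intro sum.cong refl) (simp add: sum_v_partial[OF euler_harm_partial[OF q] a] algebra_simps)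
  finally show ?thesis
    by (simp only: sum.distrib sum_distrib_left[symmetric] D2_def[of q] D1_def[of q])
qed

lemma sum_a_partial: "(\<Sum>i\<in>UNIV. a $ i * partial i q w) = D1 q w a"
  by (simp add: D1_def)

lemma sum_a_D1: "(\<Sum>i\<in>UNIV. a $ i * D1 (partial i q) w a) = D2 q w a"
  by (simp add: D2_def)

lemma sum_a_a: "(\<Sum>i\<in>UNIV. a $ i * a $ i) = a \<bullet> a"
  and sum_v_a: "(\<Sum>i\<in>UNIV. v $ i * a $ i) = v \<bullet> a"
  by (simp_all add: inner_vec_def)

lemma sum_partial_partial: "euler_harm d q \<Longrightarrow> (\<Sum>i\<in>UNIV. partial i (partial i q) w) = 0"
  by (simp add: euler_harm_def laplacian_def)

text \<open>Harmonicity removes the Laplacian that the factor \<open>v \<bullet> a\<close> would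
  carry. The \<open>D2\<close> term has the factor \<open>t - 2\<close>: it disappears exactly for
  the reflection.\<close>

lemma div_tilt:
  assumes q: "euler_harm d q" and a: "a \<noteq> 0"
  shows "(\<Sum>i\<in>UNIV. partial i (\<lambda>a. partial i q (tilt t v a)) a) =
    - (t / (a \<bullet> a)) * ((d - 1) * D1 q (tilt t v a) a + (t - 2) * (v \<bullet> a) / (a \<bullet> a) * D2 q (tilt t v a) a)"
proof -
  let ?w = "tilt t v a" and ?n = "a \<bullet> a" and ?s = "v \<bullet> a"
  have n: "?n \<noteq> 0" using a by simp
  have pq: "real_polynomial_function q" using q by (simp add: euler_harm_def)
  have "(\<Sum>i\<in>UNIV. partial i (\<lambda>a. partial i q (tilt t v a)) a) =
    (\<Sum>i\<in>UNIV. - (t / ?n) * (v $ i * D1 (partial i q) ?w a)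
       + (2 * t * ?s / ?n\<^sup>2) * (a $ i * D1 (partial i q) ?w a) + - (t * ?s / ?n) * partial i (partial i q) ?w)"
    using a by (intro sum.cong refl)
      (simp add: partial_tilt real_polynomial_function_grad[OF pq] n field_simps power2_eq_square)
  also have "\<dots> = - (t / ?n) * ((d - 1) * D1 q ?w a + t * ?s / ?n * D2 q ?w a)
       + (2 * t * ?s / ?n\<^sup>2) * D2 q ?w a + - (t * ?s / ?n) * 0"
    by (simp only: sum.distrib sum_distrib_left[symmetric] sum_v_D1[OF q a] sum_a_D1 sum_partial_partial[OF q])
  finally show ?thesis
    using n by (simp add: field_simps power2_eq_square)
qed

lemma div_powr:
  assumes "\<And>i. smooth0 (G i)" and a: "a \<noteq> 0"
  shows "(\<Sum>i\<in>UNIV. partial i (\<lambda>a. norm a powr c * G i a) a) =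
    norm a powr c * ((\<Sum>i\<in>UNIV. partial i (G i) a) + c / (a \<bullet> a) * (\<Sum>i\<in>UNIV. a $ i * G i a))"
proof -
  have "(\<Sum>i\<in>UNIV. partial i (\<lambda>a. norm a powr c * G i a) a) =
    (\<Sum>i\<in>UNIV. norm a powr c * partial i (G i) a + norm a powr c * (c / (a \<bullet> a) * (a $ i * G i a)))"
    using assms by (intro sum.cong refl)
      (simp add: partial_smooth0 smooth0_powr partial_norm_powr)
  then show ?thesis
    by (simp only: sum.distrib sum_distrib_left[symmetric] distrib_left)
qed

lemma sum_a_tilt: "a \<noteq> 0 \<Longrightarrow> (\<Sum>i\<in>UNIV. a $ i * tilt t v a $ i) = (1 - t) * (v \<bullet> a)"
  by (simp flip: inner_vec_def[where ?'a = real, simplified])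
     (simp add: tilt_def inner_simps inner_commute algebra_simps)

lemma smooth0_tilt_nth: "smooth0 (\<lambda>a. tilt t v a $ i)"
  by (intro smooth0_tilt real_polynomial_function.intros bounded_linear_vec_nth)

lemma partial_tilt_nth:
  fixes v a :: "real^'n::finite"
  assumes a: "a \<noteq> 0"
  shows "partial j (\<lambda>a. tilt t v a $ i) a =
    - (t / (a \<bullet> a)) * (a $ i * (v $ j - 2 * (v \<bullet> a) / (a \<bullet> a) * a $ j) + (v \<bullet> a) * axis j 1 $ i)"
proof -
  have "D1 (\<lambda>x. x $ i) w a = a $ i" for w
    by (simp add: D1_def partial_nth) (simp add: axis_def if_distrib cong: if_cong)
  then show ?thesis
    using partial_tilt[OF _ a, of "\<lambda>x. x $ i" j t v]
    by (simp add: partial_nth real_polynomial_function.intros bounded_linear_vec_nth)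
qed

text \<open>The reflected vector has divergence
  \<open>(2 - 2 * m) * (v \<bullet> a) / (a \<bullet> a)\<close> and radial component
  \<open>- (v \<bullet> a)\<close>; the latter meets the gradient of the norm power and contributes
  \<open>- c\<close>.\<close>

lemma div_tilt_mult:
  fixes v a :: "real^'n::finite"
  assumes f: "smooth0 f" and a: "a \<noteq> 0"
  shows "(\<Sum>i\<in>UNIV. partial i (\<lambda>a. norm a powr c * (tilt 2 v a $ i * f a)) a) =
    norm a powr c * ((2 - 2 * real CARD('n) - c) * (v \<bullet> a) / (a \<bullet> a) * f a
      + (\<Sum>i\<in>UNIV. tilt 2 v a $ i * partial i f a))"
proof -
  let ?w = "tilt 2 v a" and ?n = "a \<bullet> a" and ?s = "v \<bullet> a"
  have n: "?n \<noteq> 0" using a by simp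
  have "(\<Sum>i\<in>UNIV. partial i (\<lambda>a. tilt 2 v a $ i * f a) a) =
    (\<Sum>i\<in>UNIV. ?w $ i * partial i f a + (- (2 / ?n) * f a) * (v $ i * a $ i)
       + (4 * ?s / ?n\<^sup>2 * f a) * (a $ i * a $ i) + - (2 * ?s / ?n * f a))"
    using a by (intro sum.cong refl)
      (simp add: partial_smooth0 smooth0_tilt_nth f partial_tilt_nth axis_def n field_simps power2_eq_square)
  also have "\<dots> = (\<Sum>i\<in>UNIV. ?w $ i * partial i f a) + (- (2 / ?n) * f a) * ?s
       + (4 * ?s / ?n\<^sup>2 * f a) * ?n + - (2 * ?s / ?n * f a) * real CARD('n)"
    by (simp only: sum.distrib sum_distrib_left[symmetric] sum_v_a sum_a_a) simp
  finally have 1: "(\<Sum>i\<in>UNIV. partial i (\<lambda>a. tilt 2 v a $ i * f a) a) = \<dots>" .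
  have 2: "(\<Sum>i\<in>UNIV. a $ i * (?w $ i * f a)) = - ?s * f a"
    using sum_a_tilt[OF a, of 2 v] by (simp flip: sum_distrib_right mult.assoc)
  show ?thesis
    using n unfolding div_powr[OF smooth0_mult[OF smooth0_tilt_nth f] a] 1 2
    by (simp add: field_simps power2_eq_square)
qed

lemma inner_tilt: "a \<noteq> 0 \<Longrightarrow> tilt 2 v a \<bullet> v = v \<bullet> v - 2 * (v \<bullet> a)\<^sup>2 / (a \<bullet> a)"
  by (simp add: tilt_def inner_simps inner_commute power2_eq_square)

context
  fixes q :: "real^'n::finite \<Rightarrow> real" and d :: real
  assumes q: "euler_harm d q"
begin

text \<open>Kept for general \<open>t\<close>: with \<open>c = - m\<close> the bracket is the
  \<open>t\<close>-derivative of the function that deforms the reflection in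
  \<open>avg_reflect\<close>.\<close>

lemma div_inner_tilt:
  assumes a: "a \<noteq> 0"
  shows "(\<Sum>i\<in>UNIV. partial i (\<lambda>a. norm a powr c * ((v \<bullet> a) * partial i q (tilt t v a))) a) =
    norm a powr c * (d * q (tilt t v a) + (c - (d - 2) * t) * (v \<bullet> a) / (a \<bullet> a) * D1 q (tilt t v a) a
      + t * (2 - t) * ((v \<bullet> a) / (a \<bullet> a))\<^sup>2 * D2 q (tilt t v a) a)"
proof -
  let ?w = "tilt t v a" and ?n = "a \<bullet> a" and ?s = "v \<bullet> a"
  have n: "?n \<noteq> 0" using a by simp
  have "(\<Sum>i\<in>UNIV. partial i (\<lambda>a. (v \<bullet> a) * partial i q (tilt t v a)) a) =
    (\<Sum>i\<in>UNIV. ?s * partial i (\<lambda>a. partial i q (tilt t v a)) a + v $ i * partial i q ?w)"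
    using a by (intro sum.cong refl)
      (simp add: partial_smooth0 smooth0_inner smooth0_tilt euler_harm_poly(2)[OF q] partial_inner)
  also have "\<dots> = ?s * (- (t / ?n) * ((d - 1) * D1 q ?w a + (t - 2) * ?s / ?n * D2 q ?w a))
    + (d * q ?w + t * ?s / ?n * D1 q ?w a)"
    by (simp only: sum.distrib sum_distrib_left[symmetric] div_tilt[OF q a] sum_v_partial[OF q a])
  finally have 1: "(\<Sum>i\<in>UNIV. partial i (\<lambda>a. (v \<bullet> a) * partial i q (tilt t v a)) a) = \<dots>" .
  have 2: "(\<Sum>i\<in>UNIV. a $ i * (?s * partial i q ?w)) = ?s * D1 q ?w a"
    by (simp add: D1_def sum_distrib_left mult_ac)
  show ?thesis
    using n by (subst div_powr)
      (auto simp: a 1 2 smooth0_intros smooth0_tilt euler_harm_poly(2)[OF q] field_simps power2_eq_square)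
qed

text \<open>The terms quadratic in \<open>v \<bullet> a\<close> cancel between
  \<open>inner_tilt\<close> and the radial component of the reflected vector, and only
  \<open>v \<bullet> v\<close> is left.\<close>

lemma tilt_partial_tilt:
  assumes a: "a \<noteq> 0"
  shows "(\<Sum>i\<in>UNIV. tilt 2 v a $ i * partial i (\<lambda>a. q (tilt 2 v a)) a) =
     - 2 * (v \<bullet> v) / (a \<bullet> a) * D1 q (tilt 2 v a) a - 2 * (v \<bullet> a) / (a \<bullet> a) * d * q (tilt 2 v a)"
proof -
  let ?w = "tilt 2 v a" and ?n = "a \<bullet> a" and ?s = "v \<bullet> a"
  have n: "?n \<noteq> 0" using a by simp
  have "(\<Sum>i\<in>UNIV. ?w $ i * partial i (\<lambda>a. q (tilt 2 v a)) a) =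
    (\<Sum>i\<in>UNIV. (- (2 / ?n) * D1 q ?w a) * (?w $ i * v $ i)
      + (4 * ?s / ?n\<^sup>2 * D1 q ?w a) * (a $ i * ?w $ i) + (- (2 / ?n) * ?s) * (?w $ i * partial i q ?w))"
    using a by (intro sum.cong refl) (simp add: partial_tilt euler_harm_poly(1)[OF q] n field_simps power2_eq_square)
  also have "\<dots> = (- (2 / ?n) * D1 q ?w a) * (?w \<bullet> v)
      + (4 * ?s / ?n\<^sup>2 * D1 q ?w a) * (- ?s) + (- (2 / ?n) * ?s) * (?w \<bullet> grad q ?w)"
    by (simp only: sum.distrib sum_distrib_left[symmetric] sum_a_tilt[OF a])
      (simp add: inner_vec_def grad_def)
  also have "?w \<bullet> grad q ?w = d * q ?w"
    using q by (simp add: euler_harm_def)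
  finally show ?thesis
    using n by (simp add: inner_tilt a field_simps power2_eq_square)
qed

lemma tilt_partial_D1:
  assumes a: "a \<noteq> 0"
  shows "(\<Sum>i\<in>UNIV. tilt 2 v a $ i * partial i (\<lambda>a. D1 q (tilt 2 v a) a) a) =
     d * q (tilt 2 v a) - 2 * (v \<bullet> v) / (a \<bullet> a) * D2 q (tilt 2 v a) a
     - 2 * (v \<bullet> a) / (a \<bullet> a) * (d - 1) * D1 q (tilt 2 v a) a"
proof -
  let ?w = "tilt 2 v a" and ?n = "a \<bullet> a" and ?s = "v \<bullet> a"
  have n: "?n \<noteq> 0" using a by simp
  \<comment> \<open>Passing from \<open>v\<close> to \<open>w\<close> subtracts the multiple of
    \<open>a\<close> whose contribution is the \<open>D2\<close> term of \<open>sum_v_D1\<close>;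
    Euler's relation in degree \<open>d - 1\<close> remains.\<close>
  have e: "(\<Sum>i\<in>UNIV. ?w $ i * D1 (partial i q) ?w a) = (d - 1) * D1 q ?w a"
  proof -
    have "(\<Sum>i\<in>UNIV. ?w $ i * D1 (partial i q) ?w a) =
      (\<Sum>i\<in>UNIV. v $ i * D1 (partial i q) ?w a - 2 * ?s / ?n * (a $ i * D1 (partial i q) ?w a))"
      by (intro sum.cong refl) (simp add: tilt_def algebra_simps)
    also have "\<dots> = (d - 1) * D1 q ?w a"
      by (simp only: sum_subtractf sum_distrib_left[symmetric] sum_v_D1[OF q a] sum_a_D1)
    finally show ?thesis .
  qed
  have "(\<Sum>i\<in>UNIV. ?w $ i * partial i (\<lambda>a. D1 q (tilt 2 v a) a) a) =
    (\<Sum>i\<in>UNIV. ?w $ i * partial i q ?w + (- (2 / ?n) * D2 q ?w a) * (?w $ i * v $ i)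
      + (4 * ?s / ?n\<^sup>2 * D2 q ?w a) * (a $ i * ?w $ i) + (- (2 / ?n) * ?s) * (?w $ i * D1 (partial i q) ?w a))"
    using a by (intro sum.cong refl) (simp add: partial_D1 euler_harm_poly(1)[OF q] n field_simps power2_eq_square)
  also have "\<dots> = ?w \<bullet> grad q ?w + (- (2 / ?n) * D2 q ?w a) * (?w \<bullet> v)
      + (4 * ?s / ?n\<^sup>2 * D2 q ?w a) * (- ?s) + (- (2 / ?n) * ?s) * ((d - 1) * D1 q ?w a)"
    by (simp only: sum.distrib sum_distrib_left[symmetric] sum_a_tilt[OF a] e)
      (simp add: inner_vec_def grad_def)
  also have "?w \<bullet> grad q ?w = d * q ?w"
    using q by (simp add: euler_harm_def)
  finally show ?thesis
    by (rule trans) (use n in \<open>simp add: inner_tilt a field_simps power2_eq_square\<close>)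
qed

text \<open>Differentiating the direction gives the Laplacian, hence zero; \<open>div_tilt\<close>
  in degree \<open>d - 1\<close> gives \<open>- 2 * (d - 2)\<close>, and the norm power gives
  \<open>c\<close>. For \<open>c = - m\<close> the coefficient is \<open>- (m + 2 * d - 4)\<close>,
  the reciprocal of \<open>- g\<close>.\<close>

lemma div_D1_partial:
  assumes a: "a \<noteq> 0"
  shows "(\<Sum>i\<in>UNIV. partial i (\<lambda>a. norm a powr c * D1 (partial i q) (tilt 2 v a) a) a) =
    norm a powr c * (c - 2 * d + 4) / (a \<bullet> a) * D2 q (tilt 2 v a) a"
proof -
  let ?w = "tilt 2 v a" and ?n = "a \<bullet> a" and ?s = "v \<bullet> a"
  have n: "?n \<noteq> 0" using a by simp
  have "(\<Sum>i\<in>UNIV. partial i (\<lambda>a. D1 (partial i q) (tilt 2 v a) a) a) =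
    (\<Sum>i\<in>UNIV. \<Sum>l\<in>UNIV. partial i (\<lambda>a. a $ l * partial i (partial l q) (tilt 2 v a)) a)"
    using a by (simp add: D1_def partial_commute[OF euler_harm_poly(1)[OF q]] partial_smooth0_sum smooth0_intros smooth0_tilt
        real_polynomial_function_grad euler_harm_poly(2)[OF q])
  also have "\<dots> = (\<Sum>i\<in>UNIV. \<Sum>l\<in>UNIV. a $ l * partial i (\<lambda>a. partial i (partial l q) (tilt 2 v a)) a
      + axis i 1 $ l * partial i (partial l q) ?w)"
    using a by (intro sum.cong refl)
      (simp add: partial_smooth0 smooth0_nth smooth0_tilt real_polynomial_function_grad euler_harm_poly(2)[OF q] partial_nth)
  also have "\<dots> = (\<Sum>l\<in>UNIV. a $ l * (\<Sum>i\<in>UNIV. partial i (\<lambda>a. partial i (partial l q) (tilt 2 v a)) a))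
      + (\<Sum>i\<in>UNIV. \<Sum>l\<in>UNIV. axis i 1 $ l * partial i (partial l q) ?w)"
    unfolding sum.distrib sum_distrib_left by (subst sum.swap) simp
  also have "(\<Sum>i\<in>UNIV. \<Sum>l\<in>UNIV. axis i 1 $ l * partial i (partial l q) ?w) = 0"
    using sum_partial_partial[OF q, of ?w]
    by (simp add: axis_def if_distrib[of "\<lambda>x. x * _"] cong: if_cong)
  also have "(\<Sum>l\<in>UNIV. a $ l * (\<Sum>i\<in>UNIV. partial i (\<lambda>a. partial i (partial l q) (tilt 2 v a)) a))
      = (\<Sum>l\<in>UNIV. (- (2 / ?n) * (d - 2)) * (a $ l * D1 (partial l q) ?w a))"
    by (intro sum.cong refl) (simp add: div_tilt[OF euler_harm_partial[OF q] a] n field_simps)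
  also have "\<dots> = (- (2 / ?n) * (d - 2)) * D2 q ?w a"
    by (simp only: sum_distrib_left[symmetric] sum_a_D1)
  finally have 1: "(\<Sum>i\<in>UNIV. partial i (\<lambda>a. D1 (partial i q) (tilt 2 v a) a) a) =
    (- (2 / ?n) * (d - 2)) * D2 q ?w a + 0" .
  show ?thesis
    using n unfolding div_powr[OF smooth0_D1[OF euler_harm_poly(2)[OF q]] a] 1 sum_a_D1
    by (simp add: field_simps power2_eq_square)
qed

end

section \<open>The kernels and their fluxes\<close>

text \<open>The coefficients of the operator, evaluated on \<open>p\<close> at the reflected vector:
  contracted with the Hessian of a coefficient function of \<open>x\<close>, they give the integrand
  of the potential. The squared length of the reflected vector is written as
  \<open>v \<bullet> v\<close>. The parameters \<open>b\<close> and \<open>g\<close> stand for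
  \<open>4 / (m + 2 * k - 2)\<close> and \<open>1 / (m + 2 * k - 4)\<close>.\<close>

definition kerA :: "real \<Rightarrow> real \<Rightarrow> (real^'n::finite \<Rightarrow> real) \<Rightarrow> real^'n \<Rightarrow> 'n \<Rightarrow> 'n \<Rightarrow> real^'n \<Rightarrow> real" where
  "kerA b g p v i j a = norm a powr (2 - real CARD('n)) *
     ((if i = j then p (tilt 2 v a) else 0) - b * (tilt 2 v a $ i * partial j p (tilt 2 v a)
       - g * (v \<bullet> v) * partial i (partial j p) (tilt 2 v a)))"

text \<open>Arranged as a combination of four fields whose divergences are known, so that
  \<open>div_lincomb4\<close> applies.\<close>

definition fluxA :: "real \<Rightarrow> (real^'n::finite \<Rightarrow> real) \<Rightarrow> real^'n \<Rightarrow> 'n \<Rightarrow> real^'n \<Rightarrow> real" where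
  "fluxA g p v j a =
     (2 - real CARD('n)) * (a $ j * (norm a powr (- real CARD('n)) * p (tilt 2 v a)))
     + (- 2) * (norm a powr (- real CARD('n)) * (tilt 2 v a $ j * D1 p (tilt 2 v a) a))
     + 2 * (norm a powr (- real CARD('n)) * ((v \<bullet> a) * partial j p (tilt 2 v a)))
     + (4 * g * (v \<bullet> v)) * (norm a powr (- real CARD('n)) * D1 (partial j p) (tilt 2 v a) a)"

text \<open>Here the operator acts on the function that sends \<open>v\<close> to
  \<open>p (tilt 2 v a)\<close>; the terms with \<open>D1\<close> and \<open>D2\<close> are the
  chain rule, as in \<open>partial_reflect\<close> and \<open>partial_partial_reflect\<close>. The
  indices in the first-order term are exchanged against \<open>kerA\<close>, because passing to test
  functions reverses the order of the two derivatives in \<open>x\<close>.\<close>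

definition kerB :: "real \<Rightarrow> real \<Rightarrow> (real^'n::finite \<Rightarrow> real) \<Rightarrow> real^'n \<Rightarrow> 'n \<Rightarrow> 'n \<Rightarrow> real^'n \<Rightarrow> real" where
  "kerB b g p v i j a = norm a powr (2 - real CARD('n)) *
     ((if i = j then p (tilt 2 v a) else 0)
      - b * (v $ j * (partial i p (tilt 2 v a) - 2 * a $ i * D1 p (tilt 2 v a) a / (a \<bullet> a))
       - g * (v \<bullet> v) * (partial i (partial j p) (tilt 2 v a)
          - 2 * a $ i * D1 (partial j p) (tilt 2 v a) a / (a \<bullet> a)
          - 2 * a $ j * D1 (partial i p) (tilt 2 v a) a / (a \<bullet> a)
          + 4 * a $ i * a $ j * D2 p (tilt 2 v a) a / (a \<bullet> a)\<^sup>2)))"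

text \<open>The three non-radial fields are those of \<open>fluxA\<close> with opposite signs; the
  additional radial terms restore the radial component of \<open>fluxA\<close>.\<close>

definition fluxB :: "real \<Rightarrow> (real^'n::finite \<Rightarrow> real) \<Rightarrow> real^'n \<Rightarrow> 'n \<Rightarrow> real^'n \<Rightarrow> real" where
  "fluxB g p v j a =
     a $ j * (norm a powr (- real CARD('n)) * ((2 - real CARD('n)) * p (tilt 2 v a)
        + 8 * (v \<bullet> a) * D1 p (tilt 2 v a) a / (a \<bullet> a)
        + 8 * g * (v \<bullet> v) * D2 p (tilt 2 v a) a / (a \<bullet> a)))
     + 2 * (norm a powr (- real CARD('n)) * (tilt 2 v a $ j * D1 p (tilt 2 v a) a))
     + (- 2) * (norm a powr (- real CARD('n)) * ((v \<bullet> a) * partial j p (tilt 2 v a)))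
     + (- 4 * g * (v \<bullet> v)) * (norm a powr (- real CARD('n)) * D1 (partial j p) (tilt 2 v a) a)"

text \<open>The radial flux of either field, normalised to degree zero. That both kernels share it
  makes their constants equal.\<close>

definition flux_density :: "real \<Rightarrow> (real^'n::finite \<Rightarrow> real) \<Rightarrow> real^'n \<Rightarrow> real^'n \<Rightarrow> real" where
  "flux_density g p v a = (2 - real CARD('n)) * p (tilt 2 v a)
     + 4 * (v \<bullet> a) / (a \<bullet> a) * D1 p (tilt 2 v a) a + 4 * g * (v \<bullet> v) / (a \<bullet> a) * D2 p (tilt 2 v a) a"

lemma div_lincomb4:
  assumes "\<And>j. smooth0 (A j)" "\<And>j. smooth0 (B j)" "\<And>j. smooth0 (C j)" "\<And>j. smooth0 (D j)" "a \<noteq> 0"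
  shows "(\<Sum>j\<in>UNIV. partial j (\<lambda>a. c1 * A j a + c2 * B j a + c3 * C j a + c4 * D j a) a) =
    c1 * (\<Sum>j\<in>UNIV. partial j (A j) a) + c2 * (\<Sum>j\<in>UNIV. partial j (B j) a)
    + c3 * (\<Sum>j\<in>UNIV. partial j (C j) a) + c4 * (\<Sum>j\<in>UNIV. partial j (D j) a)"
proof -
  have "partial j (\<lambda>a. c1 * A j a + c2 * B j a + c3 * C j a + c4 * D j a) a =
      c1 * partial j (A j) a + c2 * partial j (B j) a + c3 * partial j (C j) a + c4 * partial j (D j) a" for j
  proof -
    have s: "smooth0 (\<lambda>a. c1 * A j a)" "smooth0 (\<lambda>a. c2 * B j a)" "smooth0 (\<lambda>a. c3 * C j a)" "smooth0 (\<lambda>a. c4 * D j a)"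
      using assms by (auto intro!: smooth0_mult smooth0_const)
    show ?thesis
      by (simp add: partial_smooth0(1) smooth0_add s assms(5)) (simp add: partial_smooth0_cmult assms)
  qed
  then show ?thesis
    by (simp add: sum.distrib sum_distrib_left)
qed

context
  fixes p :: "real^'n::finite \<Rightarrow> real" and d b g :: real
  assumes p: "euler_harm d p"
    and b: "b * (real CARD('n) + 2 * d - 2) = 4"
    and g: "g * (real CARD('n) + 2 * d - 4) = 1"
begin

lemmas ker_smooth = smooth0_powr smooth0_nth smooth0_inner smooth0_tilt_nth smooth0_tilt[OF euler_harm_poly(1)[OF p]]
  smooth0_tilt[OF euler_harm_poly(2)[OF p]] smooth0_tilt[OF euler_harm_poly(3)[OF p]] smooth0_D1[OF euler_harm_poly(1)[OF p]] smooth0_D1[OF euler_harm_poly(2)[OF p]] smooth0_D2[OF euler_harm_poly(1)[OF p]]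
  smooth0_divide smooth0_const smooth0_mult smooth0_add smooth0_diff

lemma smooth0_if: "(P \<Longrightarrow> smooth0 f) \<Longrightarrow> smooth0 (\<lambda>a. if P then f a else 0)"
  by (cases P) (auto intro: smooth0_const)

lemma smooth0_kerA: "smooth0 (kerA b g p v i j)"
  unfolding kerA_def by (intro ker_smooth smooth0_if)

lemma smooth0_fluxA: "smooth0 (fluxA g p v j)"
  unfolding fluxA_def by (intro ker_smooth)

lemma norm_powr_2: "a \<noteq> 0 \<Longrightarrow> norm a powr (2 - c) = (a \<bullet> a) * norm a powr (- c)" for a :: "real^'n"
  by (simp add: powr_diff powr_minus dot_square_norm powr_realpow divide_inverse)

lemma div_kerA_diag:
  assumes a: "a \<noteq> 0"
  shows "(\<Sum>i\<in>UNIV. partial i (\<lambda>a. if i = j then norm a powr (2 - real CARD('n)) * p (tilt 2 v a) else 0) a) =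
      norm a powr (- real CARD('n)) * ((2 - real CARD('n)) * (a $ j * p (tilt 2 v a))
        - 2 * tilt 2 v a $ j * D1 p (tilt 2 v a) a - 2 * (v \<bullet> a) * partial j p (tilt 2 v a))"
    (is "_ = ?rhs")
proof -
  let ?m = "real CARD('n)"
  let ?A = "\<lambda>i a. (if i = j then norm a powr (2 - ?m) * p (tilt 2 v a) else 0)"
  have n: "a \<bullet> a \<noteq> 0" using a by simp
  have "(\<Sum>i\<in>UNIV. partial i (?A i) a) = (\<Sum>i\<in>UNIV. if i = j then partial i (?A i) a else 0)"
    by (intro sum.cong) auto
  also have "\<dots> = partial j (\<lambda>a. norm a powr (2 - ?m) * p (tilt 2 v a)) a"
    by simp
  also have "\<dots> = ?rhs"
    using a n by (simp add: partial_smooth0 smooth0_powr smooth0_tilt euler_harm_poly(1)[OF p] partial_norm_powr partial_tilt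
        norm_powr_2) (simp add: tilt_def field_simps power2_eq_square)
  finally show ?thesis .
qed

lemma div_kerA:
  assumes a: "a \<noteq> 0"
  shows "(\<Sum>i\<in>UNIV. partial i (kerA b g p v i j) a) = fluxA g p v j a"
proof -
  let ?m = "real CARD('n)" and ?w = "tilt 2 v a" and ?n = "a \<bullet> a" and ?s = "v \<bullet> a"
  let ?N = "norm a powr (- ?m)"
  let ?A = "\<lambda>i a. (if i = j then norm a powr (2 - ?m) * p (tilt 2 v a) else 0)"
  let ?B = "\<lambda>i a. norm a powr (2 - ?m) * (tilt 2 v a $ i * partial j p (tilt 2 v a))"
  let ?C = "\<lambda>i a. norm a powr (2 - ?m) * partial i (partial j p) (tilt 2 v a)"
  have n: "?n \<noteq> 0" using a by simp
  have k: "kerA b g p v i j = (\<lambda>a. 1 * ?A i a + (-b) * ?B i a + (b * g * (v \<bullet> v)) * ?C i a + 0 * 0)" for i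
    by (auto simp: kerA_def fun_eq_iff algebra_simps)
  have s: "smooth0 (?A i)" "smooth0 (?B i)" "smooth0 (?C i)" for i
    by (intro ker_smooth smooth0_if)+
  have eA: "(\<Sum>i\<in>UNIV. partial i (?A i) a) =
      ?N * ((2 - ?m) * (a $ j * p ?w) - 2 * ?w $ j * D1 p ?w a - 2 * ?s * partial j p ?w)"
    by (rule div_kerA_diag[OF a])
  have eB: "(\<Sum>i\<in>UNIV. partial i (?B i) a) =
      ?N * (- (?m + 2 * d - 2) * ?s * partial j p ?w - 2 * (v \<bullet> v) * D1 (partial j p) ?w a)"
    using a n
    by (simp add: div_tilt_mult smooth0_tilt euler_harm_poly(2)[OF p] tilt_partial_tilt[OF euler_harm_partial[OF p]] norm_powr_2)
      (simp add: field_simps)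
  have eC: "(\<Sum>i\<in>UNIV. partial i (?C i) a) = ?N * (- (?m + 2 * d - 6) * D1 (partial j p) ?w a)"
    using a n
    by (simp add: div_powr smooth0_tilt euler_harm_poly(3)[OF p] div_tilt[OF euler_harm_partial[OF p]] norm_powr_2 sum_a_partial)
      (simp add: field_simps)
  have "(\<Sum>i\<in>UNIV. partial i (kerA b g p v i j) a) =
     1 * (\<Sum>i\<in>UNIV. partial i (?A i) a) + (- b) * (\<Sum>i\<in>UNIV. partial i (?B i) a)
     + (b * g * (v \<bullet> v)) * (\<Sum>i\<in>UNIV. partial i (?C i) a)
     + 0 * (\<Sum>i\<in>(UNIV :: 'n set). partial i (\<lambda>a. 0) a)"
    unfolding k by (rule div_lincomb4) (rule s smooth0_const a)+
  also have "\<dots> =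
     ?N * ((2 - ?m) * (a $ j * p ?w) - 2 * ?w $ j * D1 p ?w a + (b * (?m + 2 * d - 2) - 2) * ?s * partial j p ?w
       + (2 * b - b * g * (?m + 2 * d - 4) + b * g * 2) * (v \<bullet> v) * D1 (partial j p) ?w a)"
    unfolding eA eB eC by (simp add: algebra_simps)
  \<comment> \<open>The coefficients of the operator enter through this cancellation and the next
    one.\<close>
  also have "b * (?m + 2 * d - 2) - 2 = 2"
    by (simp add: b)
  also have "2 * b - b * g * (?m + 2 * d - 4) + b * g * 2 = 4 * g"
  proof -
    have "b * g * (?m + 2 * d - 4) = b * (g * (?m + 2 * d - 4))"
      by (simp only: mult.assoc)
    then have "b * g * (?m + 2 * d - 4) = b"
      by (simp only: g)
    moreover have "4 * g = g * (b * (?m + 2 * d - 2))"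
      by (simp add: b)
    moreover have "g * (b * (?m + 2 * d - 2)) = b * g * (?m + 2 * d - 4) + b * g * 2"
      by (simp add: algebra_simps)
    ultimately show ?thesis by simp
  qed
  finally show ?thesis
    by (rule trans) (simp add: fluxA_def algebra_simps)
qed

text \<open>The radial field has degree \<open>- m\<close> and no divergence. Between the fields
  with \<open>- 2\<close> and \<open>2\<close> only a \<open>D2\<close> term survives, and it
  cancels the last field precisely because \<open>g * (m + 2 * d - 4) = 1\<close>.\<close>

lemma div_fluxA:
  assumes a: "a \<noteq> 0"
  shows "(\<Sum>j\<in>UNIV. partial j (fluxA g p v j) a) = 0"
proof -
  let ?m = "real CARD('n)" and ?w = "tilt 2 v a" and ?n = "a \<bullet> a" and ?s = "v \<bullet> a"
  let ?N = "norm a powr (- ?m)"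
  define N where "N = ?N"
  define r where "r = inverse ?n"
  have h: "homog0 (- ?m) (\<lambda>a. norm a powr (- ?m) * p (tilt 2 v a))"
    using homog0_mult[OF homog0_powr homog0_tilt] by simp
  have hs: "smooth0 (\<lambda>a. norm a powr (- ?m) * p (tilt 2 v a))"
    by (intro ker_smooth)
  have "(\<Sum>j\<in>UNIV. partial j (fluxA g p v j) a) =
    (-2) * ?N * (d * p ?w - (?m + 2 * d - 4) * ?s / ?n * D1 p ?w a - 2 * (v \<bullet> v) / ?n * D2 p ?w a)
    + 2 * ?N * (d * p ?w - (?m + 2 * d - 4) * ?s / ?n * D1 p ?w a)
    - 4 * (v \<bullet> v) * ?N / ?n * (g * (?m + 2 * d - 4)) * D2 p ?w a"
    (is "_ = ?rhs")
  proof -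
    have "(\<Sum>j\<in>UNIV. partial j (fluxA g p v j) a) =
     (2 - ?m) * (\<Sum>j\<in>UNIV. partial j (\<lambda>a. a $ j * (norm a powr (- ?m) * p (tilt 2 v a))) a)
     + (- 2) * (\<Sum>j\<in>UNIV. partial j (\<lambda>a. norm a powr (- ?m) * (tilt 2 v a $ j * D1 p (tilt 2 v a) a)) a)
     + 2 * (\<Sum>j\<in>UNIV. partial j (\<lambda>a. norm a powr (- ?m) * ((v \<bullet> a) * partial j p (tilt 2 v a))) a)
     + (4 * g * (v \<bullet> v)) * (\<Sum>j\<in>UNIV. partial j (\<lambda>a. norm a powr (- ?m) * D1 (partial j p) (tilt 2 v a) a) a)"
      unfolding fluxA_def by (rule div_lincomb4[OF _ _ _ _ a]; intro ker_smooth)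
    also have "\<dots> = ?rhs"
      unfolding div_radial[OF hs h a] div_tilt_mult[OF smooth0_D1[OF euler_harm_poly(1)[OF p]] a] tilt_partial_D1[OF p a]
        div_inner_tilt[OF p a] div_D1_partial[OF p a]
      unfolding N_def[symmetric] r_def[symmetric] divide_inverse by (simp add: algebra_simps)
    finally show ?thesis .
  qed
  then show ?thesis
    unfolding g by (rule trans) (simp add: divide_inverse algebra_simps)
qed

lemma flux_fluxA:
  assumes a: "a \<noteq> 0"
  shows "(\<Sum>j\<in>UNIV. a $ j * fluxA g p v j a) = (a \<bullet> a) * norm a powr (- real CARD('n)) * flux_density g p v a"
proof -
  let ?m = "real CARD('n)" and ?w = "tilt 2 v a" and ?n = "a \<bullet> a" and ?s = "v \<bullet> a"
  let ?N = "norm a powr (- ?m)"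
  have n: "?n \<noteq> 0" using a by simp
  have "(\<Sum>j\<in>UNIV. a $ j * fluxA g p v j a) =
    (\<Sum>j\<in>UNIV. ((2 - ?m) * ?N * p ?w) * (a $ j * a $ j) + (- 2 * ?N * D1 p ?w a) * (a $ j * ?w $ j)
      + (2 * ?N * ?s) * (a $ j * partial j p ?w) + (4 * g * (v \<bullet> v) * ?N) * (a $ j * D1 (partial j p) ?w a))"
    by (intro sum.cong refl) (simp add: fluxA_def algebra_simps)
  also have "\<dots> = ((2 - ?m) * ?N * p ?w) * ?n + (- 2 * ?N * D1 p ?w a) * (- ?s)
      + (2 * ?N * ?s) * D1 p ?w a + (4 * g * (v \<bullet> v) * ?N) * D2 p ?w a"
    by (simp only: sum.distrib sum_distrib_left[symmetric] sum_a_a sum_a_tilt[OF a] sum_a_partial sum_a_D1) simp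
  also have "\<dots> = ?n * ?N * flux_density g p v a"
    using n by (simp add: flux_density_def field_simps)
  finally show ?thesis .
qed

lemma smooth0_kerB: "smooth0 (kerB b g p v i j)"
  unfolding kerB_def power2_eq_square divide_divide_eq_left[symmetric]
  by (intro ker_smooth smooth0_if)

lemma smooth0_fluxB: "smooth0 (fluxB g p v j)"
  unfolding fluxB_def by (intro ker_smooth)

lemma div_kerB:
  assumes a: "a \<noteq> 0"
  shows "(\<Sum>i\<in>UNIV. partial i (kerB b g p v i j) a) = fluxB g p v j a"
proof -
  let ?m = "real CARD('n)" and ?w = "tilt 2 v a" and ?n = "a \<bullet> a" and ?s = "v \<bullet> a"
  let ?N = "norm a powr (- ?m)"
  let ?A = "\<lambda>i a. (if i = j then norm a powr (2 - ?m) * p (tilt 2 v a) else 0)"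
  let ?B = "\<lambda>i a. norm a powr (2 - ?m) * partial i p (tilt 2 v a)"
  let ?B' = "\<lambda>i a. a $ i * (norm a powr (2 - ?m) * D1 p (tilt 2 v a) a / (a \<bullet> a))"
  let ?C = "\<lambda>i a. norm a powr (2 - ?m) * partial i (partial j p) (tilt 2 v a)"
  let ?C1 = "\<lambda>i a. a $ i * (norm a powr (2 - ?m) * D1 (partial j p) (tilt 2 v a) a / (a \<bullet> a))"
  let ?C2 = "\<lambda>i a. norm a powr (2 - ?m) * D1 (partial i p) (tilt 2 v a) a / (a \<bullet> a)"
  let ?C3 = "\<lambda>i a. a $ i * (a $ j * (norm a powr (2 - ?m) * D2 p (tilt 2 v a) a / (a \<bullet> a) / (a \<bullet> a)))"
  have n: "?n \<noteq> 0" using a by simp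
  \<comment> \<open>Seven fields, nested as four plus three so that \<open>div_lincomb4\<close> can
    be used twice.\<close>
  have k: "kerB b g p v i j = (\<lambda>a. 1 * (1 * ?A i a + (- b * v $ j) * ?B i a + (2 * b * v $ j) * ?B' i a
       + (b * g * (v \<bullet> v)) * ?C i a)
     + (- 2 * b * g * (v \<bullet> v)) * ?C1 i a + (- 2 * b * g * (v \<bullet> v)) * (a $ j * ?C2 i a)
     + (4 * b * g * (v \<bullet> v)) * ?C3 i a)" for i
    by (auto simp: kerB_def fun_eq_iff power2_eq_square algebra_simps)
  have s: "smooth0 (?A i)" "smooth0 (?B i)" "smooth0 (?B' i)" "smooth0 (?C i)" "smooth0 (?C1 i)"
    "smooth0 (?C2 i)" "smooth0 (?C3 i)" "smooth0 (\<lambda>a. a $ j * ?C2 i a)" for i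
    by (intro ker_smooth smooth0_if)+
  have eA: "(\<Sum>i\<in>UNIV. partial i (?A i) a) =
      ?N * ((2 - ?m) * (a $ j * p ?w) - 2 * ?w $ j * D1 p ?w a - 2 * ?s * partial j p ?w)"
    by (rule div_kerA_diag[OF a])
  have eB: "(\<Sum>i\<in>UNIV. partial i (?B i) a) = ?N * (- (?m + 2 * d - 4) * D1 p ?w a)"
    using a n
    by (simp add: div_powr smooth0_tilt euler_harm_poly(2)[OF p] div_tilt[OF p] norm_powr_2 sum_a_partial)
      (simp add: field_simps)
  have eC: "(\<Sum>i\<in>UNIV. partial i (?C i) a) = ?N * (- (?m + 2 * d - 6) * D1 (partial j p) ?w a)"
    using a n
    by (simp add: div_powr smooth0_tilt euler_harm_poly(3)[OF p] div_tilt[OF euler_harm_partial[OF p]] norm_powr_2 sum_a_partial)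
      (simp add: field_simps)
  have h: "homog0 (1 - ?m) (\<lambda>a. norm a powr (2 - ?m) * D1 q (tilt 2 v a) a / (a \<bullet> a))" for q :: "real^'n \<Rightarrow> real"
    using homog0_divide[OF homog0_mult[OF homog0_powr[of "2 - ?m"] homog0_D1]] by simp
  have h3: "homog0 (1 - ?m) (\<lambda>a. a $ j * (norm a powr (2 - ?m) * D2 p (tilt 2 v a) a / (a \<bullet> a) / (a \<bullet> a)))"
    using homog0_mult[OF homog0_nth homog0_divide[OF homog0_divide[OF homog0_mult[OF homog0_powr[of "2 - ?m"] homog0_D2]]]]
    by simp
  have h3s: "smooth0 (\<lambda>a. a $ j * (norm a powr (2 - ?m) * D2 p (tilt 2 v a) a / (a \<bullet> a) / (a \<bullet> a)))"
    by (intro ker_smooth)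
  have eB': "(\<Sum>i\<in>UNIV. partial i (?B' i) a) = ?N * D1 p ?w a"
    using n by (subst div_radial[OF _ h a]) (auto intro!: ker_smooth simp: norm_powr_2 a)
  have eC1: "(\<Sum>i\<in>UNIV. partial i (?C1 i) a) = ?N * D1 (partial j p) ?w a"
    using n by (subst div_radial[OF _ h a]) (auto intro!: ker_smooth simp: norm_powr_2 a)
  have eC3: "(\<Sum>i\<in>UNIV. partial i (?C3 i) a) = ?N * (a $ j * D2 p ?w a / ?n)"
    using n unfolding div_radial[OF h3s h3 a] by (simp add: norm_powr_2 a)
  have eC2: "(\<Sum>i\<in>UNIV. partial i (\<lambda>a. a $ j * ?C2 i a) a) =
     ?N * (D1 (partial j p) ?w a - (?m + 2 * d - 4) * a $ j * D2 p ?w a / ?n)"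
  proof -
    \<comment> \<open>Off the origin the weight \<open>norm a powr (2 - m) / (a \<bullet> a)\<close>
      is a single norm power, the form that \<open>div_D1_partial\<close> expects.\<close>
    have c: "partial i (?C2 i) a = partial i (\<lambda>a. norm a powr (- ?m) * D1 (partial i p) (tilt 2 v a) a) a" for i
      by (rule partial_cong0[OF a _ s(6)]) (simp add: norm_powr_2)
    have "(\<Sum>i\<in>UNIV. partial i (\<lambda>a. a $ j * ?C2 i a) a) =
      (\<Sum>i\<in>UNIV. a $ j * partial i (?C2 i) a + (if i = j then ?C2 i a else 0))"
      using a by (intro sum.cong refl) (simp only: partial_smooth0(3)[OF smooth0_nth s(6) a] partial_nth, simp add: axis_def)
    also have "\<dots> = a $ j * (\<Sum>i\<in>UNIV. partial i (\<lambda>a. norm a powr (- ?m) * D1 (partial i p) (tilt 2 v a) a) a) + ?C2 j a"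
      unfolding c by (simp add: sum.distrib sum_distrib_left)
    also have "\<dots> = ?N * (D1 (partial j p) ?w a - (?m + 2 * d - 4) * a $ j * D2 p ?w a / ?n)"
      unfolding div_D1_partial[OF p a] using n a by (simp add: norm_powr_2 field_simps)
    finally show ?thesis .
  qed
  have "(\<Sum>i\<in>UNIV. partial i (kerB b g p v i j) a) =
     1 * (\<Sum>i\<in>UNIV. partial i (\<lambda>a. 1 * ?A i a + (- b * v $ j) * ?B i a + (2 * b * v $ j) * ?B' i a
       + (b * g * (v \<bullet> v)) * ?C i a) a)
     + (- 2 * b * g * (v \<bullet> v)) * (\<Sum>i\<in>UNIV. partial i (?C1 i) a)
     + (- 2 * b * g * (v \<bullet> v)) * (\<Sum>i\<in>UNIV. partial i (\<lambda>a. a $ j * ?C2 i a) a)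
     + (4 * b * g * (v \<bullet> v)) * (\<Sum>i\<in>UNIV. partial i (?C3 i) a)"
    unfolding k by (rule div_lincomb4)
      (rule s smooth0_const smooth0_add smooth0_mult a)+
  also have "(\<Sum>i\<in>UNIV. partial i (\<lambda>a. 1 * ?A i a + (- b * v $ j) * ?B i a + (2 * b * v $ j) * ?B' i a
       + (b * g * (v \<bullet> v)) * ?C i a) a) =
     1 * (\<Sum>i\<in>UNIV. partial i (?A i) a) + (- b * v $ j) * (\<Sum>i\<in>UNIV. partial i (?B i) a)
     + (2 * b * v $ j) * (\<Sum>i\<in>UNIV. partial i (?B' i) a)
     + (b * g * (v \<bullet> v)) * (\<Sum>i\<in>UNIV. partial i (?C i) a)"
    by (rule div_lincomb4) (rule s a)+
  also have "1 * (1 * (\<Sum>i\<in>UNIV. partial i (?A i) a) + (- b * v $ j) * (\<Sum>i\<in>UNIV. partial i (?B i) a)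
     + (2 * b * v $ j) * (\<Sum>i\<in>UNIV. partial i (?B' i) a)
     + (b * g * (v \<bullet> v)) * (\<Sum>i\<in>UNIV. partial i (?C i) a))
     + (- 2 * b * g * (v \<bullet> v)) * (\<Sum>i\<in>UNIV. partial i (?C1 i) a)
     + (- 2 * b * g * (v \<bullet> v)) * (\<Sum>i\<in>UNIV. partial i (\<lambda>a. a $ j * ?C2 i a) a)
     + (4 * b * g * (v \<bullet> v)) * (\<Sum>i\<in>UNIV. partial i (?C3 i) a) =
     ?N * ((2 - ?m) * (a $ j * p ?w) - 2 * ?w $ j * D1 p ?w a - 2 * ?s * partial j p ?w
       + (b * (?m + 2 * d - 2)) * (v $ j * D1 p ?w a - g * (v \<bullet> v) * D1 (partial j p) ?w a
         + 2 * g * (v \<bullet> v) * a $ j * D2 p ?w a / ?n))"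
    unfolding eA eB eB' eC eC1 eC2 eC3 by (simp add: divide_inverse algebra_simps)
  \<comment> \<open>Trading \<open>v\<close> for the reflected vector and \<open>a\<close> brings
    the result into the form of \<open>fluxB\<close>; the multiple of \<open>a\<close> accounts for
    its extra radial term.\<close>
  also have "v $ j = ?w $ j + 2 * ?s / ?n * a $ j"
    by (simp add: tilt_def)
  finally show ?thesis
    unfolding b by (rule trans) (simp add: fluxB_def divide_inverse algebra_simps)
qed

text \<open>The enlarged radial field still has degree \<open>- m\<close>, so it is divergence free,
  and the other fields cancel as for \<open>fluxA\<close> up to sign.\<close>

lemma div_fluxB:
  assumes a: "a \<noteq> 0"
  shows "(\<Sum>j\<in>UNIV. partial j (fluxB g p v j) a) = 0"
proof -
  let ?m = "real CARD('n)" and ?w = "tilt 2 v a" and ?n = "a \<bullet> a" and ?s = "v \<bullet> a"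
  let ?N = "norm a powr (- ?m)"
  define N where "N = ?N"
  define r where "r = inverse ?n"
  let ?R = "\<lambda>a. norm a powr (- ?m) * ((2 - ?m) * p (tilt 2 v a)
        + 8 * (v \<bullet> a) * D1 p (tilt 2 v a) a / (a \<bullet> a) + 8 * g * (v \<bullet> v) * D2 p (tilt 2 v a) a / (a \<bullet> a))"
  have "homog0 (- ?m + 0) ?R"
    using homog0_divide[OF homog0_mult[OF homog0_cmult[OF homog0_inner] homog0_D1[of p 2 v]], of 8 v]
      homog0_divide[OF homog0_cmult[OF homog0_D2[of p 2 v]], of "8 * g * (v \<bullet> v)"]
    by (intro homog0_mult[OF homog0_powr] homog0_add homog0_cmult homog0_tilt) simp_all
  then have h: "homog0 (- ?m) ?R" by simp
  have hs: "smooth0 ?R"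
    by (intro ker_smooth)
  have k: "fluxB g p v j = (\<lambda>a. 1 * (a $ j * ?R a)
     + 2 * (norm a powr (- ?m) * (tilt 2 v a $ j * D1 p (tilt 2 v a) a))
     + (- 2) * (norm a powr (- ?m) * ((v \<bullet> a) * partial j p (tilt 2 v a)))
     + (- 4 * g * (v \<bullet> v)) * (norm a powr (- ?m) * D1 (partial j p) (tilt 2 v a) a))" for j
    by (rule ext) (simp add: fluxB_def)
  have "(\<Sum>j\<in>UNIV. partial j (fluxB g p v j) a) =
    2 * ?N * (d * p ?w - (?m + 2 * d - 4) * ?s / ?n * D1 p ?w a - 2 * (v \<bullet> v) / ?n * D2 p ?w a)
    - 2 * ?N * (d * p ?w - (?m + 2 * d - 4) * ?s / ?n * D1 p ?w a)
    + 4 * (v \<bullet> v) * ?N / ?n * (g * (?m + 2 * d - 4)) * D2 p ?w a"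
    (is "_ = ?rhs")
  proof -
    have "(\<Sum>j\<in>UNIV. partial j (fluxB g p v j) a) =
     1 * (\<Sum>j\<in>UNIV. partial j (\<lambda>a. a $ j * ?R a) a)
     + 2 * (\<Sum>j\<in>UNIV. partial j (\<lambda>a. norm a powr (- ?m) * (tilt 2 v a $ j * D1 p (tilt 2 v a) a)) a)
     + (- 2) * (\<Sum>j\<in>UNIV. partial j (\<lambda>a. norm a powr (- ?m) * ((v \<bullet> a) * partial j p (tilt 2 v a))) a)
     + (- 4 * g * (v \<bullet> v)) * (\<Sum>j\<in>UNIV. partial j (\<lambda>a. norm a powr (- ?m) * D1 (partial j p) (tilt 2 v a) a) a)"
      unfolding k by (rule div_lincomb4[OF _ _ _ _ a]; intro ker_smooth)
    also have "\<dots> = ?rhs"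
      unfolding div_radial[OF hs h a] div_tilt_mult[OF smooth0_D1[OF euler_harm_poly(1)[OF p]] a] tilt_partial_D1[OF p a]
        div_inner_tilt[OF p a] div_D1_partial[OF p a]
      unfolding N_def[symmetric] r_def[symmetric] divide_inverse by (simp add: algebra_simps)
    finally show ?thesis .
  qed
  then show ?thesis
    unfolding g by (rule trans) (simp add: divide_inverse algebra_simps)
qed

lemma flux_fluxB:
  assumes a: "a \<noteq> 0"
  shows "(\<Sum>j\<in>UNIV. a $ j * fluxB g p v j a) = (a \<bullet> a) * norm a powr (- real CARD('n)) * flux_density g p v a"
proof -
  let ?m = "real CARD('n)" and ?w = "tilt 2 v a" and ?n = "a \<bullet> a" and ?s = "v \<bullet> a"
  let ?N = "norm a powr (- ?m)"
  have n: "?n \<noteq> 0" using a by simp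
  have "(\<Sum>j\<in>UNIV. a $ j * fluxB g p v j a) =
    (\<Sum>j\<in>UNIV. (?N * ((2 - ?m) * p ?w + 8 * ?s * D1 p ?w a / ?n + 8 * g * (v \<bullet> v) * D2 p ?w a / ?n)) * (a $ j * a $ j)
      + (2 * ?N * D1 p ?w a) * (a $ j * ?w $ j)
      + (- 2 * ?N * ?s) * (a $ j * partial j p ?w) + (- 4 * g * (v \<bullet> v) * ?N) * (a $ j * D1 (partial j p) ?w a))"
    by (intro sum.cong refl) (simp add: fluxB_def algebra_simps)
  also have "\<dots> = (?N * ((2 - ?m) * p ?w + 8 * ?s * D1 p ?w a / ?n + 8 * g * (v \<bullet> v) * D2 p ?w a / ?n)) * ?n
      + (2 * ?N * D1 p ?w a) * (- ?s)
      + (- 2 * ?N * ?s) * D1 p ?w a + (- 4 * g * (v \<bullet> v) * ?N) * D2 p ?w a"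
    by (simp only: sum.distrib sum_distrib_left[symmetric] sum_a_a sum_a_tilt[OF a] sum_a_partial sum_a_D1) simp
  also have "\<dots> = ?n * ?N * flux_density g p v a"
    using n by (simp add: flux_density_def field_simps)
  finally show ?thesis .
qed

lemma homog0_kerA: "homog0 (2 - real CARD('n)) (kerA b g p v i j)"
  unfolding homog0_def kerA_def by (simp add: tilt_def powr_mult)

lemma homog0_kerB: "homog0 (2 - real CARD('n)) (kerB b g p v i j)"
  unfolding homog0_def
proof (intro allI impI)
  fix t :: real and a :: "real^'n" assume "t > 0" "a \<noteq> 0"
  moreover have "tilt 2 v (t *\<^sub>R a) = tilt 2 v a"
    using \<open>t > 0\<close> by (simp add: tilt_def)
  moreover have "D1 q w (t *\<^sub>R a) = t * D1 q w a" "D2 q w (t *\<^sub>R a) = t\<^sup>2 * D2 q w a" for q :: "real^'n \<Rightarrow> real" and w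
    by (simp_all add: D1_def D2_def sum_distrib_left mult_ac power2_eq_square)
  ultimately show "kerB b g p v i j (t *\<^sub>R a) = t powr (2 - real CARD('n)) * kerB b g p v i j a"
    by (simp add: kerB_def powr_mult power2_eq_square mult_ac)
qed

end

section \<open>Integration by parts\<close>

lemma lborel_integral_translate:
  fixes f :: "'a::euclidean_space \<Rightarrow> real"
  assumes [measurable]: "f \<in> borel_measurable borel"
  shows "(LINT x|lborel. f (y + x)) = (LINT x|lborel. f x)"
proof -
  have "(LINT x|lborel. f x) = (LINT x|distr lborel borel ((+) y). f x)"
    by (simp add: lborel_distr_plus)
  also have "\<dots> = (LINT x|lborel. f (y + x))"
    by (rule integral_distr) auto
  finally show ?thesis by simp
qed

lemma lborel_integrable_translate:
  fixes f :: "'a::euclidean_space \<Rightarrow> real"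
  assumes "integrable lborel f"
  shows "integrable lborel (\<lambda>x. f (y + x))"
proof -
  have "integrable (distr lborel borel ((+) y)) f"
    using assms by (simp add: lborel_distr_plus)
  then show ?thesis
    by (rule integrable_distr[rotated]) simp
qed

lemma lborel_integral_scale:
  fixes f :: "'a::euclidean_space \<Rightarrow> real"
  assumes [measurable]: "f \<in> borel_measurable borel" and c: "c > 0"
  shows "(LINT x|lborel. f x) = c ^ DIM('a) * (LINT x|lborel. f (c *\<^sub>R x))"
proof -
  have "(LINT x|lborel. f x) =
      (LINT x|density (distr lborel borel (\<lambda>x. 0 + c *\<^sub>R x)) (\<lambda>_. \<bar>c\<bar> ^ DIM('a)). f x)"
    using c by (subst lborel_affine[of c 0]) auto
  also have "\<dots> = (LINT x|distr lborel borel (\<lambda>x. 0 + c *\<^sub>R x). \<bar>c\<bar> ^ DIM('a) *\<^sub>R f x)"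
    using c by (subst integral_density) (auto simp: ennreal_power)
  also have "\<dots> = (LINT x|lborel. \<bar>c\<bar> ^ DIM('a) *\<^sub>R f (c *\<^sub>R x))"
    by (subst integral_distr) auto
  finally show ?thesis
    using c by simp
qed

lemma integrable_compact_support:
  fixes f :: "'a::euclidean_space \<Rightarrow> real"
  assumes "continuous_on UNIV f" "\<And>x. norm x > R \<Longrightarrow> f x = 0"
  shows "integrable lborel f"
proof -
  have "integrable lborel (\<lambda>x. indicator (cball 0 R) x *\<^sub>R f x)"
    by (rule borel_integrable_compact) (auto intro: continuous_on_subset[OF assms(1)])
  also have "(\<lambda>x. indicator (cball 0 R) x *\<^sub>R f x) = f"
    using assms(2) by (auto simp: fun_eq_iff indicator_def not_le)
  finally show ?thesis .
qed

lemma bounded_compact_support: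
  fixes f :: "'a::euclidean_space \<Rightarrow> real"
  assumes "continuous_on UNIV f" "\<And>x. norm x > R \<Longrightarrow> f x = 0"
  obtains B where "B \<ge> 0" "\<And>x. \<bar>f x\<bar> \<le> B"
proof -
  have "bounded (f ` cball 0 R)"
    by (intro compact_imp_bounded compact_continuous_image continuous_on_subset[OF assms(1)]) auto
  then obtain B where "\<forall>x\<in>cball 0 R. \<bar>f x\<bar> \<le> B"
    by (auto simp: bounded_iff)
  then have "\<And>x. x \<in> cball 0 R \<Longrightarrow> \<bar>f x\<bar> \<le> B"
    by blast
  then have "\<bar>f x\<bar> \<le> max B 0" for x
    using assms(2)[of x] by (cases "norm x \<le> R") (auto simp: le_max_iff_disj)
  then show ?thesis
    by (intro that[of "max B 0"]) auto
qed

section \<open>Differentiability along one coordinate axis\<close>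

definition has_partial :: "'n::finite \<Rightarrow> (real^'n \<Rightarrow> real) \<Rightarrow> (real^'n \<Rightarrow> real) \<Rightarrow> bool" where
  "has_partial j f f' \<longleftrightarrow> continuous_on UNIV f \<and> continuous_on UNIV f' \<and>
     (\<forall>x. ((\<lambda>t. f (x + t *\<^sub>R axis j 1)) has_real_derivative f' x) (at 0))"

lemma has_partialD:
  assumes "has_partial j f f'"
  shows "((\<lambda>t. f (x + t *\<^sub>R axis j 1)) has_real_derivative f' (x + s *\<^sub>R axis j 1)) (at s)"
proof -
  have "((\<lambda>t. f (x + s *\<^sub>R axis j 1 + t *\<^sub>R axis j 1)) has_real_derivative f' (x + s *\<^sub>R axis j 1)) (at 0)"
    using assms by (simp add: has_partial_def)
  moreover have "(\<lambda>t. f (x + s *\<^sub>R axis j 1 + t *\<^sub>R axis j 1)) = (\<lambda>t. f (x + (t + s) *\<^sub>R axis j 1))"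
    by (simp add: algebra_simps)
  ultimately show ?thesis
    using DERIV_shift[of "\<lambda>t. f (x + t *\<^sub>R axis j 1)" _ 0 s] by simp
qed

lemma has_partial_partial: "has_partial j f f' \<Longrightarrow> partial j f = f'"
  by (rule ext) (auto simp: has_partial_def partial_def intro: DERIV_imp_deriv)

lemma has_partial_mult:
  "has_partial j f f' \<Longrightarrow> has_partial j g g' \<Longrightarrow> has_partial j (\<lambda>x. f x * g x) (\<lambda>x. f' x * g x + f x * g' x)"
  by (auto simp: has_partial_def intro!: continuous_intros derivative_eq_intros)

lemma has_partial_diff:
  "has_partial j f f' \<Longrightarrow> has_partial j g g' \<Longrightarrow> has_partial j (\<lambda>x. f x - g x) (\<lambda>x. f' x - g' x)"
  by (auto simp: has_partial_def intro!: continuous_intros derivative_eq_intros)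

lemma has_partial_translate: "has_partial j f f' \<Longrightarrow> has_partial j (\<lambda>x. f (y + x)) (\<lambda>x. f' (y + x))"
  by (auto simp: has_partial_def add.assoc[symmetric]
      intro!: continuous_intros continuous_on_compose2[of UNIV f] continuous_on_compose2[of UNIV f'])

lemma has_partial_scale:
  assumes "has_partial j f f'"
  shows "has_partial j (\<lambda>x. f (c *\<^sub>R x)) (\<lambda>x. c * f' (c *\<^sub>R x))"
proof -
  have "((\<lambda>t. f (c *\<^sub>R x + (c * t) *\<^sub>R axis j 1)) has_real_derivative c * f' (c *\<^sub>R x)) (at 0)" for x
  proof -
    have "((\<lambda>t. f (c *\<^sub>R x + (c * t) *\<^sub>R axis j 1)) has_real_derivative f' (c *\<^sub>R x) * c) (at 0)"
      by (rule DERIV_chain2[where f = "\<lambda>t. f (c *\<^sub>R x + t *\<^sub>R axis j 1)" and g = "\<lambda>t. c * t"])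
        (use assms in \<open>auto simp: has_partial_def intro!: derivative_eq_intros\<close>)
    then show ?thesis by (simp add: mult.commute)
  qed
  then show ?thesis
    using assms
    by (auto simp: has_partial_def algebra_simps
        intro!: continuous_intros continuous_on_compose2[of UNIV f] continuous_on_compose2[of UNIV f'])
qed

lemma has_partial_zero:
  assumes "has_partial j f f'" "\<And>x. norm x > R \<Longrightarrow> f x = 0" "norm x > R"
  shows "f' x = 0"
proof -
  have "((\<lambda>t. f (x + t *\<^sub>R axis j 1)) has_real_derivative f' x) (at 0)"
    using assms by (simp add: has_partial_def)
  moreover have "((\<lambda>t. f (x + t *\<^sub>R axis j 1)) has_real_derivative 0) (at 0)"
  proof (rule has_field_derivative_transform_within_open[of "\<lambda>_. 0"])
    show "open ((\<lambda>t. x + t *\<^sub>R axis j 1) -` {y. norm y > R})"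
      by (intro open_vimage open_Collect_less continuous_intros)
  qed (use assms in auto)
  ultimately show ?thesis by (rule DERIV_unique)
qed

text \<open>The difference quotients integrate to zero by translation invariance, and the mean value
  theorem dominates them; no iterated integral is needed.\<close>

lemma integral_partial_eq_0:
  assumes "has_partial j f f'" "\<And>x. norm x > R \<Longrightarrow> f x = 0"
  shows "(LINT x|lborel. f' x) = 0"
proof -
  have f: "continuous_on UNIV f" "continuous_on UNIV f'"
    using assms by (auto simp: has_partial_def)
  have f'0: "norm x > R \<Longrightarrow> f' x = 0" for x
    using has_partial_zero assms by blast
  obtain B where B: "B \<ge> 0" "\<And>x. \<bar>f' x\<bar> \<le> B"
    using bounded_compact_support[OF f(2) f'0] by blast
  have [measurable]: "f \<in> borel_measurable borel" "f' \<in> borel_measurable borel"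
    using f by (auto intro: borel_measurable_continuous_onI)
  define h :: "nat \<Rightarrow> real" where "h n = 1 / real (Suc n)" for n
  have h: "h n > 0" "h n \<le> 1" for n by (auto simp: h_def)
  have h0: "h \<longlonglongrightarrow> 0"
    unfolding h_def using LIMSEQ_inverse_real_of_nat by (simp add: inverse_eq_divide)
  let ?s = "\<lambda>n x. (f (h n *\<^sub>R axis j 1 + x) - f x) / h n"
  have "(\<lambda>n. LINT x|lborel. ?s n x) \<longlonglongrightarrow> (LINT x|lborel. f' x)"
  proof (rule integral_dominated_convergence)
    \<comment> \<open>The ball is enlarged by 1 because the shifts \<open>h n\<close> are at most
      1.\<close>
    show "integrable lborel (\<lambda>x. indicator (cball 0 (R + 1)) x *\<^sub>R B)"
      by (rule borel_integrable_compact) auto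
    show "AE x in lborel. norm (?s n x) \<le> indicator (cball 0 (R + 1)) x *\<^sub>R B" for n
    proof (rule AE_I2)
      fix x
      show "norm (?s n x) \<le> indicator (cball 0 (R + 1)) x *\<^sub>R B"
      proof (cases "norm x \<le> R + 1")
        case True
        have "\<exists>z. 0 < z \<and> z < h n \<and>
          f (x + h n *\<^sub>R axis j 1) - f (x + 0 *\<^sub>R axis j 1) = (h n - 0) * f' (x + z *\<^sub>R axis j 1)"
          by (rule MVT2) (use h has_partialD[OF assms(1)] in auto)
        then obtain z where "f (h n *\<^sub>R axis j 1 + x) - f x = h n * f' (x + z *\<^sub>R axis j 1)"
          by (auto simp: add.commute)
        then show ?thesis
          using B h[of n] True by simp
      next
        case False
        have "norm (h n *\<^sub>R axis j (1::real) + x) \<ge> norm x - norm (h n *\<^sub>R axis j (1::real))"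
          using norm_diff_ineq[of x "h n *\<^sub>R axis j (1::real)"] by (simp add: add.commute)
        with False h[of n] have "norm (h n *\<^sub>R axis j (1::real) + x) > R" "norm x > R"
          by auto
        then show ?thesis
          using assms(2) B by simp
      qed
    qed
    show "AE x in lborel. (\<lambda>n. ?s n x) \<longlonglongrightarrow> f' x"
    proof (rule AE_I2)
      fix x
      have "((\<lambda>t. (f (x + t *\<^sub>R axis j 1) - f x) / t) \<longlongrightarrow> f' x) (at 0)"
        using assms(1) by (simp add: has_partial_def DERIV_def)
      moreover have "filterlim h (at 0) sequentially"
        using h0 h(1) by (auto simp: filterlim_at less_imp_neq[symmetric])
      ultimately have "(\<lambda>n. (f (x + h n *\<^sub>R axis j 1) - f x) / h n) \<longlonglongrightarrow> f' x"
        by (rule filterlim_compose)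
      then show "(\<lambda>n. ?s n x) \<longlonglongrightarrow> f' x"
        by (simp add: add.commute)
    qed
  qed auto
  moreover have "(LINT x|lborel. ?s n x) = 0" for n
  proof -
    have i: "integrable lborel f" by (rule integrable_compact_support[OF f(1) assms(2)])
    have "(LINT x|lborel. ?s n x) = ((LINT x|lborel. f (h n *\<^sub>R axis j 1 + x)) - (LINT x|lborel. f x)) / h n"
      using i lborel_integrable_translate[OF i] by simp
    then show ?thesis
      by (simp add: lborel_integral_translate)
  qed
  ultimately have "(\<lambda>n :: nat. 0 :: real) \<longlonglongrightarrow> (LINT x|lborel. f' x)"
    by (simp only:)
  from LIMSEQ_unique[OF this tendsto_const] show ?thesis .
qed

lemma integral_by_parts:
  assumes f: "has_partial j f f'" and g: "has_partial j g g'" and R: "\<And>x. norm x > R \<Longrightarrow> f x = 0"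
  shows "(LINT x|lborel. f x * g' x) = - (LINT x|lborel. f' x * g x)"
    and "integrable lborel (\<lambda>x. f x * g' x)" and "integrable lborel (\<lambda>x. f' x * g x)"
proof -
  have c: "continuous_on UNIV f" "continuous_on UNIV f'" "continuous_on UNIV g" "continuous_on UNIV g'"
    using f g by (auto simp: has_partial_def)
  have R': "norm x > R \<Longrightarrow> f' x = 0" for x
    using has_partial_zero[OF f R] by blast
  show i: "integrable lborel (\<lambda>x. f x * g' x)" "integrable lborel (\<lambda>x. f' x * g x)"
    by (rule integrable_compact_support[where R = R]; use c R R' in \<open>auto intro!: continuous_intros\<close>)+
  have "(LINT x|lborel. f' x * g x + f x * g' x) = 0"
    by (rule integral_partial_eq_0[OF has_partial_mult[OF f g], of R]) (simp add: R)
  then show "(LINT x|lborel. f x * g' x) = - (LINT x|lborel. f' x * g x)"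
    using i by simp
qed

section \<open>Products with a factor singular at the origin\<close>

lemma continuous_cut:
  fixes f :: "'a::real_normed_vector \<Rightarrow> real"
  assumes "continuous_on UNIV \<theta>" "\<And>x. norm x < e \<Longrightarrow> \<theta> x = 0" "e > 0" "continuous_on (- {0}) f"
  shows "continuous_on UNIV (\<lambda>x. \<theta> x * f x)"
proof -
  have "continuous_on (ball 0 e \<union> - {0}) (\<lambda>x. \<theta> x * f x)"
  proof (rule continuous_on_open_Un[OF open_ball])
    show "continuous_on (ball 0 e) (\<lambda>x. \<theta> x * f x)"
      by (rule continuous_on_eq[OF continuous_on_const[of _ 0]]) (simp add: assms(2))
    show "continuous_on (- {0}) (\<lambda>x. \<theta> x * f x)"
      by (rule continuous_on_mult[OF continuous_on_subset[OF assms(1)] assms(4)]) simp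
  qed auto
  moreover have "ball 0 e \<union> - {0} = (UNIV :: 'a set)"
    using assms(3) by auto
  ultimately show ?thesis by simp
qed

text \<open>Near the origin the product vanishes identically, so the arbitrary value of
  \<open>f\<close> there does no harm; elsewhere this is the product rule.\<close>

lemma has_partial_cut:
  assumes \<theta>: "has_partial j \<theta> \<theta>'" "\<And>x. norm x < e \<Longrightarrow> \<theta> x = 0" "e > 0" and f: "smooth0 f"
    and \<theta>'0: "\<And>x. norm x < e \<Longrightarrow> \<theta>' x = 0"
  shows "has_partial j (\<lambda>x. \<theta> x * f x) (\<lambda>x. \<theta>' x * f x + \<theta> x * partial j f x)"
  unfolding has_partial_def
proof (intro conjI allI)
  have c: "continuous_on UNIV \<theta>" "continuous_on UNIV \<theta>'"
    using \<theta> by (auto simp: has_partial_def)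
  show "continuous_on UNIV (\<lambda>x. \<theta> x * f x)"
    using c \<theta> f by (intro continuous_cut smooth0_continuous) auto
  show "continuous_on UNIV (\<lambda>x. \<theta>' x * f x + \<theta> x * partial j f x)"
    using c \<theta> f \<theta>'0 by (intro continuous_on_add continuous_cut[where e = e] smooth0_continuous smooth0_partial) auto
  fix x
  show "((\<lambda>t. \<theta> (x + t *\<^sub>R axis j 1) * f (x + t *\<^sub>R axis j 1)) has_real_derivative
      \<theta>' x * f x + \<theta> x * partial j f x) (at 0)"
  proof (cases "x = 0")
    case True
    have "((\<lambda>t. \<theta> (t *\<^sub>R axis j 1) * f (t *\<^sub>R axis j 1)) has_real_derivative 0) (at 0)"
      by (rule has_field_derivative_transform_within_open[of "\<lambda>_. 0" _ _ "ball 0 e"])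
         (use \<theta> in auto)
    then show ?thesis
      using True \<theta> \<theta>'0 by simp
  next
    case False
    have "((\<lambda>t. f (x + t *\<^sub>R axis j 1)) has_real_derivative partial j f x) (at 0)"
      using partial_GDERIV(2)[OF smooth0_GDERIV[OF f False]] by (simp add: grad_def)
    moreover have "((\<lambda>t. \<theta> (x + t *\<^sub>R axis j 1)) has_real_derivative \<theta>' x) (at 0)"
      using \<theta> by (simp add: has_partial_def)
    ultimately show ?thesis
      by (auto intro!: derivative_eq_intros)
  qed
qed

section \<open>Smooth cutoff functions\<close>

text \<open>The negative powers of \<open>t\<close> close the family under differentiation.\<close>

definition flat :: "nat \<Rightarrow> real \<Rightarrow> real" where
  "flat j t = (if t > 0 then exp (- 1 / t) / t ^ j else 0)"

lemma flat_nonneg: "flat j t \<ge> 0"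
  and flat_pos: "t > 0 \<Longrightarrow> flat j t > 0"
  and flat_0: "t \<le> 0 \<Longrightarrow> flat j t = 0"
  by (auto simp: flat_def)

lemma flat_tendsto_0: "(flat j \<longlongrightarrow> 0) (at_right 0)"
proof -
  have "((\<lambda>t. exp (- 1 / t) / t ^ j) \<longlongrightarrow> 0) (at_right (0::real))"
  proof -
    have "((\<lambda>y :: real. y ^ j / exp y) \<longlongrightarrow> 0) at_top"
      by (rule tendsto_power_div_exp_0)
    then have "((\<lambda>t :: real. (inverse t) ^ j / exp (inverse t)) \<longlongrightarrow> 0) (at_right 0)"
      by (rule filterlim_compose[OF _ filterlim_inverse_at_top_right])
    then show ?thesis
      by (simp add: exp_minus field_simps inverse_eq_divide)
  qed
  then show ?thesis
    by (rule Lim_transform_eventually) (auto simp: eventually_at_filter flat_def)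
qed

lemma flat_DERIV: "(flat j has_real_derivative (flat (j + 2) t - real j * flat (j + 1) t)) (at t)"
proof (cases t "0 :: real" rule: linorder_cases)
  case less
  then have "(flat j has_real_derivative 0) (at t)"
    by (intro has_field_derivative_transform_within_open[OF DERIV_const, where S = "{..<0}"]) (auto simp: flat_def)
  then show ?thesis
    using less by (simp add: flat_0)
next
  case equal
  have "((\<lambda>h. (flat j (0 + h) - flat j 0) / h) \<longlongrightarrow> 0) (at 0)"
  proof (subst filterlim_at_split, intro conjI)
    show "((\<lambda>h. (flat j (0 + h) - flat j 0) / h) \<longlongrightarrow> 0) (at_left 0)"
      by (rule tendsto_eventually) (auto simp: eventually_at_filter flat_def)
    show "((\<lambda>h. (flat j (0 + h) - flat j 0) / h) \<longlongrightarrow> 0) (at_right 0)"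
      by (rule Lim_transform_eventually[OF flat_tendsto_0[of "Suc j"]])
        (auto simp: eventually_at_filter flat_def)
  qed
  then show ?thesis
    using equal by (simp add: DERIV_def flat_0)
next
  case greater
  let ?u = "inverse t"
  have e: "((\<lambda>t. exp (- inverse t)) has_real_derivative exp (- ?u) * ?u\<^sup>2) (at t)"
    using greater by (auto intro!: derivative_eq_intros simp: power2_eq_square)
  have "((\<lambda>t. inverse t ^ j) has_real_derivative - real j * ?u ^ (j + 1)) (at t)"
    using DERIV_power[OF DERIV_inverse[of t UNIV], of j] greater
    by (cases j) (auto simp: power2_eq_square algebra_simps)
  from DERIV_mult[OF e this]
  have "((\<lambda>t. exp (- inverse t) * inverse t ^ j) has_real_derivative
      (flat (j + 2) t - real j * flat (j + 1) t)) (at t)"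
    using greater by (simp add: flat_def divide_inverse power_inverse power2_eq_square algebra_simps)
  then show ?thesis
    by (rule has_field_derivative_transform_within_open[where S = "{0<..}"])
      (use greater in \<open>auto simp: flat_def divide_inverse power_inverse\<close>)
qed

lemma continuous_flat: "continuous_on UNIV (flat j)"
  by (intro continuous_at_imp_continuous_on ballI DERIV_isCont[OF flat_DERIV])

lemma flat_compose_DERIV [derivative_intros]:
  "(f has_real_derivative f') (at t) \<Longrightarrow>
    ((\<lambda>x. flat j (f x)) has_real_derivative (flat (j + 2) (f t) - real j * flat (j + 1) (f t)) * f') (at t)"
  by (rule DERIV_chain2[OF flat_DERIV])

section \<open>A smooth step and its first two derivatives\<close>

text \<open>Never zero, as \<open>2 - t\<close> and \<open>t - 1\<close> add up to 1 and cannot both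
  be nonpositive.\<close>

definition step_den :: "real \<Rightarrow> real" where
  "step_den t = flat 0 (2 - t) + flat 0 (t - 1)"

definition step :: "real \<Rightarrow> real" where
  "step t = flat 0 (2 - t) / step_den t"

text \<open>The derivative of \<open>step\<close>, with \<open>flat 2\<close> as the derivative of
  \<open>flat 0\<close>. Both products in the numerator are nonnegative, so the sign can be read
  off.\<close>

definition step1 :: "real \<Rightarrow> real" where
  "step1 t = - (flat 2 (2 - t) * flat 0 (t - 1) + flat 0 (2 - t) * flat 2 (t - 1)) / (step_den t)\<^sup>2"

lemma step_den_pos: "step_den t > 0"
proof (cases "t < 2")
  case True
  then show ?thesis
    using flat_pos[of "2 - t" 0] flat_nonneg[of 0 "t - 1"] unfolding step_den_def by linarith
next
  case False
  then show ?thesis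
    using flat_pos[of "t - 1" 0] flat_nonneg[of 0 "2 - t"] unfolding step_den_def by linarith
qed

lemma step_den_DERIV: "(step_den has_real_derivative (flat 2 (t - 1) - flat 2 (2 - t))) (at t)"
  unfolding step_den_def by (auto intro!: derivative_eq_intros simp: numeral_eq_Suc)

lemma step_DERIV: "(step has_real_derivative step1 t) (at t)"
proof -
  have "((\<lambda>t. flat 0 (2 - t)) has_real_derivative - flat 2 (2 - t)) (at t)"
    by (auto intro!: derivative_eq_intros simp: numeral_eq_Suc)
  from DERIV_divide[OF this step_den_DERIV] show ?thesis
    using step_den_pos[of t] unfolding step_def[abs_def] step1_def
    by (simp add: step_den_def power2_eq_square algebra_simps)
qed

lemma step1_DERIV: "\<exists>D. \<forall>t. (step1 has_real_derivative D t) (at t) \<and> continuous_on UNIV D"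
proof -
  let ?N1 = "\<lambda>t. (- (flat 4 (2 - t) - 2 * flat 3 (2 - t))) * flat 0 (t - 1) + flat 2 (2 - t) * flat 2 (t - 1)
      + ((- flat 2 (2 - t)) * flat 2 (t - 1) + flat 0 (2 - t) * (flat 4 (t - 1) - 2 * flat 3 (t - 1)))"
  let ?N = "\<lambda>t. flat 2 (2 - t) * flat 0 (t - 1) + flat 0 (2 - t) * flat 2 (t - 1)"
  let ?d = "\<lambda>t. flat 2 (t - 1) - flat 2 (2 - t)"
  have N: "(?N has_real_derivative ?N1 t) (at t)" for t
    by (rule derivative_eq_intros refl | simp)+ (simp add: numeral_eq_Suc algebra_simps)
  have D: "((\<lambda>t. (step_den t)\<^sup>2) has_real_derivative 2 * step_den t * ?d t) (at t)" for t
    using DERIV_power[OF step_den_DERIV[of t], where n = 2] by (simp add: mult_ac)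
  let ?D = "\<lambda>t. - ((?N1 t * (step_den t)\<^sup>2 - ?N t * (2 * step_den t * ?d t)) / ((step_den t)\<^sup>2 * (step_den t)\<^sup>2))"
  have "(step1 has_real_derivative ?D t) (at t)" for t
    using DERIV_minus[OF DERIV_divide[OF N D]] step_den_pos[of t]
    unfolding step1_def[abs_def] by (simp add: minus_divide_left)
  moreover have "continuous_on UNIV ?D"
    unfolding step_den_def
    by (intro continuous_intros continuous_on_compose2[OF continuous_flat])
      (use step_den_pos in \<open>auto simp: step_den_def less_imp_neq[symmetric]\<close>)
  ultimately show ?thesis by (intro exI[of _ ?D]) simp
qed

text \<open>Only existence and continuity of the second derivative matter, so its formula is
  hidden.\<close>

definition step2 :: "real \<Rightarrow> real" where
  "step2 = (SOME D. \<forall>t. (step1 has_real_derivative D t) (at t) \<and> continuous_on UNIV D)"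

lemma step2_DERIV: "(step1 has_real_derivative step2 t) (at t)"
  and continuous_step2: "continuous_on UNIV step2"
proof -
  have "\<forall>t. (step1 has_real_derivative step2 t) (at t) \<and> continuous_on UNIV step2"
    unfolding step2_def by (rule someI_ex[OF step1_DERIV])
  then show "(step1 has_real_derivative step2 t) (at t)" "continuous_on UNIV step2" by auto
qed

lemma step_eq_1: "t \<le> 1 \<Longrightarrow> step t = 1"
  using step_den_pos[of t] by (simp add: step_def step_den_def flat_0)

lemma step_eq_0: "t \<ge> 2 \<Longrightarrow> step t = 0"
  by (simp add: step_def flat_0)

lemma step_bounds: "0 \<le> step t" "step t \<le> 1"
  using step_den_pos[of t] flat_nonneg[of 0 "2 - t"] flat_nonneg[of 0 "t - 1"]
  by (auto simp: step_def step_den_def)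

lemma step1_nonpos: "step1 t \<le> 0"
  unfolding step1_def minus_divide_left[symmetric] neg_le_0_iff_le
  by (intro divide_nonneg_nonneg add_nonneg_nonneg mult_nonneg_nonneg flat_nonneg) simp

lemma step1_neg: "1 < t \<Longrightarrow> t < 2 \<Longrightarrow> step1 t < 0"
  unfolding step1_def minus_divide_left[symmetric] neg_less_0_iff_less using step_den_pos[of t]
  by (intro divide_pos_pos add_pos_pos mult_pos_pos flat_pos) simp_all

lemma step1_eq_0: "t \<le> 1 \<or> t \<ge> 2 \<Longrightarrow> step1 t = 0"
  by (auto simp: step1_def flat_0)

lemma step2_eq_0: "t < 1 \<or> t > 2 \<Longrightarrow> step2 t = 0"
proof -
  assume t: "t < 1 \<or> t > 2"
  have "(step1 has_real_derivative 0) (at t)"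
    by (rule has_field_derivative_transform_within_open[OF DERIV_const, where S = "{..<1} \<union> {2<..}"])
       (use t in \<open>auto simp: step1_eq_0\<close>)
  then show ?thesis
    using step2_DERIV DERIV_unique by blast
qed

lemma continuous_step1: "continuous_on UNIV step1"
  by (intro continuous_at_imp_continuous_on ballI DERIV_isCont[OF step2_DERIV])

lemma has_partial_radial:
  fixes f f' :: "real \<Rightarrow> real" and j :: "'n::finite"
  assumes "\<And>t. (f has_real_derivative f' t) (at t)" "continuous_on UNIV f'"
  shows "has_partial j (\<lambda>a. f (a \<bullet> a)) (\<lambda>a. 2 * a $ j * f' (a \<bullet> a))"
  unfolding has_partial_def
proof (intro conjI allI)
  have f: "continuous_on UNIV f"
    by (intro continuous_at_imp_continuous_on ballI DERIV_isCont[OF assms(1)])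
  show "continuous_on UNIV (\<lambda>a :: real^'n. f (a \<bullet> a))" "continuous_on UNIV (\<lambda>a. 2 * a $ j * f' (a \<bullet> a))"
    by (intro continuous_intros continuous_on_compose2[OF f] continuous_on_compose2[OF assms(2)]; simp)+
  fix x :: "real^'n"
  have "((\<lambda>t. (x + t *\<^sub>R axis j 1) \<bullet> (x + t *\<^sub>R axis j 1)) has_real_derivative 2 * x $ j) (at 0)"
    by (simp add: inner_simps inner_axis inner_axis') (auto intro!: derivative_eq_intros)
  from DERIV_chain2[OF assms(1) this]
  show "((\<lambda>t. f ((x + t *\<^sub>R axis j 1) \<bullet> (x + t *\<^sub>R axis j 1))) has_real_derivative 2 * x $ j * f' (x \<bullet> x)) (at 0)"
    by (simp add: mult.commute)
qed

section \<open>The radial cutoff\<close>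

text \<open>The argument \<open>a \<bullet> a\<close> keeps the function differentiable at the
  origin. The actual support has radius \<open>sqrt 2\<close>; the estimates below use the cruder
  radius 2.\<close>

definition cutoff :: "real^'n::finite \<Rightarrow> real" where "cutoff a = step (a \<bullet> a)"
definition cutoff1 :: "'n::finite \<Rightarrow> real^'n \<Rightarrow> real" where "cutoff1 j a = 2 * a $ j * step1 (a \<bullet> a)"
definition cutoff2 :: "'n::finite \<Rightarrow> 'n \<Rightarrow> real^'n \<Rightarrow> real" where
  "cutoff2 i j a = 2 * axis i 1 $ j * step1 (a \<bullet> a) + 2 * a $ j * (2 * a $ i * step2 (a \<bullet> a))"

lemma has_partial_nth: "has_partial i (\<lambda>a. c * a $ j) (\<lambda>a. c * axis i 1 $ j)"
  by (auto simp: has_partial_def intro!: continuous_intros derivative_eq_intros)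

lemma has_partial_cutoff: "has_partial j cutoff (cutoff1 j)"
  unfolding cutoff_def[abs_def] cutoff1_def[abs_def] by (rule has_partial_radial[OF step_DERIV continuous_step1])

lemma has_partial_cutoff1: "has_partial i (cutoff1 j) (cutoff2 i j)"
  using has_partial_mult[OF has_partial_nth[of i 2 j] has_partial_radial[OF step2_DERIV continuous_step2, of i]]
  unfolding cutoff1_def[abs_def] cutoff2_def[abs_def] .

lemma inner_self_less_1: "norm (a :: 'a::real_inner) < 1 \<Longrightarrow> a \<bullet> a < 1"
  by (simp add: dot_square_norm power_less_one_iff)

lemma inner_self_greater_2: "norm (a :: 'a::real_inner) > 2 \<Longrightarrow> a \<bullet> a > 2"
  using power_strict_mono[of 2 "norm a" 2] by (simp add: dot_square_norm)

lemma cutoff_small: "norm a < 1 \<Longrightarrow> cutoff a = 1" "norm a < 1 \<Longrightarrow> cutoff1 j a = 0" "norm a < 1 \<Longrightarrow> cutoff2 i j a = 0"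
  using inner_self_less_1[of a] by (auto simp: cutoff_def cutoff1_def cutoff2_def step_eq_1 step1_eq_0 step2_eq_0)

lemma cutoff_large: "norm a > 2 \<Longrightarrow> cutoff a = 0" "norm a > 2 \<Longrightarrow> cutoff1 j a = 0" "norm a > 2 \<Longrightarrow> cutoff2 i j a = 0"
  using inner_self_greater_2[of a] by (auto simp: cutoff_def cutoff1_def cutoff2_def step_eq_0 step1_eq_0 step2_eq_0)

lemma cutoff_bounds: "0 \<le> cutoff a" "cutoff a \<le> 1"
  by (auto simp: cutoff_def step_bounds)

section \<open>Green's identity for a homogeneous kernel\<close>

text \<open>Domination by a series over dyadic balls: on the ball of radius \<open>R / 2 ^ k\<close>
  the volume outweighs the singularity by the square of the radius, so the series is geometric with
  ratio \<open>1 / 4\<close>.\<close>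

lemma integrable_norm_powr:
  fixes R :: real
  assumes R: "R > 0" and m: "CARD('n::finite) > 2"
  shows "integrable lborel (\<lambda>a :: real^'n. indicator (cball 0 R) a * norm a powr (2 - real CARD('n)))"
proof (rule integrableI_bounded)
  let ?m = "CARD('n)"
  let ?f = "\<lambda>a :: real^'n. indicator (cball 0 R) a * norm a powr (2 - real ?m)"
  have "(\<lambda>a :: real^'n. norm a powr (2 - real ?m)) \<in> borel_measurable borel"
    by (intro powr_real_measurable borel_measurable_norm) auto
  then show "?f \<in> borel_measurable lborel"
    by (auto intro!: borel_measurable_times borel_measurable_indicator)
  let ?r = "\<lambda>k :: nat. R / 2 ^ k"
  let ?c = "\<lambda>k. (?r (Suc k)) powr (2 - real ?m)"
  let ?V = "unit_ball_vol (real ?m)"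
  have le: "ennreal (norm (?f a)) \<le> (\<Sum>k. ennreal (?c k) * indicator (cball 0 (?r k)) a)" for a
  proof (cases "a = 0 \<or> norm a > R")
    case False
    then have a: "0 < norm a" "norm a \<le> R" by auto
    have "\<exists>k. ?r k < norm a"
    proof -
      obtain k where "R / norm a < 2 ^ k"
        using real_arch_pow[of 2 "R / norm a"] by auto
      then show ?thesis using a by (intro exI[of _ k]) (simp add: field_simps)
    qed
    \<comment> \<open>The first dyadic radius below \<open>norm a\<close>. It is not the zeroth,
      since \<open>norm a \<le> R\<close>, so its predecessor \<open>l\<close> brackets
      \<open>norm a\<close> from above.\<close>
    then obtain k where k: "?r k < norm a" "\<And>l. l < k \<Longrightarrow> \<not> ?r l < norm a"
      using exists_least_iff[of "\<lambda>k. ?r k < norm a"] by auto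
    with a obtain l where l: "k = Suc l" by (cases k) auto
    have "ennreal (norm (?f a)) \<le> ennreal (?c l) * indicator (cball 0 (?r l)) a"
    proof -
      have "norm a powr (2 - real ?m) \<le> ?c l"
        using k l R m by (intro powr_mono2') auto
      moreover have "norm a \<le> ?r l" using k(2)[of l] l by simp
      ultimately show ?thesis using a by (simp add: ennreal_leI)
    qed
    also have "\<dots> \<le> (\<Sum>k. ennreal (?c k) * indicator (cball 0 (?r k)) a)"
    proof -
      define F where "F k = ennreal (?c k) * indicator (cball 0 (?r k)) a" for k
      have "sum F {l} \<le> suminf F"
        by (rule sum_le_suminf) auto
      then have "F l \<le> suminf F" by simp
      then show ?thesis unfolding F_def .
    qed
    finally show ?thesis .
  qed auto
  have "(\<integral>\<^sup>+a. ennreal (norm (?f a)) \<partial>lborel) \<le>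
      (\<integral>\<^sup>+a. (\<Sum>k. ennreal (?c k) * indicator (cball 0 (?r k)) (a :: real^'n)) \<partial>lborel)"
    by (intro nn_integral_mono le)
  also have "\<dots> = (\<Sum>k. \<integral>\<^sup>+a. ennreal (?c k) * indicator (cball 0 (?r k)) (a :: real^'n) \<partial>lborel)"
    by (rule nn_integral_suminf) (intro borel_measurable_times_ennreal borel_measurable_const borel_measurable_indicator, simp)
  also have "\<dots> = (\<Sum>k. ennreal ((?V * R\<^sup>2 * 2 powr (real ?m - 2)) * (1 / 4) ^ k))"
  proof (rule suminf_cong)
    fix k
    have "(\<integral>\<^sup>+a. ennreal (?c k) * indicator (cball 0 (?r k)) (a :: real^'n) \<partial>lborel) =
        ennreal (?c k) * emeasure lborel (cball (0 :: real^'n) (?r k))"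
      by (subst nn_integral_cmult_indicator) auto
    also have "\<dots> = ennreal (?c k) * ennreal (?V * ?r k ^ ?m)"
      using R by (subst emeasure_cball) auto
    also have "\<dots> = ennreal (?c k * (?V * ?r k ^ ?m))"
      by (rule ennreal_mult[symmetric]) (use R in \<open>auto simp: unit_ball_vol_nonneg\<close>)
    also have "?c k * (?V * ?r k ^ ?m) = (?V * R\<^sup>2 * 2 powr (real ?m - 2)) * (1 / 4) ^ k"
    proof -
      have 1: "?c k = ?r k powr (2 - real ?m) * (1 / 2) powr (2 - real ?m)"
      proof -
        have "?r (Suc k) = ?r k * (1 / 2)" by simp
        then show ?thesis using R by (simp only: powr_mult)
      qed
      have 2: "?r k ^ ?m = ?r k powr real ?m"
        using R by (simp add: powr_realpow)
      have 3: "?r k powr (2 - real ?m) * ?r k powr real ?m = (?r k)\<^sup>2"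
        using R by (subst powr_add[symmetric]) (simp add: powr_realpow)
      have 4: "(1 / 2 :: real) powr (2 - real ?m) = 2 powr (real ?m - 2)"
        by (simp add: powr_divide powr_diff)
      have 5: "(?r k)\<^sup>2 = R\<^sup>2 * (1 / 4) ^ k"
        by (simp add: power_divide power_mult[symmetric] mult.commute[of k 2]) (simp add: power_mult)
      have "?c k * (?V * ?r k ^ ?m) =
          ?V * (?r k powr (2 - real ?m) * ?r k powr real ?m) * 2 powr (real ?m - 2)"
        unfolding 1 2 4 by (simp only: mult_ac)
      then show ?thesis
        unfolding 3 5 by (simp only: mult_ac)
    qed
    finally show "(\<integral>\<^sup>+a. ennreal (?c k) * indicator (cball 0 (?r k)) (a :: real^'n) \<partial>lborel) =
      ennreal ((?V * R\<^sup>2 * 2 powr (real ?m - 2)) * (1 / 4) ^ k)" .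
  qed
  also have "\<dots> < \<infinity>"
    by (subst suminf_ennreal2) (auto intro!: summable_mult summable_geometric simp: unit_ball_vol_nonneg less_top[symmetric])
  finally show "(\<integral>\<^sup>+a. ennreal (norm (?f a)) \<partial>lborel) < \<infinity>" .
qed

lemma homog0_bound:
  fixes f :: "real^'n::finite \<Rightarrow> real"
  assumes "smooth0 f" "homog0 c f"
  obtains C where "C \<ge> 0" "\<And>a. a \<noteq> 0 \<Longrightarrow> \<bar>f a\<bar> \<le> C * norm a powr c"
proof -
  have "bounded (f ` sphere 0 1)"
    by (intro compact_imp_bounded compact_continuous_image continuous_on_subset[OF smooth0_continuous[OF assms(1)]]) auto
  then obtain C where C: "\<forall>x\<in>sphere 0 1. \<bar>f x\<bar> \<le> C"
    by (auto simp: bounded_iff)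
  have "\<bar>f a\<bar> \<le> max C 0 * norm a powr c" if "a \<noteq> 0" for a
  proof -
    have "f (norm a *\<^sub>R (a /\<^sub>R norm a)) = norm a powr c * f (a /\<^sub>R norm a)"
      using assms(2)[unfolded homog0_def, rule_format, of "norm a" "a /\<^sub>R norm a"] that by auto
    then have "\<bar>f a\<bar> = norm a powr c * \<bar>f (a /\<^sub>R norm a)\<bar>"
      using that by (simp add: abs_mult)
    also have "\<dots> \<le> norm a powr c * max C 0"
      using C that by (intro mult_left_mono) (auto simp: le_max_iff_disj)
    finally show ?thesis by (simp add: mult.commute)
  qed
  then show ?thesis
    by (intro that[of "max C 0"]) auto
qed

section \<open>Functions with explicit second derivatives\<close>

text \<open>The derivatives are carried along as data, so that translated, scaled and subtracted
  functions come with formulas for theirs. No symmetry of \<open>f2\<close> is asked for.\<close>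

definition C2 :: "(real^'n::finite \<Rightarrow> real) \<Rightarrow> ('n \<Rightarrow> real^'n \<Rightarrow> real) \<Rightarrow> ('n \<Rightarrow> 'n \<Rightarrow> real^'n \<Rightarrow> real) \<Rightarrow> bool" where
  "C2 f f1 f2 \<longleftrightarrow> (\<forall>j. has_partial j f (f1 j)) \<and> (\<forall>i j. has_partial i (f1 j) (f2 i j))"

lemma C2_continuous:
  assumes "C2 f f1 f2"
  shows "continuous_on UNIV f" "continuous_on UNIV (f1 j)" "continuous_on UNIV (f2 i j)"
  using assms by (auto simp: C2_def has_partial_def)

lemma C2_translate:
  "C2 f f1 f2 \<Longrightarrow> C2 (\<lambda>a. f (y + a)) (\<lambda>j a. f1 j (y + a)) (\<lambda>i j a. f2 i j (y + a))"
  by (auto simp: C2_def intro: has_partial_translate)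

lemma C2_cutoff: "C2 cutoff cutoff1 cutoff2"
  by (auto simp: C2_def has_partial_cutoff has_partial_cutoff1)

lemma has_partial_cmult: "has_partial j f f' \<Longrightarrow> has_partial j (\<lambda>x. c * f x) (\<lambda>x. c * f' x)"
  by (auto simp: has_partial_def intro!: continuous_intros derivative_eq_intros)

lemma C2_scale:
  "C2 f f1 f2 \<Longrightarrow> C2 (\<lambda>a. f (c *\<^sub>R a)) (\<lambda>j a. c * f1 j (c *\<^sub>R a)) (\<lambda>i j a. c * (c * f2 i j (c *\<^sub>R a)))"
  by (auto simp: C2_def intro!: has_partial_scale has_partial_cmult)

lemma C2_diff:
  "C2 f f1 f2 \<Longrightarrow> C2 g g1 g2 \<Longrightarrow> C2 (\<lambda>a. f a - g a) (\<lambda>j a. f1 j a - g1 j a) (\<lambda>i j a. f2 i j a - g2 i j a)"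
  by (auto simp: C2_def intro!: has_partial_diff)

lemma integrable_cut3:
  fixes \<theta> f g :: "real^'n::finite \<Rightarrow> real"
  assumes "continuous_on UNIV \<theta>" "\<And>x. norm x < e \<Longrightarrow> \<theta> x = 0" "e > 0" "\<And>x. norm x > R \<Longrightarrow> \<theta> x = 0"
    "smooth0 f" "continuous_on UNIV g"
  shows "integrable lborel (\<lambda>x. \<theta> x * f x * g x)"
  by (rule integrable_compact_support[where R = R])
    (use assms in \<open>auto intro!: continuous_on_mult[OF continuous_cut[where e = e]] smooth0_continuous\<close>)

section \<open>Kernels with divergence-free flux\<close>

text \<open>What \<open>kerA\<close> and \<open>kerB\<close> have in common. Degree
  \<open>2 - m\<close> is the one at which two derivatives balance the volume element, so that
  boundary terms are independent of the scale.\<close>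

locale flux_kernel =
  fixes M :: "'n::finite \<Rightarrow> 'n \<Rightarrow> real^'n \<Rightarrow> real" and J :: "'n \<Rightarrow> real^'n \<Rightarrow> real"
  assumes smooth_M: "smooth0 (M i j)" and smooth_J: "smooth0 (J j)"
    and homog_M: "homog0 (2 - real CARD('n)) (M i j)"
    and div_M: "a \<noteq> 0 \<Longrightarrow> (\<Sum>i\<in>UNIV. partial i (M i j) a) = J j a"
    and div_J: "a \<noteq> 0 \<Longrightarrow> (\<Sum>j\<in>UNIV. partial j (J j) a) = 0"
begin

text \<open>Two integrations by parts turn \<open>\<theta>\<close> times the kernel into the
  divergences of \<open>\<theta>1 i * M i j\<close> and of \<open>\<theta> * J j\<close>. The one
  term with \<open>\<theta>\<close> undifferentiated is the divergence of \<open>J\<close> and drops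
  out, so the remainder lives where \<open>\<theta>\<close> varies.\<close>

definition defect :: "('n \<Rightarrow> real^'n \<Rightarrow> real) \<Rightarrow> ('n \<Rightarrow> 'n \<Rightarrow> real^'n \<Rightarrow> real) \<Rightarrow> real^'n \<Rightarrow> real" where
  "defect \<theta>1 \<theta>2 a = (\<Sum>i\<in>UNIV. \<Sum>j\<in>UNIV. \<theta>2 j i a * M i j a + \<theta>1 i a * partial j (M i j) a)
     + (\<Sum>j\<in>UNIV. \<theta>1 j a * J j a)"

text \<open>After the derivative in \<open>i\<close> has been moved (\<open>A\<close>), the sum over
  \<open>i\<close> replaces the divergence of the kernel by \<open>J\<close> (\<open>D\<close>);
  only then is the second derivative moved, and \<open>E\<close> removes what is left. All of it is
  legitimate because \<open>\<theta>\<close> vanishes near the singularity.\<close>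

lemma green:
  assumes \<theta>: "C2 \<theta> \<theta>1 \<theta>2" and \<phi>: "C2 \<phi> \<phi>1 \<phi>2" and e: "e > 0"
    and z: "\<And>a. norm a < e \<Longrightarrow> \<theta> a = 0" "\<And>a j. norm a < e \<Longrightarrow> \<theta>1 j a = 0" "\<And>a i j. norm a < e \<Longrightarrow> \<theta>2 i j a = 0"
    and R: "\<And>a. norm a > R \<Longrightarrow> \<theta> a = 0"
  shows "(LINT a|lborel. \<theta> a * (\<Sum>i\<in>UNIV. \<Sum>j\<in>UNIV. M i j a * \<phi>2 i j a)) =
    (LINT a|lborel. \<phi> a * defect \<theta>1 \<theta>2 a)"
proof -
  note c\<theta> = C2_continuous[OF \<theta>] and c\<phi> = C2_continuous[OF \<phi>]
  have p\<theta>: "has_partial j \<theta> (\<theta>1 j)" "has_partial i (\<theta>1 j) (\<theta>2 i j)"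
    and p\<phi>: "has_partial j \<phi> (\<phi>1 j)" "has_partial i (\<phi>1 j) (\<phi>2 i j)" for i j
    using \<theta> \<phi> by (auto simp: C2_def)
  have R1: "norm a > R \<Longrightarrow> \<theta>1 j a = 0" for a j
    using has_partial_zero[OF p\<theta>(1) R] by blast
  have R2: "norm a > R \<Longrightarrow> \<theta>2 i j a = 0" for a i j
    using has_partial_zero[OF p\<theta>(2) R1] by blast
  have int0: "integrable lborel (\<lambda>a. \<theta> a * f a * g a)" if "smooth0 f" "continuous_on UNIV g" for f g
    using that by (intro integrable_cut3[OF c\<theta>(1) z(1) e R]) auto
  have int1: "integrable lborel (\<lambda>a. \<theta>1 j a * f a * g a)" if "smooth0 f" "continuous_on UNIV g" for f g j
    using that by (intro integrable_cut3[OF c\<theta>(2) z(2) e R1]) auto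
  have int2: "integrable lborel (\<lambda>a. \<theta>2 i j a * f a * g a)" if "smooth0 f" "continuous_on UNIV g" for f g i j
    using that by (intro integrable_cut3[OF c\<theta>(3) z(3) e R2]) auto
  note ints = int0[OF smooth_M] int0[OF smooth0_partial[OF smooth_M]] int0[OF smooth_J]
    int0[OF smooth0_partial[OF smooth_J]] int1[OF smooth_M] int1[OF smooth0_partial[OF smooth_M]]
    int1[OF smooth_J] int2[OF smooth_M]
  have A: "(LINT a|lborel. \<theta> a * M i j a * \<phi>2 i j a) =
     - (LINT a|lborel. \<theta>1 i a * M i j a * \<phi>1 j a) - (LINT a|lborel. \<theta> a * partial i (M i j) a * \<phi>1 j a)" for i j
  proof -
    have "(LINT a|lborel. \<theta> a * M i j a * \<phi>2 i j a) =
        - (LINT a|lborel. (\<theta>1 i a * M i j a + \<theta> a * partial i (M i j) a) * \<phi>1 j a)"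
      by (rule integral_by_parts(1)[OF has_partial_cut[OF p\<theta>(1) z(1) e smooth_M z(2)] p\<phi>(2), where R = R]) (auto simp: R)
    also have "(LINT a|lborel. (\<theta>1 i a * M i j a + \<theta> a * partial i (M i j) a) * \<phi>1 j a) =
       (LINT a|lborel. \<theta>1 i a * M i j a * \<phi>1 j a) + (LINT a|lborel. \<theta> a * partial i (M i j) a * \<phi>1 j a)"
      unfolding distrib_right by (intro Bochner_Integration.integral_add ints c\<phi>)
    finally show ?thesis by simp
  qed
  have B: "(LINT a|lborel. \<theta>1 i a * M i j a * \<phi>1 j a) =
     - (LINT a|lborel. \<phi> a * (\<theta>2 j i a * M i j a + \<theta>1 i a * partial j (M i j) a))" for i j
    by (subst mult.commute[of "\<phi> _"])
      (rule integral_by_parts(1)[OF has_partial_cut[OF p\<theta>(2) z(2) e smooth_M z(3)] p\<phi>(1), where R = R], auto simp: R1)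
  have C: "(LINT a|lborel. \<theta> a * J j a * \<phi>1 j a) =
     - (LINT a|lborel. \<theta>1 j a * J j a * \<phi> a) - (LINT a|lborel. \<theta> a * partial j (J j) a * \<phi> a)" for j
  proof -
    have "(LINT a|lborel. \<theta> a * J j a * \<phi>1 j a) =
        - (LINT a|lborel. (\<theta>1 j a * J j a + \<theta> a * partial j (J j) a) * \<phi> a)"
      by (rule integral_by_parts(1)[OF has_partial_cut[OF p\<theta>(1) z(1) e smooth_J z(2)] p\<phi>(1), where R = R]) (auto simp: R)
    also have "(LINT a|lborel. (\<theta>1 j a * J j a + \<theta> a * partial j (J j) a) * \<phi> a) =
       (LINT a|lborel. \<theta>1 j a * J j a * \<phi> a) + (LINT a|lborel. \<theta> a * partial j (J j) a * \<phi> a)"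
      unfolding distrib_right by (intro Bochner_Integration.integral_add ints c\<phi>)
    finally show ?thesis by simp
  qed
  have D: "(\<Sum>i\<in>UNIV. \<Sum>j\<in>UNIV. (LINT a|lborel. \<theta> a * partial i (M i j) a * \<phi>1 j a)) =
     (\<Sum>j\<in>UNIV. (LINT a|lborel. \<theta> a * J j a * \<phi>1 j a))"
  proof (subst sum.swap, rule sum.cong[OF refl])
    fix j
    have "(\<Sum>i\<in>UNIV. (LINT a|lborel. \<theta> a * partial i (M i j) a * \<phi>1 j a)) =
        (LINT a|lborel. (\<Sum>i\<in>UNIV. \<theta> a * partial i (M i j) a * \<phi>1 j a))"
      by (subst Bochner_Integration.integral_sum) (auto intro!: ints c\<phi>)
    also have "(\<lambda>a. \<Sum>i\<in>UNIV. \<theta> a * partial i (M i j) a * \<phi>1 j a) = (\<lambda>a. \<theta> a * J j a * \<phi>1 j a)"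
    proof
      fix a
      show "(\<Sum>i\<in>UNIV. \<theta> a * partial i (M i j) a * \<phi>1 j a) = \<theta> a * J j a * \<phi>1 j a"
        using div_M[of a j] z(1)[of a] e
        by (cases "a = 0") (auto simp: sum_distrib_left[symmetric] sum_distrib_right[symmetric])
    qed
    finally show "(\<Sum>i\<in>UNIV. (LINT a|lborel. \<theta> a * partial i (M i j) a * \<phi>1 j a)) =
      (LINT a|lborel. \<theta> a * J j a * \<phi>1 j a)" .
  qed
  have E: "(\<Sum>j\<in>UNIV. (LINT a|lborel. \<theta> a * partial j (J j) a * \<phi> a)) = 0"
  proof -
    have "(\<Sum>j\<in>UNIV. (LINT a|lborel. \<theta> a * partial j (J j) a * \<phi> a)) =
        (LINT a|lborel. (\<Sum>j\<in>UNIV. \<theta> a * partial j (J j) a * \<phi> a))"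
      by (subst Bochner_Integration.integral_sum) (auto intro!: ints c\<phi>)
    also have "(\<lambda>a. \<Sum>j\<in>UNIV. \<theta> a * partial j (J j) a * \<phi> a) = (\<lambda>a. 0)"
    proof
      fix a
      show "(\<Sum>j\<in>UNIV. \<theta> a * partial j (J j) a * \<phi> a) = 0"
        using div_J[of a] z(1)[of a] e
        by (cases "a = 0") (auto simp: sum_distrib_left[symmetric] sum_distrib_right[symmetric])
    qed
    finally show ?thesis by simp
  qed
  have "(LINT a|lborel. \<theta> a * (\<Sum>i\<in>UNIV. \<Sum>j\<in>UNIV. M i j a * \<phi>2 i j a)) =
      (\<Sum>i\<in>UNIV. \<Sum>j\<in>UNIV. (LINT a|lborel. \<theta> a * M i j a * \<phi>2 i j a))"
    by (simp add: sum_distrib_left Bochner_Integration.integral_sum ints c\<phi> flip: mult.assoc)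
  also have "\<dots> = (\<Sum>i\<in>UNIV. \<Sum>j\<in>UNIV. (LINT a|lborel. \<phi> a * (\<theta>2 j i a * M i j a + \<theta>1 i a * partial j (M i j) a)))
      + (\<Sum>j\<in>UNIV. (LINT a|lborel. \<theta>1 j a * J j a * \<phi> a))"
    unfolding A by (simp add: sum_subtractf D B C E sum_negf)
  also have "\<dots> = (LINT a|lborel. \<phi> a * defect \<theta>1 \<theta>2 a)"
  proof -
    have i1: "integrable lborel (\<lambda>a. \<phi> a * (\<theta>2 j i a * M i j a + \<theta>1 i a * partial j (M i j) a))" for i j
      using ints(8)[OF c\<phi>(1), of j i i j] ints(6)[OF c\<phi>(1), of i j i j] by (simp add: algebra_simps)
    have i2: "integrable lborel (\<lambda>a. \<phi> a * (\<theta>1 j a * J j a))" for j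
      using ints(7)[OF c\<phi>(1), of j j] by (simp add: algebra_simps)
    show ?thesis
      by (simp add: defect_def distrib_left[of "\<phi> _" "sum _ _"] sum_distrib_left[of "\<phi> _"]
          Bochner_Integration.integral_sum i1 i2 mult.commute[of "_ * J _ _"])
  qed
  finally show ?thesis .
qed

lemma homog_J: "homog0 (1 - real CARD('n)) (J j)"
proof -
  have "homog0 (1 - real CARD('n)) (\<lambda>a. \<Sum>i\<in>UNIV. partial i (M i j) a)"
    using homog0_partial[OF smooth_M homog_M] by (intro homog0_sum) simp
  then show ?thesis
    by (simp add: homog0_def div_M[symmetric])
qed

text \<open>The smoothed substitute for a boundary density on the unit sphere.\<close>

definition K :: "real^'n \<Rightarrow> real" where
  "K = defect cutoff1 cutoff2"

lemma K_small: "norm a < 1 \<Longrightarrow> K a = 0" and K_large: "norm a > 2 \<Longrightarrow> K a = 0"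
  by (simp_all add: K_def defect_def cutoff_small cutoff_large)

lemma continuous_K: "continuous_on UNIV K"
proof -
  note c = C2_continuous[OF C2_cutoff]
  have "continuous_on UNIV (\<lambda>a. cutoff2 j i a * M i j a)" "continuous_on UNIV (\<lambda>a. cutoff1 i a * partial j (M i j) a)"
    "continuous_on UNIV (\<lambda>a. cutoff1 j a * J j a)" for i j
    by (rule continuous_cut[where e = 1];
        auto intro: c cutoff_small smooth0_continuous smooth_M smooth_J smooth0_partial)+
  then show ?thesis
    unfolding K_def defect_def[abs_def] by (intro continuous_on_add continuous_on_sum)
qed

lemma integrable_K: "continuous_on UNIV g \<Longrightarrow> integrable lborel (\<lambda>a. g a * K a)"
  by (rule integrable_compact_support[where R = 2]) (auto intro!: continuous_intros continuous_K simp: K_large)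

text \<open>Each derivative of the cutoff brings a factor \<open>c\<close>, while the kernel has
  degree \<open>2 - m\<close> and its derivatives and flux have degree \<open>1 - m\<close>. Hence
  every term picks up \<open>c ^ m\<close>, the Jacobian of the dilation.\<close>

lemma defect_scale:
  assumes c: "c > 0"
  shows "defect (\<lambda>j a. c * cutoff1 j (c *\<^sub>R a)) (\<lambda>i j a. c * (c * cutoff2 i j (c *\<^sub>R a))) a =
    c ^ CARD('n) * K (c *\<^sub>R a)"
proof (cases "a = 0")
  case False
  let ?m = "real CARD('n)"
  have cm: "c ^ CARD('n) = c powr ?m"
    using c by (simp add: powr_realpow)
  have M: "c * c * M i j a = c powr ?m * M i j (c *\<^sub>R a)" for i j
    using homog_M[unfolded homog0_def, rule_format, OF c False, of i j] c
    by (simp add: powr_diff powr_realpow power2_eq_square)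
  have P: "c * partial l (M i j) a = c powr ?m * partial l (M i j) (c *\<^sub>R a)" for l i j
    using homog0_partial[OF smooth_M homog_M, unfolded homog0_def, rule_format, OF c False, of l i j] c
    by (simp add: powr_diff powr_realpow)
  have J: "c * J j a = c powr ?m * J j (c *\<^sub>R a)" for j
    using homog_J[unfolded homog0_def, rule_format, OF c False, of j] c
    by (simp add: powr_diff powr_realpow)
  have "defect (\<lambda>j a. c * cutoff1 j (c *\<^sub>R a)) (\<lambda>i j a. c * (c * cutoff2 i j (c *\<^sub>R a))) a =
    (\<Sum>i\<in>UNIV. \<Sum>j\<in>UNIV. cutoff2 j i (c *\<^sub>R a) * (c * c * M i j a) + cutoff1 i (c *\<^sub>R a) * (c * partial j (M i j) a))
     + (\<Sum>j\<in>UNIV. cutoff1 j (c *\<^sub>R a) * (c * J j a))"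
    unfolding defect_def by (simp add: mult_ac)
  also have "\<dots> = c ^ CARD('n) * K (c *\<^sub>R a)"
    unfolding M P J cm K_def defect_def by (simp add: algebra_simps sum_distrib_left)
  finally show ?thesis .
qed (simp add: K_def defect_def cutoff_small)

lemma integral_K_scale:
  assumes c: "c > 0" and g: "continuous_on UNIV g"
  shows "(LINT a|lborel. g a * (c ^ CARD('n) * K (c *\<^sub>R a))) = (LINT z|lborel. g (z /\<^sub>R c) * K z)"
proof -
  have "continuous_on UNIV (\<lambda>z. g (z /\<^sub>R c) * K z)"
    by (intro continuous_intros continuous_K continuous_on_compose2[OF g]) auto
  then have "(LINT z|lborel. g (z /\<^sub>R c) * K z) = c ^ CARD('n) * (LINT z|lborel. g z * K (c *\<^sub>R z))"
    using lborel_integral_scale[OF _ c, of "\<lambda>z. g (z /\<^sub>R c) * K z"] c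
    by (simp add: borel_measurable_continuous_onI)
  then show ?thesis
    by (simp add: mult_ac flip: integral_mult_right_zero)
qed

text \<open>Both scaled cutoffs equal 1 near the origin, so their difference vanishes there and
  \<open>green\<close> applies; a change of scale then puts both boundary terms on the same
  \<open>K\<close>.\<close>

lemma green_annulus:
  assumes \<phi>: "C2 \<phi> \<phi>1 \<phi>2" and e: "e > 0" and R: "R > 0"
  shows "(LINT a|lborel. (cutoff (a /\<^sub>R R) - cutoff (a /\<^sub>R e)) * (\<Sum>i\<in>UNIV. \<Sum>j\<in>UNIV. M i j a * \<phi>2 i j (y + a))) =
    (LINT z|lborel. \<phi> (y + R *\<^sub>R z) * K z) - (LINT z|lborel. \<phi> (y + e *\<^sub>R z) * K z)"
proof -
  have small: "cutoff (a /\<^sub>R r) = 1" "cutoff1 j (a /\<^sub>R r) = 0" "cutoff2 i j (a /\<^sub>R r) = 0"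
    if "norm a < r" for a :: "real^'n" and r i j
  proof -
    have "r > 0" using that norm_ge_zero[of a] by linarith
    then have "norm (a /\<^sub>R r) < 1" using that by (simp add: field_simps)
    then show "cutoff (a /\<^sub>R r) = 1" "cutoff1 j (a /\<^sub>R r) = 0" "cutoff2 i j (a /\<^sub>R r) = 0"
      by (rule cutoff_small)+
  qed
  have large: "cutoff (a /\<^sub>R r) = 0" "K (inverse r *\<^sub>R a) = 0" if "norm a > 2 * r" "r > 0" for a :: "real^'n" and r
  proof -
    have "norm (a /\<^sub>R r) > 2" using that by (simp add: field_simps)
    then show "cutoff (a /\<^sub>R r) = 0" "K (inverse r *\<^sub>R a) = 0"
      by (rule cutoff_large K_large)+
  qed
  let ?t1 = "\<lambda>c j a. c * cutoff1 j (c *\<^sub>R a)" and ?t2 = "\<lambda>c i j a. c * (c * cutoff2 i j (c *\<^sub>R a))"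
  have c\<phi>: "continuous_on UNIV (\<lambda>a. \<phi> (y + a))"
    by (rule C2_continuous(1)[OF C2_translate[OF \<phi>]])
  have "(LINT a|lborel. (cutoff (a /\<^sub>R R) - cutoff (a /\<^sub>R e)) * (\<Sum>i\<in>UNIV. \<Sum>j\<in>UNIV. M i j a * \<phi>2 i j (y + a))) =
    (LINT a|lborel. \<phi> (y + a) * defect (\<lambda>j a. ?t1 (inverse R) j a - ?t1 (inverse e) j a)
        (\<lambda>i j a. ?t2 (inverse R) i j a - ?t2 (inverse e) i j a) a)"
    by (rule green[OF C2_diff[OF C2_scale[OF C2_cutoff] C2_scale[OF C2_cutoff]] C2_translate[OF \<phi>],
          where e = "min R e" and R = "max (2 * R) (2 * e)"])
      (use R e in \<open>auto simp: small large\<close>)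
  also have "\<dots> = (LINT a|lborel. \<phi> (y + a) * (inverse R ^ CARD('n) * K (inverse R *\<^sub>R a))
      - \<phi> (y + a) * (inverse e ^ CARD('n) * K (inverse e *\<^sub>R a)))"
  proof (rule arg_cong[where f = "integral\<^sup>L lborel"], rule ext)
    fix a
    have "defect (\<lambda>j a. ?t1 (inverse R) j a - ?t1 (inverse e) j a)
        (\<lambda>i j a. ?t2 (inverse R) i j a - ?t2 (inverse e) i j a) a =
      defect (?t1 (inverse R)) (?t2 (inverse R)) a - defect (?t1 (inverse e)) (?t2 (inverse e)) a"
      unfolding defect_def by (simp add: sum_subtractf sum.distrib algebra_simps)
    then show "\<phi> (y + a) * defect (\<lambda>j a. ?t1 (inverse R) j a - ?t1 (inverse e) j a)
        (\<lambda>i j a. ?t2 (inverse R) i j a - ?t2 (inverse e) i j a) a =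
      \<phi> (y + a) * (inverse R ^ CARD('n) * K (inverse R *\<^sub>R a))
      - \<phi> (y + a) * (inverse e ^ CARD('n) * K (inverse e *\<^sub>R a))"
      using defect_scale[of "inverse R" a] defect_scale[of "inverse e" a] R e
      by (simp add: right_diff_distrib)
  qed
  also have "\<dots> = (LINT a|lborel. \<phi> (y + a) * (inverse R ^ CARD('n) * K (inverse R *\<^sub>R a)))
      - (LINT a|lborel. \<phi> (y + a) * (inverse e ^ CARD('n) * K (inverse e *\<^sub>R a)))"
  proof (rule Bochner_Integration.integral_diff)
    have i: "integrable lborel (\<lambda>a. \<phi> (y + a) * (inverse r ^ CARD('n) * K (inverse r *\<^sub>R a)))" if r: "r > 0" for r
      by (rule integrable_compact_support[where R = "2 * r"])
        (use r in \<open>auto intro!: continuous_intros c\<phi> continuous_on_compose2[OF continuous_K] simp: large\<close>)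
    show "integrable lborel (\<lambda>a. \<phi> (y + a) * (inverse R ^ CARD('n) * K (inverse R *\<^sub>R a)))"
      "integrable lborel (\<lambda>a. \<phi> (y + a) * (inverse e ^ CARD('n) * K (inverse e *\<^sub>R a)))"
      using i R e by auto
  qed
  finally show ?thesis
    using R e by (simp add: integral_K_scale[OF _ c\<phi>])
qed

lemma integral_K_limit:
  assumes \<phi>: "continuous_on UNIV \<phi>" and e: "e \<longlonglongrightarrow> 0" "\<And>n :: nat. 0 \<le> e n" "\<And>n. e n \<le> 1"
  shows "(\<lambda>n. LINT z|lborel. \<phi> (y + e n *\<^sub>R z) * K z) \<longlonglongrightarrow> (LINT z|lborel. \<phi> (y + 0 *\<^sub>R z) * K z)"
proof -
  have "bounded (\<phi> ` cball y 2)"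
    by (intro compact_imp_bounded compact_continuous_image continuous_on_subset[OF \<phi>]) auto
  then obtain B where B: "\<forall>x\<in>cball y 2. \<bar>\<phi> x\<bar> \<le> B"
    by (auto simp: bounded_iff)
  show ?thesis
  proof (rule integral_dominated_convergence)
  show "integrable lborel (\<lambda>z. B * \<bar>K z\<bar>)"
    using integrable_K[OF continuous_on_const[of _ 1]] by simp
  show "AE z in lborel. norm (\<phi> (y + e n *\<^sub>R z) * K z) \<le> B * \<bar>K z\<bar>" for n
  proof (rule AE_I2)
    fix z
    show "norm (\<phi> (y + e n *\<^sub>R z) * K z) \<le> B * \<bar>K z\<bar>"
    proof (cases "norm z \<le> 2")
      case True
      have "e n * norm z \<le> 1 * 2"
        using True e by (intro mult_mono) auto
      then have "y + e n *\<^sub>R z \<in> cball y 2"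
        using e by (simp add: dist_norm)
      then show ?thesis
        using B by (auto simp: abs_mult intro!: mult_right_mono)
    qed (simp add: K_large)
  qed
  show "AE z in lborel. (\<lambda>n. \<phi> (y + e n *\<^sub>R z) * K z) \<longlonglongrightarrow> \<phi> (y + 0 *\<^sub>R z) * K z"
  proof (rule AE_I2)
    fix z
    have "(\<lambda>n. \<phi> (y + e n *\<^sub>R z)) \<longlonglongrightarrow> \<phi> (y + 0 *\<^sub>R z)"
      by (rule continuous_on_tendsto_compose[OF \<phi> tendsto_add[OF tendsto_const tendsto_scaleR[OF e(1) tendsto_const]]])
        auto
    then show "(\<lambda>n. \<phi> (y + e n *\<^sub>R z) * K z) \<longlonglongrightarrow> \<phi> (y + 0 *\<^sub>R z) * K z"
      by (intro tendsto_intros)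
  qed
  have "continuous_on UNIV (\<lambda>z. \<phi> (y + c *\<^sub>R z) * K z)" for c
    by (intro continuous_intros continuous_K continuous_on_compose2[OF \<phi>]) auto
  then have m: "(\<lambda>z. \<phi> (y + c *\<^sub>R z) * K z) \<in> borel_measurable lborel" for c
    by (simp add: borel_measurable_continuous_onI)
  show "(\<lambda>z. \<phi> (y + 0 *\<^sub>R z) * K z) \<in> borel_measurable lborel"
    "\<And>n. (\<lambda>z. \<phi> (y + e n *\<^sub>R z) * K z) \<in> borel_measurable lborel"
    by (rule m)+
  qed
qed

text \<open>The limit of \<open>green_annulus\<close> as the inner scale tends to zero: the kernel
  is locally integrable, so the volume integral converges by domination, and the inner term
  concentrates at \<open>y\<close>.\<close>

lemma green_ball:
  assumes \<phi>: "C2 \<phi> \<phi>1 \<phi>2" and R: "R > 0" and m: "CARD('n) > 2"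
  shows "(LINT a|lborel. cutoff (a /\<^sub>R R) * (\<Sum>i\<in>UNIV. \<Sum>j\<in>UNIV. M i j a * \<phi>2 i j (y + a))) =
    (LINT z|lborel. \<phi> (y + R *\<^sub>R z) * K z) - \<phi> y * (LINT z|lborel. K z)"
proof -
  let ?m = "real CARD('n)"
  define S where "S a = (\<Sum>i\<in>UNIV. \<Sum>j\<in>UNIV. M i j a * \<phi>2 i j (y + a))" for a
  have c2: "continuous_on UNIV (\<lambda>a. \<phi>2 i j (y + a))" for i j
    by (rule C2_continuous(3)[OF C2_translate[OF \<phi>]])
  have cS: "continuous_on (- {0}) S"
    unfolding S_def by (intro continuous_intros smooth0_continuous smooth_M continuous_on_subset[OF c2]) auto
  have mS [measurable]: "S \<in> borel_measurable borel"
    by (rule borel_measurable_continuous_countable_exceptions[OF _ cS]) simp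
  have mcut: "(\<lambda>a :: real^'n. cutoff (a /\<^sub>R r)) \<in> borel_measurable borel" for r
    by (intro borel_measurable_continuous_onI continuous_on_compose2[OF C2_continuous(1)[OF C2_cutoff]] continuous_intros) auto
  \<comment> \<open>The radius \<open>2 * max R 1\<close> covers the supports of both cutoffs, the
    inner scale being at most 1.\<close>
  have "\<exists>C\<ge>0. \<forall>a. a \<noteq> 0 \<longrightarrow> norm a \<le> 2 * max R 1 \<longrightarrow> \<bar>M i j a * \<phi>2 i j (y + a)\<bar> \<le> C * norm a powr (2 - ?m)" for i j
  proof -
    obtain C where C: "C \<ge> 0" "\<And>a. a \<noteq> 0 \<Longrightarrow> \<bar>M i j a\<bar> \<le> C * norm a powr (2 - ?m)"
      using homog0_bound[OF smooth_M homog_M] by blast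
    have "bounded ((\<lambda>a. \<phi>2 i j (y + a)) ` cball 0 (2 * max R 1))"
      by (intro compact_imp_bounded compact_continuous_image continuous_on_subset[OF c2]) auto
    then obtain D where D: "\<forall>a\<in>cball 0 (2 * max R 1). \<bar>\<phi>2 i j (y + a)\<bar> \<le> D"
      by (auto simp: bounded_iff)
    have "D \<ge> 0"
      using D[rule_format, of 0] R by (auto intro: order_trans[OF abs_ge_zero])
    show ?thesis
    proof (intro exI[of _ "C * D"] conjI allI impI)
      show "C * D \<ge> 0" using C \<open>D \<ge> 0\<close> by simp
      fix a :: "real^'n" assume "a \<noteq> 0" "norm a \<le> 2 * max R 1"
      then have "\<bar>M i j a\<bar> * \<bar>\<phi>2 i j (y + a)\<bar> \<le> (C * norm a powr (2 - ?m)) * D"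
        using C D by (intro mult_mono) auto
      then show "\<bar>M i j a * \<phi>2 i j (y + a)\<bar> \<le> C * D * norm a powr (2 - ?m)"
        by (simp add: abs_mult mult_ac)
    qed
  qed
  then obtain C where C: "\<And>i j. C i j \<ge> 0"
    "\<And>i j a. a \<noteq> 0 \<Longrightarrow> norm a \<le> 2 * max R 1 \<Longrightarrow> \<bar>M i j a * \<phi>2 i j (y + a)\<bar> \<le> C i j * norm a powr (2 - ?m)"
    by metis
  define D where "D = (\<Sum>i\<in>UNIV. \<Sum>j\<in>UNIV. C i j)"
  have D: "\<bar>S a\<bar> \<le> D * norm a powr (2 - ?m)" if "a \<noteq> 0" "norm a \<le> 2 * max R 1" for a
    unfolding S_def D_def sum_distrib_right
    by (intro order_trans[OF sum_abs] sum_mono C that order_trans[OF sum_abs])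
  define e :: "nat \<Rightarrow> real" where "e n = 1 / real (Suc n)" for n
  have e: "e n > 0" "e n \<le> 1" for n by (auto simp: e_def)
  have e0: "e \<longlonglongrightarrow> 0"
    unfolding e_def using LIMSEQ_inverse_real_of_nat by (simp add: inverse_eq_divide)
  have "(\<lambda>n. LINT a|lborel. (cutoff (a /\<^sub>R R) - cutoff (a /\<^sub>R e n)) * S a) \<longlonglongrightarrow> (LINT a|lborel. cutoff (a /\<^sub>R R) * S a)"
  proof (rule integral_dominated_convergence)
    show "integrable lborel (\<lambda>a :: real^'n. D * (indicator (cball 0 (2 * max R 1)) a * norm a powr (2 - ?m)))"
      by (intro integrable_mult_right integrable_norm_powr m) auto
    show "AE a in lborel. norm ((cutoff (a /\<^sub>R R) - cutoff (a /\<^sub>R e n)) * S a)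
        \<le> D * (indicator (cball 0 (2 * max R 1)) a * norm a powr (2 - ?m))" for n
      using AE_lborel_singleton[of "0 :: real^'n"]
    proof eventually_elim
      case (elim a)
      show ?case
      proof (cases "norm a \<le> 2 * max R 1")
        case True
        have "\<bar>cutoff (a /\<^sub>R R) - cutoff (a /\<^sub>R e n)\<bar> \<le> 1"
          using cutoff_bounds[of "a /\<^sub>R R"] cutoff_bounds[of "a /\<^sub>R e n"] by linarith
        then have "\<bar>cutoff (a /\<^sub>R R) - cutoff (a /\<^sub>R e n)\<bar> * \<bar>S a\<bar> \<le> 1 * (D * norm a powr (2 - ?m))"
          using D[OF elim True] by (intro mult_mono) auto
        then show ?thesis using True by (simp add: abs_mult)
      next
        case False
        then have "norm (a /\<^sub>R R) > 2" "norm (a /\<^sub>R e n) > 2"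
          using R e[of n] by (auto simp: field_simps max_def split: if_splits)
        then show ?thesis using False by (simp add: cutoff_large)
      qed
    qed
    show "AE a in lborel. (\<lambda>n. (cutoff (a /\<^sub>R R) - cutoff (a /\<^sub>R e n)) * S a) \<longlonglongrightarrow> cutoff (a /\<^sub>R R) * S a"
      using AE_lborel_singleton[of "0 :: real^'n"]
    proof eventually_elim
      case (elim a)
      have "\<forall>\<^sub>F n in sequentially. e n < norm a / 2"
        using e0 elim by (intro order_tendstoD) auto
      then have "\<forall>\<^sub>F n in sequentially. (cutoff (a /\<^sub>R R) - cutoff (a /\<^sub>R e n)) * S a = cutoff (a /\<^sub>R R) * S a"
      proof eventually_elim
        case (elim n)
        then have "norm (a /\<^sub>R e n) > 2"
          using e[of n] by (simp add: field_simps)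
        then show ?case by (simp add: cutoff_large)
      qed
      then show ?case by (rule tendsto_eventually)
    qed
    show "(\<lambda>a. cutoff (a /\<^sub>R R) * S a) \<in> borel_measurable lborel"
      "\<And>n. (\<lambda>a. (cutoff (a /\<^sub>R R) - cutoff (a /\<^sub>R e n)) * S a) \<in> borel_measurable lborel"
      using mS mcut by auto
  qed
  then have 1: "(\<lambda>n. (LINT z|lborel. \<phi> (y + R *\<^sub>R z) * K z) - (LINT z|lborel. \<phi> (y + e n *\<^sub>R z) * K z))
      \<longlonglongrightarrow> (LINT a|lborel. cutoff (a /\<^sub>R R) * S a)"
    unfolding S_def green_annulus[OF \<phi> e(1) R] .
  have "(\<lambda>n. (LINT z|lborel. \<phi> (y + R *\<^sub>R z) * K z) - (LINT z|lborel. \<phi> (y + e n *\<^sub>R z) * K z))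
      \<longlonglongrightarrow> (LINT z|lborel. \<phi> (y + R *\<^sub>R z) * K z) - (LINT z|lborel. \<phi> (y + 0 *\<^sub>R z) * K z)"
    by (intro tendsto_diff tendsto_const integral_K_limit[OF C2_continuous(1)[OF \<phi>] e0] less_imp_le e)
  from LIMSEQ_unique[OF 1 this]
  have "(LINT a|lborel. cutoff (a /\<^sub>R R) * S a) =
     (LINT z|lborel. \<phi> (y + R *\<^sub>R z) * K z) - (LINT z|lborel. \<phi> (y + 0 *\<^sub>R z) * K z)" .
  then show ?thesis
    by (simp add: S_def)
qed

end

section \<open>The normalising constant\<close>

text \<open>In polar coordinates this is the vanishing of the integral of \<open>\<mu>'\<close>. It
  is obtained by integrating the divergence of \<open>\<mu> (a \<bullet> a) * f a\<close> times
  \<open>a\<close>, where \<open>div_radial\<close> in degree \<open>- m\<close> leaves only the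
  derivative of \<open>\<mu>\<close>.\<close>

lemma radial_integral_eq_0:
  fixes f :: "real^'n::finite \<Rightarrow> real"
  assumes \<mu>: "\<And>t. (\<mu> has_real_derivative \<mu>' t) (at t)" "continuous_on UNIV \<mu>'"
    and z: "\<And>t. t < 1 \<or> t > 2 \<Longrightarrow> \<mu> t = 0" "\<And>t. t < 1 \<or> t > 2 \<Longrightarrow> \<mu>' t = 0"
    and f: "smooth0 f" "homog0 (- real CARD('n)) f"
  shows "(LINT a|lborel. \<mu>' (a \<bullet> a) * ((a \<bullet> a) * f a)) = 0"
proof -
  have zn: "norm (a :: real^'n) < 1 \<Longrightarrow> \<mu> (a \<bullet> a) = 0" "norm a < 1 \<Longrightarrow> \<mu>' (a \<bullet> a) = 0"
    "norm a > 2 \<Longrightarrow> \<mu> (a \<bullet> a) = 0" "norm a > 2 \<Longrightarrow> \<mu>' (a \<bullet> a) = 0" for a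
    using inner_self_less_1[of a] inner_self_greater_2[of a] z by blast+
  have s: "smooth0 (\<lambda>a. a $ i * f a)" for i
    by (intro smooth0_mult smooth0_nth f)
  let ?F = "\<lambda>i a. 2 * a $ i * \<mu>' (a \<bullet> a) * (a $ i * f a) + \<mu> (a \<bullet> a) * partial i (\<lambda>a. a $ i * f a) a"
  have h: "has_partial i (\<lambda>a. \<mu> (a \<bullet> a) * (a $ i * f a)) (?F i)" for i
    by (rule has_partial_cut[OF has_partial_radial[OF \<mu>] _ _ s, where e = 1]) (auto simp: zn)
  have i0: "(LINT a|lborel. ?F i a) = 0" for i
    by (rule integral_partial_eq_0[OF h, where R = 2]) (simp add: zn)
  have int: "integrable lborel (?F i)" for i
    by (rule integrable_compact_support[where R = 2])
      (use h[of i] in \<open>auto simp: has_partial_def zn\<close>)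
  have "0 = (\<Sum>i\<in>UNIV. (LINT a|lborel. ?F i a))"
    by (simp only: i0) simp
  also have "\<dots> = (LINT a|lborel. (\<Sum>i\<in>UNIV. ?F i a))"
    by (rule Bochner_Integration.integral_sum[symmetric]) (rule int)
  also have "(\<lambda>a. \<Sum>i\<in>UNIV. ?F i a) = (\<lambda>a. 2 * (\<mu>' (a \<bullet> a) * ((a \<bullet> a) * f a)))"
  proof
    fix a :: "real^'n"
    show "(\<Sum>i\<in>UNIV. ?F i a) = 2 * (\<mu>' (a \<bullet> a) * ((a \<bullet> a) * f a))"
    proof (cases "a = 0")
      case True then show ?thesis using zn(1)[of a] by simp
    next
      case False
      have "(\<Sum>i\<in>UNIV. ?F i a) = (\<Sum>i\<in>UNIV. (2 * \<mu>' (a \<bullet> a) * f a) * (a $ i * a $ i))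
          + \<mu> (a \<bullet> a) * (\<Sum>i\<in>UNIV. partial i (\<lambda>a. a $ i * f a) a)"
        unfolding sum.distrib sum_distrib_left[of "\<mu> _"] by (simp add: mult_ac)
      also have "\<dots> = (2 * \<mu>' (a \<bullet> a) * f a) * (a \<bullet> a) + \<mu> (a \<bullet> a) * 0"
        unfolding div_radial[OF f False] by (simp only: sum_distrib_left[symmetric] sum_a_a) simp
      finally show ?thesis by simp
    qed
  qed
  finally show ?thesis by simp
qed

text \<open>Integration by parts moves the derivative onto \<open>\<mu>\<close> and leaves the
  radial component of the field, to which \<open>radial_integral_eq_0\<close> applies.\<close>

lemma radial_div_integral_eq_0:
  fixes G :: "'n::finite \<Rightarrow> real^'n \<Rightarrow> real"
  assumes \<mu>: "\<And>t. (\<mu> has_real_derivative \<mu>' t) (at t)" "continuous_on UNIV \<mu>'"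
    and z: "\<And>t. t < 1 \<or> t > 2 \<Longrightarrow> \<mu> t = 0" "\<And>t. t < 1 \<or> t > 2 \<Longrightarrow> \<mu>' t = 0"
    and G: "\<And>i. smooth0 (G i)" "\<And>i. homog0 (1 - real CARD('n)) (G i)"
  shows "(LINT a|lborel. \<mu> (a \<bullet> a) * (\<Sum>i\<in>UNIV. partial i (G i) a)) = 0"
proof -
  have zn: "norm (a :: real^'n) < 1 \<Longrightarrow> \<mu> (a \<bullet> a) = 0" "norm a < 1 \<Longrightarrow> \<mu>' (a \<bullet> a) = 0"
    "norm a > 2 \<Longrightarrow> \<mu> (a \<bullet> a) = 0" "norm a > 2 \<Longrightarrow> \<mu>' (a \<bullet> a) = 0" for a
    using inner_self_less_1[of a] inner_self_greater_2[of a] z by blast+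
  let ?F = "\<lambda>i a. 2 * a $ i * \<mu>' (a \<bullet> a) * G i a"
  let ?H = "\<lambda>i a. \<mu> (a \<bullet> a) * partial i (G i) a"
  let ?f = "\<lambda>a. (\<Sum>i\<in>UNIV. a $ i * G i a) / (a \<bullet> a)"
  have h: "has_partial i (\<lambda>a. \<mu> (a \<bullet> a) * G i a) (\<lambda>a. ?F i a + ?H i a)" for i
    by (rule has_partial_cut[OF has_partial_radial[OF \<mu>] _ _ G(1), where e = 1]) (auto simp: zn)
  have i0: "(LINT a|lborel. ?F i a + ?H i a) = 0" for i
    by (rule integral_partial_eq_0[OF h, where R = 2]) (simp add: zn)
  have c: "continuous_on UNIV (\<lambda>a :: real^'n. \<mu> (a \<bullet> a))" "continuous_on UNIV (\<lambda>a :: real^'n. 2 * a $ i * \<mu>' (a \<bullet> a))" for i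
    using has_partial_radial[OF \<mu>] by (auto simp: has_partial_def)
  have intF: "integrable lborel (?F i)" for i
    using integrable_cut3[OF c(2), where e = 1 and R = 2 and f = "G i" and g = "\<lambda>_. 1"] G by (simp add: zn)
  have intH: "integrable lborel (?H i)" for i
    using integrable_cut3[OF c(1), where e = 1 and R = 2 and f = "partial i (G i)" and g = "\<lambda>_. 1"] G by (simp add: zn smooth0_partial)
  have f: "smooth0 ?f"
    by (intro smooth0_divide smooth0_sum smooth0_mult smooth0_nth G)
  have "homog0 (1 + (1 - real CARD('n)) - 2) ?f"
    by (intro homog0_divide homog0_sum homog0_mult homog0_nth G)
  then have f': "homog0 (- real CARD('n)) ?f" by simp
  have "(\<Sum>i\<in>UNIV. (LINT a|lborel. ?F i a)) = (LINT a|lborel. (\<Sum>i\<in>UNIV. ?F i a))"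
    by (rule Bochner_Integration.integral_sum[symmetric]) (rule intF)
  also have "(\<lambda>a. \<Sum>i\<in>UNIV. ?F i a) = (\<lambda>a. 2 * (\<mu>' (a \<bullet> a) * ((a \<bullet> a) * ?f a)))"
  proof
    fix a :: "real^'n"
    show "(\<Sum>i\<in>UNIV. ?F i a) = 2 * (\<mu>' (a \<bullet> a) * ((a \<bullet> a) * ?f a))"
    proof (cases "a = 0")
      case False
      then have "(a \<bullet> a) * ?f a = (\<Sum>i\<in>UNIV. a $ i * G i a)" by simp
      then show ?thesis by (simp add: sum_distrib_left mult_ac)
    qed simp
  qed
  also have "(LINT a|lborel. 2 * (\<mu>' (a \<bullet> a) * ((a \<bullet> a) * ?f a))) = 0"
    using radial_integral_eq_0[OF \<mu> z f f'] by simp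
  finally have 1: "(\<Sum>i\<in>UNIV. (LINT a|lborel. ?F i a)) = 0" .
  have "(LINT a|lborel. ?F i a) + (LINT a|lborel. ?H i a) = 0" for i
    using i0[of i] intF intH by simp
  then have "(\<Sum>i\<in>UNIV. (LINT a|lborel. ?F i a)) + (\<Sum>i\<in>UNIV. (LINT a|lborel. ?H i a)) = 0"
    by (simp flip: sum.distrib)
  then have "(\<Sum>i\<in>UNIV. (LINT a|lborel. ?H i a)) = 0"
    using 1 by simp
  then show ?thesis
    by (simp add: sum_distrib_left Bochner_Integration.integral_sum intH)
qed

section \<open>Averages over a shell\<close>

text \<open>Half the weight that arises when \<open>cutoff1\<close> is contracted with a radial
  flux, see \<open>integral_K\<close>.\<close>

definition shell :: "real^'n::finite \<Rightarrow> real" where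
  "shell a = (a \<bullet> a) * step1 (a \<bullet> a)"

text \<open>For \<open>f\<close> of degree zero this is minus one half of the integral of
  \<open>f\<close> over the unit sphere, the radial integral being that of the derivative of a step
  from 1 to 0.\<close>

definition avg :: "(real^'n::finite \<Rightarrow> real) \<Rightarrow> real" where
  "avg f = (LINT a|lborel. shell a * (norm a powr (- real CARD('n)) * f a))"

lemma continuous_shell: "continuous_on UNIV shell"
  unfolding shell_def by (intro continuous_intros continuous_on_compose2[OF continuous_step1]) auto

lemma shell_small: "norm a < 1 \<Longrightarrow> shell a = 0" and shell_large: "norm a > 2 \<Longrightarrow> shell a = 0"
  using inner_self_less_1[of a] inner_self_greater_2[of a] by (auto simp: shell_def step1_eq_0)

lemma integrable_avg:
  "smooth0 f \<Longrightarrow> integrable lborel (\<lambda>a. shell a * (norm a powr (- real CARD('n)) * f a))" for f :: "real^'n::finite \<Rightarrow> real"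
  using integrable_cut3[OF continuous_shell, where e = 1 and R = 2 and f = "\<lambda>a. norm a powr (- real CARD('n)) * f a" and g = "\<lambda>_. 1"]
  by (simp add: shell_small shell_large smooth0_mult smooth0_powr)

lemma avg_add: "smooth0 f \<Longrightarrow> smooth0 g \<Longrightarrow> avg (\<lambda>a. f a + g a) = avg f + avg g"
  unfolding avg_def by (simp add: distrib_left integrable_avg)

lemma avg_cmult: "avg (\<lambda>a. c * f a) = c * avg f"
  unfolding avg_def by (simp add: mult.left_commute[of _ c])

lemma shell_div_integral_eq_0:
  fixes G :: "'n::finite \<Rightarrow> real^'n \<Rightarrow> real"
  assumes G: "\<And>i. smooth0 (G i)" "\<And>i. homog0 (1 - real CARD('n)) (G i)"
  shows "(LINT a|lborel. shell a * (\<Sum>i\<in>UNIV. partial i (G i) a)) = 0"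
  unfolding shell_def
proof (rule radial_div_integral_eq_0[where \<mu> = "\<lambda>t. t * step1 t" and \<mu>' = "\<lambda>t. step1 t + t * step2 t", OF _ _ _ _ G])
  show "((\<lambda>t. t * step1 t) has_real_derivative step1 t + t * step2 t) (at t)" for t
    by (auto intro!: derivative_eq_intros step2_DERIV)
  show "continuous_on UNIV (\<lambda>t. step1 t + t * step2 t)"
    by (intro continuous_intros continuous_step1 continuous_step2)
qed (auto simp: step1_eq_0 step2_eq_0)

lemma avg_eq_0:
  fixes G :: "'n::finite \<Rightarrow> real^'n \<Rightarrow> real"
  assumes G: "\<And>i. smooth0 (G i)" "\<And>i. homog0 (1 - real CARD('n)) (G i)"
    and f: "\<And>a. a \<noteq> 0 \<Longrightarrow> (\<Sum>i\<in>UNIV. partial i (G i) a) = norm a powr (- real CARD('n)) * f a"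
  shows "avg f = 0"
proof -
  have "(\<lambda>a. shell a * (\<Sum>i\<in>UNIV. partial i (G i) a)) = (\<lambda>a. shell a * (norm a powr (- real CARD('n)) * f a))"
  proof
    fix a :: "real^'n"
    show "shell a * (\<Sum>i\<in>UNIV. partial i (G i) a) = shell a * (norm a powr (- real CARD('n)) * f a)"
      by (cases "a = 0") (auto simp: f shell_small)
  qed
  with shell_div_integral_eq_0[of G, OF G] show ?thesis
    by (simp add: avg_def)
qed

text \<open>Differentiation under the integral. Since \<open>shell\<close> vanishes near the origin,
  joint continuity of the derivative is needed only for \<open>a \<noteq> 0\<close>.\<close>

lemma has_derivative_avg:
  fixes F F' :: "real \<Rightarrow> real^'n::finite \<Rightarrow> real"
  assumes d: "\<And>t a. a \<noteq> 0 \<Longrightarrow> ((\<lambda>t. F t a) has_real_derivative F' t a) (at t)"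
    and s: "\<And>t. smooth0 (F t)" "\<And>t. smooth0 (F' t)"
    and c: "continuous_on (UNIV \<times> - {0}) (\<lambda>(t, a). F' t a)"
  shows "((\<lambda>t. avg (F t)) has_real_derivative avg (F' t0)) (at t0)"
proof -
  let ?N = "\<lambda>a :: real^'n. norm a powr (- real CARD('n))"
  obtain u :: "real^'n" where u: "cball 0 2 \<subseteq> cbox (- u) u"
    using bounded_subset_cbox_symmetric[OF bounded_cball] by blast
  have I: "((\<lambda>a. shell a * (?N a * f a)) has_integral avg f) (cbox (- u) u)" if "smooth0 f" for f
  proof -
    have "((\<lambda>a. shell a * (?N a * f a)) has_integral avg f) UNIV"
      unfolding avg_def by (rule has_integral_integral_lborel[OF integrable_avg[OF that]])
    also have "(\<lambda>a. shell a * (?N a * f a)) = (\<lambda>a. if a \<in> cbox (- u) u then shell a * (?N a * f a) else 0)"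
      using u shell_large by (force simp: fun_eq_iff)
    finally show ?thesis
      by (simp only: has_integral_restrict_UNIV)
  qed
  have "((\<lambda>t. integral (cbox (- u) u) (\<lambda>a. shell a * (?N a * F t a))) has_field_derivative
      integral (cbox (- u) u) (\<lambda>a. shell a * (?N a * F' t0 a))) (at t0 within UNIV)"
  proof (rule leibniz_rule_field_derivative)
    show "((\<lambda>t. shell a * (?N a * F t a)) has_field_derivative shell a * (?N a * F' t a)) (at t within UNIV)" for t a
      using d[of a t] by (cases "a = 0") (auto simp: shell_small intro!: derivative_eq_intros)
    show "(\<lambda>a. shell a * (?N a * F t a)) integrable_on cbox (- u) u" for t
      using I[OF s(1)] by blast
    have "continuous_on (UNIV \<times> ball 0 1 \<union> UNIV \<times> - {0}) (\<lambda>(t, a). shell a * (?N a * F' t a))"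
    proof (rule continuous_on_open_Un)
      show "continuous_on (UNIV \<times> ball 0 1) (\<lambda>(t, a). shell a * (?N a * F' t a))"
        by (rule continuous_on_eq[OF continuous_on_const[of _ 0]]) (auto simp: shell_small)
      have "continuous_on (UNIV \<times> - {0}) (\<lambda>x :: real \<times> (real^'n). shell (snd x) * (?N (snd x) * (\<lambda>(t, a). F' t a) x))"
        by (intro continuous_on_mult c continuous_on_compose2[OF continuous_shell]
            continuous_on_compose2[OF smooth0_continuous[OF smooth0_powr]] continuous_on_snd continuous_on_id) auto
      then show "continuous_on (UNIV \<times> - {0}) (\<lambda>(t, a). shell a * (?N a * F' t a))"
        by (simp add: case_prod_unfold)
    qed (auto intro: open_Times)
    then show "continuous_on (UNIV \<times> cbox (- u) u) (\<lambda>(t, a). shell a * (?N a * F' t a))"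
      by (rule continuous_on_subset) auto
  qed auto
  moreover have "integral (cbox (- u) u) (\<lambda>a. shell a * (?N a * f a)) = avg f" if "smooth0 f" for f
    using I[OF that] by (rule integral_unique)
  ultimately show ?thesis
    by (simp add: s)
qed

section \<open>Averages of reflected polynomials\<close>

context
  fixes p :: "real^'n::finite \<Rightarrow> real" and d :: real
  assumes p: "euler_harm d p" and dm: "real CARD('n) + 2 * d - 4 > 0"
begin

private lemmas smooths = smooth0_powr smooth0_nth smooth0_inner smooth0_tilt[OF euler_harm_poly(1)[OF p]]
  smooth0_tilt[OF euler_harm_poly(2)[OF p]] smooth0_D1[OF euler_harm_poly(1)[OF p]] smooth0_D1[OF euler_harm_poly(2)[OF p]] smooth0_D2[OF euler_harm_poly(1)[OF p]]
  smooth0_divide smooth0_const smooth0_mult smooth0_add smooth0_diff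

text \<open>By \<open>div_D1_partial\<close> the integrand is a divergence up to the factor
  \<open>- (m + 2 * d - 4)\<close>, which \<open>dm\<close> keeps away from zero.\<close>

lemma avg_D2: "avg (\<lambda>a. D2 p (tilt 2 v a) a / (a \<bullet> a)) = 0"
proof -
  let ?m = "real CARD('n)"
  have "avg (\<lambda>a. (- ?m - 2 * d + 4) * (D2 p (tilt 2 v a) a / (a \<bullet> a))) = 0"
  proof (rule avg_eq_0)
    show "smooth0 (\<lambda>a. norm a powr (- ?m) * D1 (partial i p) (tilt 2 v a) a)" for i
      by (intro smooths)
    show "homog0 (1 - ?m) (\<lambda>a. norm a powr (- ?m) * D1 (partial i p) (tilt 2 v a) a)" for i
      using homog0_mult[OF homog0_powr[of "- ?m"] homog0_D1[of "partial i p" 2 v]] by simp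
    show "a \<noteq> 0 \<Longrightarrow> (\<Sum>i\<in>UNIV. partial i (\<lambda>a. norm a powr (- ?m) * D1 (partial i p) (tilt 2 v a) a) a) =
        norm a powr (- ?m) * ((- ?m - 2 * d + 4) * (D2 p (tilt 2 v a) a / (a \<bullet> a)))" for a
      by (simp add: div_D1_partial[OF p])
  qed
  then have "(- ?m - 2 * d + 4) * avg (\<lambda>a. D2 p (tilt 2 v a) a / (a \<bullet> a)) = 0"
    unfolding avg_cmult .
  then show ?thesis
    using dm by auto
qed

lemma avg_div_inner:
  "avg (\<lambda>a. d * p (tilt t v a) + (- real CARD('n) - (d - 2) * t) * (v \<bullet> a) / (a \<bullet> a) * D1 p (tilt t v a) a
      + t * (2 - t) * ((v \<bullet> a) / (a \<bullet> a))\<^sup>2 * D2 p (tilt t v a) a) = 0"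
proof (rule avg_eq_0)
  let ?m = "real CARD('n)"
  show "smooth0 (\<lambda>a. norm a powr (- ?m) * ((v \<bullet> a) * partial i p (tilt t v a)))" for i
    by (intro smooths)
  show "homog0 (1 - ?m) (\<lambda>a. norm a powr (- ?m) * ((v \<bullet> a) * partial i p (tilt t v a)))" for i
    using homog0_mult[OF homog0_powr[of "- ?m"] homog0_mult[OF homog0_inner homog0_tilt[of "partial i p" t v]], of v] by simp
qed (rule div_inner_tilt[OF p])

text \<open>The case \<open>t = 2\<close> of \<open>avg_div_inner\<close>, in which the factor
  \<open>2 - t\<close> removes the second-order term.\<close>

lemma avg_D1:
  "(real CARD('n) + 2 * d - 4) * avg (\<lambda>a. (v \<bullet> a) / (a \<bullet> a) * D1 p (tilt 2 v a) a) = d * avg (\<lambda>a. p (tilt 2 v a))"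
proof -
  have "avg (\<lambda>a. d * p (tilt 2 v a) + (- (real CARD('n) + 2 * d - 4)) * ((v \<bullet> a) / (a \<bullet> a) * D1 p (tilt 2 v a) a)) = 0"
    using avg_div_inner[of 2 v] by (simp add: algebra_simps)
  then have "d * avg (\<lambda>a. p (tilt 2 v a)) + (- (real CARD('n) + 2 * d - 4)) * avg (\<lambda>a. (v \<bullet> a) / (a \<bullet> a) * D1 p (tilt 2 v a) a) = 0"
    by (subst (asm) avg_add) (intro smooths, intro smooths, simp only: avg_cmult)
  then show ?thesis unfolding mult_minus_left by linarith
qed

text \<open>The function \<open>?F\<close> is built so that its derivative in \<open>t\<close> is
  the divergence of \<open>avg_div_inner\<close>; its average is therefore constant in
  \<open>t\<close>. The factor \<open>t * (2 - t)\<close> removes the \<open>D1\<close> term at both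
  ends, the reflection at \<open>t = 2\<close> and the identity at \<open>t = 0\<close>.\<close>

lemma avg_reflect:
  "(real CARD('n) + 2 * d - 2) * avg (\<lambda>a. p (tilt 2 v a)) = (real CARD('n) - 2) * avg (\<lambda>a :: real^'n. 1) * p v"
proof -
  let ?m = "real CARD('n)"
  let ?F = "\<lambda>t a. (?m - 2 + d * t) * p (tilt t v a) - t * (2 - t) * ((v \<bullet> a) / (a \<bullet> a) * D1 p (tilt t v a) a)"
  let ?F' = "\<lambda>t a. d * p (tilt t v a) + (- ?m - (d - 2) * t) * (v \<bullet> a) / (a \<bullet> a) * D1 p (tilt t v a) a
      + t * (2 - t) * ((v \<bullet> a) / (a \<bullet> a))\<^sup>2 * D2 p (tilt t v a) a"
  have dt: "((\<lambda>t. q (tilt t v a)) has_real_derivative - ((v \<bullet> a) / (a \<bullet> a)) * D1 q (tilt t v a) a) (at t)"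
    if q: "real_polynomial_function q" for q :: "real^'n \<Rightarrow> real" and t a
  proof -
    define c where "c = (v \<bullet> a) / (a \<bullet> a)"
    have "((\<lambda>t. v - (t * c) *\<^sub>R a) has_derivative (\<lambda>h. - (h * c) *\<^sub>R a)) (at t)"
      by (auto intro!: derivative_eq_intros)
    then have "((\<lambda>t. tilt t v a) has_derivative (\<lambda>h. - (h * (v \<bullet> a) / (a \<bullet> a)) *\<^sub>R a)) (at t)"
      by (simp add: tilt_def c_def)
    from GDERIV_chain[OF real_polynomial_function_grad(1)[OF q] this]
    show ?thesis
      by (rule has_derivative_imp_has_field_derivative) (simp add: D1_inner)
  qed
  have dD: "((\<lambda>t. D1 p (tilt t v a) a) has_real_derivative - ((v \<bullet> a) / (a \<bullet> a)) * D2 p (tilt t v a) a) (at t)" for t a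
  proof -
    have "((\<lambda>t. D1 p (tilt t v a) a) has_real_derivative
        (\<Sum>l\<in>UNIV. a $ l * (- ((v \<bullet> a) / (a \<bullet> a)) * D1 (partial l p) (tilt t v a) a))) (at t)"
      unfolding D1_def[of p] by (intro DERIV_sum DERIV_cmult dt euler_harm_poly(2)[OF p])
    also have "(\<Sum>l\<in>UNIV. a $ l * (- ((v \<bullet> a) / (a \<bullet> a)) * D1 (partial l p) (tilt t v a) a)) =
        - ((v \<bullet> a) / (a \<bullet> a)) * D2 p (tilt t v a) a"
      by (simp add: D2_def sum_distrib_left mult_ac)
    finally show ?thesis .
  qed
  have s: "smooth0 (?F t)" "smooth0 (?F' t)" for t
    unfolding power2_eq_square by (intro smooths)+
  have "((\<lambda>t. avg (?F t)) has_real_derivative avg (?F' t)) (at t)" for t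
  proof (rule has_derivative_avg[OF _ s])
    show "((\<lambda>t. ?F t a) has_real_derivative ?F' t a) (at t)" for t a
    proof -
      define c where "c = (v \<bullet> a) / (a \<bullet> a)"
      have 1: "((\<lambda>t. p (tilt t v a)) has_real_derivative - c * D1 p (tilt t v a) a) (at t)"
        unfolding c_def by (rule dt[OF euler_harm_poly(1)[OF p]])
      have 2: "((\<lambda>t. D1 p (tilt t v a) a) has_real_derivative - c * D2 p (tilt t v a) a) (at t)"
        unfolding c_def by (rule dD)
      have "((\<lambda>t. (?m - 2 + d * t) * p (tilt t v a) - t * (2 - t) * (c * D1 p (tilt t v a) a)) has_real_derivative
          d * p (tilt t v a) + (- ?m - (d - 2) * t) * c * D1 p (tilt t v a) a + t * (2 - t) * c\<^sup>2 * D2 p (tilt t v a) a) (at t)"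
        by (rule derivative_eq_intros 1 2 refl)+ (simp add: algebra_simps power2_eq_square)
      then show ?thesis
        by (simp add: c_def)
    qed
    have ct: "continuous_on (UNIV \<times> - {0}) (\<lambda>x :: real \<times> (real^'n). tilt (fst x) v (snd x))"
      unfolding tilt_def by (intro continuous_intros) auto
    have "continuous_on (UNIV \<times> - {0}) (\<lambda>x :: real \<times> (real^'n). ?F' (fst x) (snd x))"
      unfolding D2_def D1_def
      by (intro continuous_intros poly_continuous[OF euler_harm_poly(1)[OF p] ct] poly_continuous[OF euler_harm_poly(2)[OF p] ct]
          poly_continuous[OF real_polynomial_function_grad(2)[OF euler_harm_poly(2)[OF p]] ct]) auto
    then show "continuous_on (UNIV \<times> - {0}) (\<lambda>(t, a). ?F' t a)"
      by (simp add: case_prod_unfold)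
  qed
  then have "((\<lambda>t. avg (?F t)) has_real_derivative 0) (at t)" for t
    by (simp only: avg_div_inner)
  then have "avg (?F 2) = avg (?F 0)"
    by (intro DERIV_isconst_all) auto
  moreover have "avg (?F 2) = (?m + 2 * d - 2) * avg (\<lambda>a. p (tilt 2 v a))"
    unfolding avg_cmult[symmetric] by (simp add: algebra_simps)
  moreover have "avg (?F 0) = ((?m - 2) * p v) * avg (\<lambda>a :: real^'n. 1)"
    unfolding avg_cmult[symmetric] by (simp add: tilt_def)
  ultimately have "(?m + 2 * d - 2) * avg (\<lambda>a. p (tilt 2 v a)) = ((?m - 2) * p v) * avg (\<lambda>a :: real^'n. 1)"
    by (simp only:)
  then show ?thesis
    by (simp add: mult_ac)
qed

end

section \<open>The total flux\<close>

lemma AE_lborel_continuous_eq_0: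
  fixes f :: "'a::euclidean_space \<Rightarrow> real"
  assumes "continuous_on S f" "open S" "AE x in lborel. x \<in> S \<longrightarrow> f x = 0" "x \<in> S"
  shows "f x = 0"
proof (rule ccontr)
  assume "f x \<noteq> 0"
  let ?U = "S \<inter> f -` (- {0})"
  have U: "open ?U"
    by (rule continuous_open_preimage[OF assms(1,2)]) auto
  moreover have "?U \<noteq> {}" using \<open>f x \<noteq> 0\<close> assms(4) by auto
  ultimately have "\<not> negligible ?U" by (rule open_not_negligible)
  moreover have "?U \<in> null_sets lborel"
  proof (subst AE_iff_null_sets)
    show "AE x in lborel. x \<notin> ?U"
      using assms(3) by eventually_elim auto
  qed (use U in simp)
  ultimately show False
    by (simp add: negligible_iff_null_sets null_sets_completionI)
qed

lemma avg_1_neq_0: "avg (\<lambda>a :: real^'n::finite. 1) \<noteq> 0"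
proof
  let ?m = "real CARD('n)"
  let ?f = "\<lambda>a :: real^'n. - (shell a * (norm a powr (- ?m) * 1))"
  assume "avg (\<lambda>a :: real^'n. 1) = 0"
  then have "(LINT a|lborel. ?f a) = 0"
    by (simp add: avg_def)
  moreover have nn: "0 \<le> ?f a" for a
    using step1_nonpos[of "a \<bullet> a"] by (simp add: shell_def mult_nonneg_nonpos mult_nonpos_nonneg)
  moreover have "integrable lborel ?f"
    by (intro integrable_minus integrable_avg smooth0_const)
  ultimately have "AE a in lborel. ?f a = 0"
    by (subst (asm) integral_nonneg_eq_0_iff_AE) auto
  then have ae: "AE a in lborel. a \<in> - {0} \<longrightarrow> ?f a = 0"
    by auto
  \<comment> \<open>Any squared length strictly between 1 and 2 would do, since \<open>step1\<close>
    is negative there.\<close>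
  define a :: "real^'n" where "a = sqrt (3 / 2) *\<^sub>R axis undefined 1"
  have a: "a \<bullet> a = 3 / 2" by (simp add: a_def inner_axis_axis)
  then have a0: "a \<noteq> 0" by auto
  have "continuous_on (- {0}) ?f"
    by (intro continuous_on_minus continuous_on_mult continuous_on_subset[OF continuous_shell]
        smooth0_continuous smooth0_powr smooth0_const) auto
  from AE_lborel_continuous_eq_0[OF this _ ae, of a] a0 have "?f a = 0"
    by auto
  then show False
    using a0 a step1_neg[of "3 / 2"] by (simp add: shell_def)
qed

text \<open>The factor \<open>m - 4\<close> has its origin in the identity \<open>(2 - m) * (m + 2 *
  d - 4) + 4 * d = - (m - 4) * (m + 2 * d - 2)\<close>, whose last factor is absorbed by
  \<open>avg_reflect\<close>. In dimension 4 the flux would carry no mass.\<close>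

lemma avg_flux_density:
  fixes p :: "real^'n::finite \<Rightarrow> real"
  assumes p: "euler_harm d p" and dm: "real CARD('n) + 2 * d - 4 > 0"
    and g: "g * (real CARD('n) + 2 * d - 4) = 1"
  shows "avg (flux_density g p v) =
    - ((real CARD('n) - 2) * (real CARD('n) - 4) * g * avg (\<lambda>a :: real^'n. 1)) * p v"
proof -
  let ?m = "real CARD('n)"
  have pp: "real_polynomial_function p" using p by (simp add: euler_harm_def)
  let ?f1 = "\<lambda>a. (2 - ?m) * p (tilt 2 v a)"
  let ?f2 = "\<lambda>a. 4 * ((v \<bullet> a) / (a \<bullet> a) * D1 p (tilt 2 v a) a)"
  let ?f3 = "\<lambda>a. (4 * g * (v \<bullet> v)) * (D2 p (tilt 2 v a) a / (a \<bullet> a))"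
  have s: "smooth0 ?f1" "smooth0 ?f2" "smooth0 ?f3"
    by (intro smooth0_mult smooth0_const smooth0_divide smooth0_inner smooth0_tilt smooth0_D1 smooth0_D2 pp)+
  have "flux_density g p v = (\<lambda>a. ?f1 a + ?f2 a + ?f3 a)"
    by (simp add: flux_density_def fun_eq_iff)
  then have "avg (flux_density g p v) = avg ?f1 + avg ?f2 + avg ?f3"
    by (simp only: avg_add s smooth0_add)
  also have "\<dots> = (2 - ?m) * avg (\<lambda>a. p (tilt 2 v a)) + 4 * avg (\<lambda>a. (v \<bullet> a) / (a \<bullet> a) * D1 p (tilt 2 v a) a)"
    by (simp add: avg_cmult avg_D2[OF p dm] del: times_divide_eq_right times_divide_eq_left)
  also have "avg (\<lambda>a. (v \<bullet> a) / (a \<bullet> a) * D1 p (tilt 2 v a) a) = g * d * avg (\<lambda>a. p (tilt 2 v a))"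
  proof -
    have "avg (\<lambda>a. (v \<bullet> a) / (a \<bullet> a) * D1 p (tilt 2 v a) a) =
        g * ((?m + 2 * d - 4) * avg (\<lambda>a. (v \<bullet> a) / (a \<bullet> a) * D1 p (tilt 2 v a) a))"
      using g by (simp flip: mult.assoc)
    then show ?thesis
      unfolding avg_D1[OF p dm] by (simp only: mult.assoc)
  qed
  also have "(2 - ?m) * avg (\<lambda>a. p (tilt 2 v a)) + 4 * (g * d * avg (\<lambda>a. p (tilt 2 v a))) =
     ((2 - ?m) * (g * (?m + 2 * d - 4)) + 4 * g * d) * avg (\<lambda>a. p (tilt 2 v a))"
    unfolding g by (simp add: algebra_simps)
  also have "(2 - ?m) * (g * (?m + 2 * d - 4)) + 4 * g * d = - ((?m - 4) * g) * (?m + 2 * d - 2)"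
    by (simp add: algebra_simps)
  also have "\<dots> * avg (\<lambda>a. p (tilt 2 v a)) = - ((?m - 4) * g) * ((?m + 2 * d - 2) * avg (\<lambda>a. p (tilt 2 v a)))"
    by (simp only: mult.assoc)
  also have "\<dots> = - ((?m - 4) * g) * ((?m - 2) * avg (\<lambda>a :: real^'n. 1) * p v)"
    unfolding avg_reflect[OF p dm] ..
  finally show ?thesis
    by (simp add: mult_ac)
qed

text \<open>The part of \<open>K\<close> with the kernel itself is a sum of derivatives of compactly
  supported functions and integrates to zero; the flux meets the radial vector
  \<open>cutoff1\<close>, so only its radial component counts.\<close>

lemma (in flux_kernel) integral_K:
  assumes fl: "\<And>a. a \<noteq> 0 \<Longrightarrow> (\<Sum>j\<in>UNIV. a $ j * J j a) = (a \<bullet> a) * norm a powr (- real CARD('n)) * F a"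
  shows "(LINT z|lborel. K z) = 2 * avg F"
proof -
  note c = C2_continuous[OF C2_cutoff]
  let ?A = "\<lambda>i j a. cutoff2 j i a * M i j a + cutoff1 i a * partial j (M i j) a"
  let ?B = "\<lambda>j a. cutoff1 j a * J j a"
  have h: "has_partial j (\<lambda>a. cutoff1 i a * M i j a) (?A i j)" for i j
    by (rule has_partial_cut[OF has_partial_cutoff1 _ _ smooth_M, where e = 1]) (auto simp: cutoff_small)
  have A0: "(LINT a|lborel. ?A i j a) = 0" for i j
    by (rule integral_partial_eq_0[OF h, where R = 2]) (simp add: cutoff_large)
  have iA: "integrable lborel (?A i j)" for i j
    by (rule integrable_compact_support[where R = 2])
      (use h[of j i] in \<open>auto simp: has_partial_def cutoff_large\<close>)
  have iB: "integrable lborel (?B j)" for j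
    using integrable_cut3[OF c(2), where e = 1 and R = 2 and f = "J j" and g = "\<lambda>_. 1"] by (simp add: cutoff_small cutoff_large smooth_J)
  have iAA: "integrable lborel (\<lambda>a. \<Sum>i\<in>UNIV. \<Sum>j\<in>UNIV. ?A i j a)"
    by (intro Bochner_Integration.integrable_sum iA)
  have iBB: "integrable lborel (\<lambda>a. \<Sum>j\<in>UNIV. ?B j a)"
    by (intro Bochner_Integration.integrable_sum iB)
  have "(LINT z|lborel. K z) = (LINT z|lborel. (\<Sum>i\<in>UNIV. \<Sum>j\<in>UNIV. ?A i j z)) + (LINT z|lborel. (\<Sum>j\<in>UNIV. ?B j z))"
    unfolding K_def defect_def[abs_def] by (rule Bochner_Integration.integral_add[OF iAA iBB])
  also have "(LINT z|lborel. (\<Sum>i\<in>UNIV. \<Sum>j\<in>UNIV. ?A i j z)) = 0"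
    by (subst Bochner_Integration.integral_sum, intro Bochner_Integration.integrable_sum iA,
        subst Bochner_Integration.integral_sum, intro iA) (simp only: A0 sum.neutral_const)
  also have "(\<lambda>z. \<Sum>j\<in>UNIV. ?B j z) = (\<lambda>z. 2 * (shell z * (norm z powr (- real CARD('n)) * F z)))"
  proof
    fix a :: "real^'n"
    show "(\<Sum>j\<in>UNIV. ?B j a) = 2 * (shell a * (norm a powr (- real CARD('n)) * F a))"
    proof (cases "a = 0")
      case False
      have "(\<Sum>j\<in>UNIV. ?B j a) = 2 * step1 (a \<bullet> a) * (\<Sum>j\<in>UNIV. a $ j * J j a)"
        by (simp add: cutoff1_def sum_distrib_left mult_ac)
      then show ?thesis
        unfolding fl[OF False] by (simp add: shell_def mult_ac)
    qed (simp add: cutoff_small shell_small)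
  qed
  finally show ?thesis
    by (simp add: avg_def)
qed

section \<open>Harmonic polynomials form a finite-dimensional space\<close>

text \<open>Generated by adding one multiple at a time, so that membership statements are proved by
  induction.\<close>

inductive_set lspan :: "('a \<Rightarrow> real) set \<Rightarrow> ('a \<Rightarrow> real) set" for B where
  lspan_0: "(\<lambda>x. 0) \<in> lspan B"
| lspan_step: "f \<in> lspan B \<Longrightarrow> b \<in> B \<Longrightarrow> (\<lambda>x. f x + c * b x) \<in> lspan B"

lemma lspan_base: "b \<in> B \<Longrightarrow> b \<in> lspan B"
  using lspan_step[OF lspan_0, of b B 1] by simp

lemma lspan_add:
  assumes f: "f \<in> lspan B" and g: "g \<in> lspan B"
  shows "(\<lambda>x. f x + g x) \<in> lspan B"
  using g
proof (induction g rule: lspan.induct)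
  case (lspan_step g b c)
  then have "(\<lambda>x. (f x + g x) + c * b x) \<in> lspan B"
    by (intro lspan.lspan_step)
  then show ?case by (simp add: add.assoc)
qed (simp add: f)

lemma lspan_cmult: "f \<in> lspan B \<Longrightarrow> (\<lambda>x. c * f x) \<in> lspan B"
proof (induction f rule: lspan.induct)
  case (lspan_step f b d)
  then have "(\<lambda>x. c * f x + (c * d) * b x) \<in> lspan B"
    by (intro lspan.lspan_step)
  then show ?case by (simp add: algebra_simps)
qed (simp add: lspan.lspan_0)

lemma lspan_sum: "(\<And>i. i \<in> I \<Longrightarrow> f i \<in> lspan B) \<Longrightarrow> (\<lambda>x. \<Sum>i\<in>I. f i x) \<in> lspan B"
  by (induction I rule: infinite_finite_induct) (auto intro: lspan_0 lspan_add)

lemma lspan_mono: "f \<in> lspan B \<Longrightarrow> B \<subseteq> C \<Longrightarrow> f \<in> lspan C"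
  by (induction f rule: lspan.induct) (auto intro: lspan.intros)

lemma lspan_insertE:
  assumes "f \<in> lspan (insert b B)"
  obtains g c where "g \<in> lspan B" "f = (\<lambda>x. g x + c * b x)"
proof -
  have "\<exists>g c. g \<in> lspan B \<and> f = (\<lambda>x. g x + c * b x)"
    using assms
  proof (induction f rule: lspan.induct)
    case lspan_0
    then show ?case
      by (intro exI[of _ "\<lambda>x. 0"] exI[of _ 0]) (simp add: lspan.lspan_0)
  next
    case (lspan_step f b' c')
    then obtain g c where g: "g \<in> lspan B" "f = (\<lambda>x. g x + c * b x)" by blast
    show ?case
    proof (cases "b' = b")
      case True
      then show ?thesis
        using g by (intro exI[of _ g] exI[of _ "c + c'"]) (auto simp: algebra_simps)
    next
      case False
      then have "(\<lambda>x. g x + c' * b' x) \<in> lspan B"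
        using g lspan_step by (intro lspan.lspan_step) auto
      then show ?thesis
        using g by (intro exI[of _ "\<lambda>x. g x + c' * b' x"] exI[of _ c]) (auto simp: algebra_simps)
    qed
  qed
  then show ?thesis using that by blast
qed

section \<open>Subspaces and finite spanning sets\<close>

definition lsubspace :: "('a \<Rightarrow> real) set \<Rightarrow> bool" where
  "lsubspace V \<longleftrightarrow> (\<lambda>x. 0) \<in> V \<and> (\<forall>f\<in>V. \<forall>g\<in>V. \<forall>c. (\<lambda>x. f x + c * g x) \<in> V)"

lemma lsubspaceD: "lsubspace V \<Longrightarrow> f \<in> V \<Longrightarrow> g \<in> V \<Longrightarrow> (\<lambda>x. f x + c * g x) \<in> V"
  and lsubspace_0: "lsubspace V \<Longrightarrow> (\<lambda>x. 0) \<in> V"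
  by (auto simp: lsubspace_def)

lemma lsubspace_cmult: "lsubspace V \<Longrightarrow> g \<in> V \<Longrightarrow> (\<lambda>x. c * g x) \<in> V"
  using lsubspaceD[OF _ lsubspace_0, of V g c] by simp

lemma lsubspace_sum:
  assumes "lsubspace V" "\<And>i. i \<in> I \<Longrightarrow> f i \<in> V"
  shows "(\<lambda>x. \<Sum>i\<in>I. c i * f i x) \<in> V"
  using assms(2)
proof (induction I rule: infinite_finite_induct)
  case (insert i I)
  then have "(\<lambda>x. (\<Sum>i\<in>I. c i * f i x) + c i * f i x) \<in> V"
    by (intro lsubspaceD[OF assms(1)]) auto
  then show ?case using insert by (simp add: add.commute)
qed (simp_all add: lsubspace_0[OF assms(1)])

lemma lspan_subset: "lsubspace V \<Longrightarrow> B \<subseteq> V \<Longrightarrow> f \<in> lspan B \<Longrightarrow> f \<in> V"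
  by (rotate_tac 2, induction f rule: lspan.induct) (auto intro: lsubspaceD lsubspace_0)

text \<open>A spanning set lying outside \<open>V\<close> is traded for one inside, as
  \<open>harm_poly_lspan\<close> provides only the former. One generator is eliminated at a time: an
  element \<open>p0\<close> of \<open>V\<close> outside \<open>lspan B\<close> has a nonzero
  coefficient at \<open>b\<close>, so a multiple of it clears that coefficient from every other
  element.\<close>

lemma lsubspace_finite_span:
  assumes "finite B" "lsubspace V" "V \<subseteq> lspan B"
  shows "\<exists>F. finite F \<and> F \<subseteq> V \<and> V \<subseteq> lspan F"
  using assms
proof (induction B arbitrary: V rule: finite_induct)
  case empty
  then show ?case by (intro exI[of _ "{}"]) auto
next
  case (insert b B)
  show ?case
  proof (cases "V \<subseteq> lspan B")
    case True
    then show ?thesis using insert by blast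
  next
    case False
    then obtain p0 where p0: "p0 \<in> V" "p0 \<notin> lspan B" by auto
    obtain g0 c0 where g0: "g0 \<in> lspan B" "p0 = (\<lambda>x. g0 x + c0 * b x)"
      using lspan_insertE[of p0 b B] p0 insert.prems by blast
    have c0: "c0 \<noteq> 0" using p0 g0 by auto
    have "lsubspace (V \<inter> lspan B)"
      using insert.prems(1) lspan_add lspan_cmult lspan_0 unfolding lsubspace_def by blast
    from insert.IH[OF this] obtain F where F: "finite F" "F \<subseteq> V" "V \<inter> lspan B \<subseteq> lspan F"
      by auto
    have "p \<in> lspan (insert p0 F)" if p: "p \<in> V" for p
    proof -
      obtain g c where g: "g \<in> lspan B" "p = (\<lambda>x. g x + c * b x)"
        using lspan_insertE[of p b B] p insert.prems by blast
      have "(\<lambda>x. p x + (- c / c0) * p0 x) \<in> V"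
        by (rule lsubspaceD[OF insert.prems(1) p p0(1)])
      moreover have "(\<lambda>x. p x + (- c / c0) * p0 x) = (\<lambda>x. g x + (- c / c0) * g0 x)"
        using c0 unfolding g(2) g0(2) by (auto simp: field_simps)
      moreover have "(\<lambda>x. g x + (- c / c0) * g0 x) \<in> lspan B"
        by (intro lspan_add lspan_cmult g g0)
      ultimately have "(\<lambda>x. p x + (- c / c0) * p0 x) \<in> lspan F"
        using F by auto
      then have "(\<lambda>x. (p x + (- c / c0) * p0 x) + (c / c0) * p0 x) \<in> lspan (insert p0 F)"
        by (rule lspan_step[OF lspan_mono[OF _ subset_insertI] insertI1])
      also have "(\<lambda>x. (p x + (- c / c0) * p0 x) + (c / c0) * p0 x) = p"
        by auto
      finally show ?thesis .
    qed
    then show ?thesis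
      using F p0 by (intro exI[of _ "insert p0 F"]) auto
  qed
qed

text \<open>For \<open>\<Phi>\<close> the point evaluations this is
  interpolation; for inner products it yields the reproducing kernel.\<close>

lemma dual_expansion:
  fixes V :: "('a \<Rightarrow> real) set" and \<Phi> :: "(('a \<Rightarrow> real) \<Rightarrow> real) set"
  assumes V: "lsubspace V" and F: "finite F" "F \<subseteq> V"
    and lin: "\<And>\<phi> f g c. \<phi> \<in> \<Phi> \<Longrightarrow> f \<in> V \<Longrightarrow> g \<in> V \<Longrightarrow> \<phi> (\<lambda>x. f x + c * g x) = \<phi> f + c * \<phi> g"
    and sep: "\<And>f. f \<in> V \<Longrightarrow> (\<And>\<phi>. \<phi> \<in> \<Phi> \<Longrightarrow> \<phi> f = 0) \<Longrightarrow> f = (\<lambda>x. 0)"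
  shows "\<exists>(N :: nat) \<phi> l. (\<forall>i<N. \<phi> i \<in> \<Phi> \<and> l i \<in> V) \<and> (\<forall>p\<in>lspan F. \<forall>x. p x = (\<Sum>i<N. \<phi> i p * l i x))"
  using F
proof (induction F rule: finite_induct)
  case empty
  have "p \<in> lspan {} \<Longrightarrow> p = (\<lambda>x. 0)" for p :: "'a \<Rightarrow> real"
    by (induction p rule: lspan.induct) auto
  then show ?case by (intro exI[of _ 0]) auto
next
  case (insert b F)
  have b: "b \<in> V" and FV: "F \<subseteq> V" using insert by auto
  from insert.IH[OF FV] obtain N :: nat and \<phi> l where
    N': "\<forall>i<N. \<phi> i \<in> \<Phi> \<and> l i \<in> V" "\<forall>p\<in>lspan F. \<forall>x. p x = (\<Sum>i<N. \<phi> i p * l i x)"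
    by (elim exE conjE)
  have N: "\<And>i. i < N \<Longrightarrow> \<phi> i \<in> \<Phi>" "\<And>i. i < N \<Longrightarrow> l i \<in> V"
    "\<And>p x. p \<in> lspan F \<Longrightarrow> p x = (\<Sum>i<N. \<phi> i p * l i x)"
    using N' by (auto simp only:)
  have lin0: "\<phi> (\<lambda>x. 0) = 0" if "\<phi> \<in> \<Phi>" for \<phi>
    using lin[OF that b b, of "-1"] lin[OF that lsubspace_0[OF V] lsubspace_0[OF V], of 1] by simp
  have linsum: "\<phi> (\<lambda>x. \<Sum>i<n. c i * f i x) = (\<Sum>i<n. c i * \<phi> (f i))"
    if "\<phi> \<in> \<Phi>" "\<And>i. i < n \<Longrightarrow> f i \<in> V" for \<phi> c f and n :: nat
    using that(2)
  proof (induction n)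
    case (Suc n)
    then show ?case
      using lin[OF that(1) lsubspace_sum[OF V, of "{..<n}" f c], of "f n" "c n"] by simp
  qed (simp add: lin0[OF that(1)])
  \<comment> \<open>The residual of \<open>b\<close> after interpolation by the functionals chosen
    so far. If it is nonzero, some functional detects it and is added.\<close>
  define r where "r = (\<lambda>x. b x + (-1) * (\<Sum>i<N. \<phi> i b * l i x))"
  have rV: "r \<in> V"
    unfolding r_def using N by (intro lsubspaceD[OF V b] lsubspace_sum[OF V]) auto
  show ?case
  proof (cases "r = (\<lambda>x. 0)")
    case True
    then have bb: "b x = (\<Sum>i<N. \<phi> i b * l i x)" for x
      by (simp add: r_def fun_eq_iff)
    have "p x = (\<Sum>i<N. \<phi> i p * l i x)" if p: "p \<in> lspan (insert b F)" for p x
    proof -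
      obtain g c where g: "g \<in> lspan F" "p = (\<lambda>x. g x + c * b x)"
        using lspan_insertE[OF p] by blast
      have gV: "g \<in> V" by (rule lspan_subset[OF V FV g(1)])
      have "p x = (\<Sum>i<N. \<phi> i g * l i x) + c * (\<Sum>i<N. \<phi> i b * l i x)"
        unfolding g(2) using N(3)[OF g(1), of x] bb[of x] by presburger
      also have "\<dots> = (\<Sum>i<N. \<phi> i p * l i x)"
        unfolding g(2) using N by (simp add: lin[OF _ gV b] sum_distrib_left sum.distrib algebra_simps)
      finally show ?thesis .
    qed
    then show ?thesis
      using N by (intro exI[of _ N] exI[of _ \<phi>] exI[of _ l]) auto
  next
    case False
    then obtain \<psi> where \<psi>: "\<psi> \<in> \<Phi>" "\<psi> r \<noteq> 0"
      using sep[OF rV] by blast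
    define e where "e = (\<lambda>x. (1 / \<psi> r) * r x)"
    have eV: "e \<in> V"
      unfolding e_def by (rule lsubspace_cmult[OF V rV])
    define \<phi>' where "\<phi>' i = (if i < N then \<phi> i else \<psi>)" for i
    \<comment> \<open>The earlier functions are corrected so that the new functional vanishes on
      them; on \<open>e\<close> it takes the value 1.\<close>
    define l' where "l' i = (if i < N then (\<lambda>x. l i x + (- \<psi> (l i)) * e x) else e)" for i
    have expand: "(\<Sum>i<Suc N. \<phi>' i p * l' i x) =
        (\<Sum>i<N. \<phi> i p * l i x) + (\<psi> p - (\<Sum>i<N. \<phi> i p * \<psi> (l i))) * e x" for p x
      by (simp add: \<phi>'_def l'_def algebra_simps sum.distrib sum_distrib_left sum_subtractf)
    have psi_b: "\<psi> r = \<psi> b - (\<Sum>i<N. \<phi> i b * \<psi> (l i))"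
    proof -
      have "(\<lambda>x. \<Sum>i<N. \<phi> i b * l i x) \<in> V" using N by (intro lsubspace_sum[OF V]) auto
      from lin[OF \<psi>(1) b this, of "-1"] show ?thesis
        unfolding r_def using linsum[OF \<psi>(1) N(2), where n = N and c = "\<lambda>i. \<phi> i b"] by simp
    qed
    have bx: "b x = (\<Sum>i<Suc N. \<phi>' i b * l' i x)" for x
      unfolding expand psi_b[symmetric] using \<psi>(2) by (simp add: e_def r_def)
    have gx: "g x = (\<Sum>i<Suc N. \<phi>' i g * l' i x)" if g: "g \<in> lspan F" for g x
    proof -
      have "g = (\<lambda>x. \<Sum>i<N. \<phi> i g * l i x)" using N(3)[OF g] by auto
      then have "\<psi> g = \<psi> (\<lambda>x. \<Sum>i<N. \<phi> i g * l i x)"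
        by (rule arg_cong)
      then have "\<psi> g = (\<Sum>i<N. \<phi> i g * \<psi> (l i))"
        using linsum[OF \<psi>(1) N(2), where n = N and c = "\<lambda>i. \<phi> i g"] by simp
      then show ?thesis
        unfolding expand using N(3)[OF g, of x] by simp
    qed
    have mem: "\<phi>' i \<in> \<Phi>" "l' i \<in> V" for i
      using N(1,2)[of i] \<psi>(1) eV lsubspaceD[OF V _ eV, of "l i" "- \<psi> (l i)"]
      unfolding \<phi>'_def l'_def by (cases "i < N"; simp)+
    have "p x = (\<Sum>i<Suc N. \<phi>' i p * l' i x)" if p: "p \<in> lspan (insert b F)" for p x
    proof -
      obtain g c where g: "g \<in> lspan F" "p = (\<lambda>x. g x + c * b x)"
        using lspan_insertE[OF p] by blast
      have gV: "g \<in> V" by (rule lspan_subset[OF V FV g(1)])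
      have "p x = (\<Sum>i<Suc N. \<phi>' i g * l' i x) + c * (\<Sum>i<Suc N. \<phi>' i b * l' i x)"
        unfolding g(2) using gx[OF g(1), of x] bx[of x] by presburger
      also have "\<dots> = (\<Sum>i<Suc N. \<phi>' i p * l' i x)"
        unfolding g(2) lin[OF mem(1) gV b] distrib_right sum.distrib sum_distrib_left
        by (simp only: mult.assoc)
      finally show ?thesis .
    qed
    then show ?thesis
      using mem by (intro exI[of _ "Suc N"] exI[of _ \<phi>'] exI[of _ l']) blast
  qed
qed

section \<open>Finite dimension and interpolation of harmonic polynomials\<close>

lemma harm_poly_poly: "p \<in> harm_poly k \<Longrightarrow> real_polynomial_function p"
  by (simp add: harm_poly_def)

lemma harm_poly_homog: "p \<in> harm_poly k \<Longrightarrow> p (c *\<^sub>R x) = c ^ k * p x"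
  by (simp add: harm_poly_def)

lemma lsubspace_harm_poly: "lsubspace (harm_poly k :: (real^'n::finite \<Rightarrow> real) set)"
  unfolding lsubspace_def
proof (intro conjI ballI allI)
  show "(\<lambda>x. 0) \<in> (harm_poly k :: (real^'n \<Rightarrow> real) set)"
    by (auto simp: harm_poly_def laplacian_def intro: real_polynomial_function.intros)
  fix f g :: "real^'n \<Rightarrow> real" and c :: real
  assume f: "f \<in> harm_poly k" and g: "g \<in> harm_poly k"
  note pf = harm_poly_poly[OF f] harm_poly_poly[OF g]
  have pc: "real_polynomial_function (\<lambda>x. c * q x)" if "real_polynomial_function q" for q :: "real^'n \<Rightarrow> real"
    using that by (auto intro: real_polynomial_function.intros)
  have "partial j (\<lambda>x. f x + c * g x) = (\<lambda>x. partial j f x + c * partial j g x)" for j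
    using pf pc by (auto simp: partial_poly_ops partial_cmult fun_eq_iff)
  moreover have "partial j (\<lambda>x. partial j f x + c * partial j g x) x = partial j (partial j f) x + c * partial j (partial j g) x" for j x
    using partial_poly_ops(1)[OF real_polynomial_function_grad(2)[OF pf(1)] pc[OF real_polynomial_function_grad(2)[OF pf(2)]]]
      partial_cmult[OF real_polynomial_function_grad(2)[OF pf(2)]] by metis
  ultimately have "laplacian (\<lambda>x. f x + c * g x) x = laplacian f x + c * laplacian g x" for x
    by (simp add: laplacian_def sum.distrib sum_distrib_left)
  then show "(\<lambda>x. f x + c * g x) \<in> harm_poly k"
    using f g pf pc by (auto simp: harm_poly_def algebra_simps intro: real_polynomial_function.intros)
qed

text \<open>Euler's equation writes a polynomial of positive degree through the products of
  coordinates with its partial derivatives, which are harmonic of one degree less. The products need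
  not be harmonic.\<close>

lemma harm_poly_lspan: "\<exists>B. finite B \<and> (harm_poly k :: (real^'n::finite \<Rightarrow> real) set) \<subseteq> lspan B"
proof (induction k)
  case 0
  have "p \<in> lspan {\<lambda>x. 1}" if "p \<in> harm_poly 0" for p :: "real^'n \<Rightarrow> real"
  proof -
    have "p x = p 0" for x
      using harm_poly_homog[OF that, of 0 x] by simp
    then have "p = (\<lambda>x. p 0 * 1)" by auto
    moreover have "(\<lambda>x. p 0 * 1) \<in> lspan {\<lambda>x. 1}"
      by (intro lspan_cmult lspan_base) auto
    ultimately show ?thesis by metis
  qed
  then show ?case by (intro exI[of _ "{\<lambda>x. 1}"]) auto
next
  case (Suc k)
  then obtain B where B: "finite B" "(harm_poly k :: (real^'n \<Rightarrow> real) set) \<subseteq> lspan B" by blast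
  let ?C = "(\<lambda>(i :: 'n, b) x. x $ i * b x) ` (UNIV \<times> B)"
  have mult: "(\<lambda>x. x $ i * f x) \<in> lspan ?C" if "f \<in> lspan B" for i f
    using that
  proof (induction f rule: lspan.induct)
    case (lspan_step f b c)
    then have "(\<lambda>x. x $ i * f x + c * (\<lambda>(i, b) x. x $ i * b x) (i, b) x) \<in> lspan ?C"
      by (intro lspan.lspan_step imageI) auto
    then show ?case by (simp add: algebra_simps)
  qed (simp add: lspan.lspan_0)
  have "p \<in> lspan ?C" if p: "p \<in> harm_poly (Suc k)" for p
  proof -
    have "x \<bullet> grad p x = real (Suc k) * p x" for x
      using harm_poly_euler[OF p] by (simp add: euler_harm_def)
    then have "p x = (1 / real (Suc k)) * (\<Sum>i\<in>UNIV. x $ i * partial i p x)" for x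
      by (simp add: inner_vec_def grad_def field_simps)
    then have "p = (\<lambda>x. (1 / real (Suc k)) * (\<Sum>i\<in>UNIV. x $ i * partial i p x))" by auto
    moreover have "(\<lambda>x. (1 / real (Suc k)) * (\<Sum>i\<in>UNIV. x $ i * partial i p x)) \<in> lspan ?C"
      using harm_poly_partial[OF p] B by (intro lspan_cmult lspan_sum mult) auto
    ultimately show ?thesis by metis
  qed
  then show ?case
    using B by (intro exI[of _ ?C]) auto
qed

lemma harm_poly_finite_span:
  "\<exists>F. finite F \<and> F \<subseteq> harm_poly k \<and> (harm_poly k :: (real^'n::finite \<Rightarrow> real) set) \<subseteq> lspan F"
  using harm_poly_lspan lsubspace_finite_span[OF _ lsubspace_harm_poly] by blast

lemma harm_poly_eq_0:
  fixes p :: "real^'n::finite \<Rightarrow> real"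
  assumes p: "p \<in> harm_poly k" and z: "\<And>x. x \<in> ball 0 1 \<Longrightarrow> p x = 0"
  shows "p = (\<lambda>x. 0)"
proof
  fix x :: "real^'n"
  let ?c = "1 / (norm x + 1)"
  have "norm x + 1 > 0" using norm_ge_zero[of x] by linarith
  then have "p (?c *\<^sub>R x) = 0"
    by (intro z) (simp add: field_simps)
  then show "p x = 0"
    using harm_poly_homog[OF p, of ?c x] \<open>norm x + 1 > 0\<close> by simp
qed

text \<open>The nodes lie in the unit ball because regularity in \<open>x\<close> is assumed only
  there. The coefficients of a solution then become its values \<open>g x (u s)\<close>, which are
  twice differentiable in \<open>x\<close>.\<close>

lemma harm_poly_interpolation:
  obtains N :: nat and u :: "nat \<Rightarrow> real^'n::finite" and l where
    "\<And>i. u i \<in> ball 0 1" "\<And>i. l i \<in> harm_poly k"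
    "\<And>p x. p \<in> harm_poly k \<Longrightarrow> p x = (\<Sum>i<N. p (u i) * l i x)"
proof -
  let ?\<Phi> = "(\<lambda>(u :: real^'n) p. p u :: real) ` ball 0 1"
  obtain F where F: "finite F" "F \<subseteq> harm_poly k" "(harm_poly k :: (real^'n \<Rightarrow> real) set) \<subseteq> lspan F"
    using harm_poly_finite_span by blast
  have "\<exists>(N :: nat) \<phi> l. (\<forall>i<N. \<phi> i \<in> ?\<Phi> \<and> l i \<in> harm_poly k) \<and>
      (\<forall>p\<in>lspan F. \<forall>x. p x = (\<Sum>i<N. \<phi> i p * l i x))"
    by (rule dual_expansion[OF lsubspace_harm_poly F(1,2)]) (auto intro: harm_poly_eq_0)
  then obtain N :: nat and \<phi> l where N: "\<forall>i<N. \<phi> i \<in> ?\<Phi> \<and> l i \<in> harm_poly k"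
    "\<forall>p\<in>lspan F. \<forall>x. p x = (\<Sum>i<N. \<phi> i p * l i x)" by blast
  then have "\<forall>i. \<exists>u. i < N \<longrightarrow> u \<in> ball 0 1 \<and> \<phi> i = (\<lambda>p. p u)" by blast
  then obtain u where u: "\<And>i. i < N \<Longrightarrow> u i \<in> ball 0 1" "\<And>i. i < N \<Longrightarrow> \<phi> i = (\<lambda>p. p (u i))" by metis
  show ?thesis
  \<comment> \<open>Beyond \<open>N\<close> the nodes and functions are set to zero, so that their
    properties hold for all indices.\<close>
  proof (rule that[of "\<lambda>i. if i < N then u i else 0" "\<lambda>i. if i < N then l i else (\<lambda>x. 0)" N])
    show "\<And>i. (if i < N then u i else 0) \<in> ball 0 1" using u by auto
    show "\<And>i. (if i < N then l i else (\<lambda>x. 0)) \<in> harm_poly k"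
      using N lsubspace_0[OF lsubspace_harm_poly] by auto
    fix p :: "real^'n \<Rightarrow> real" and x assume "p \<in> harm_poly k"
    then have "p x = (\<Sum>i<N. \<phi> i p * l i x)" using N F by auto
    also have "\<dots> = (\<Sum>i<N. p (if i < N then u i else 0) * (if i < N then l i else (\<lambda>x. 0)) x)"
      using u by (intro sum.cong) auto
    finally show "p x = (\<Sum>i<N. p (if i < N then u i else 0) * (if i < N then l i else (\<lambda>x. 0)) x)" .
  qed
qed

section \<open>Reflections\<close>

lemma tilt_linear: "bounded_linear (\<lambda>v. tilt t v a)"
proof -
  have "bounded_linear (\<lambda>v. v - (t * (v \<bullet> a) / (a \<bullet> a)) *\<^sub>R a)"
    unfolding times_divide_eq_right[symmetric] divide_inverse
    by (intro bounded_linear_sub bounded_linear_ident bounded_linear_scaleR_const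
        bounded_linear_const_mult bounded_linear_mult_const bounded_linear_inner_left)
  then show ?thesis by (simp add: tilt_def)
qed

lemma tilt_tilt: "tilt 2 (tilt 2 v a) a = v"
  by (cases "a = 0") (simp_all add: tilt_def inner_simps field_simps)

lemma norm_tilt: "norm (tilt 2 v a) = norm v"
proof -
  have "tilt 2 v a \<bullet> tilt 2 v a = v \<bullet> v"
    by (cases "a = 0") (simp_all add: tilt_def inner_simps inner_commute field_simps power2_eq_square)
  then show ?thesis by (simp add: norm_eq_sqrt_inner)
qed

lemma poly_tilt:
  assumes "real_polynomial_function q"
  shows "real_polynomial_function (\<lambda>v. q (tilt t v a))"
  using real_polynomial_function_compose[OF polynomial_function_bounded_linear[OF tilt_linear] assms]
  by (simp add: o_def)

lemma partial_reflect:
  assumes q: "real_polynomial_function q"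
  shows "partial i (\<lambda>v. q (tilt 2 v a)) v = partial i q (tilt 2 v a) - 2 * a $ i * D1 q (tilt 2 v a) a / (a \<bullet> a)"
proof -
  note bounded_linear_imp_has_derivative[OF tilt_linear[of 2 a]]
  from GDERIV_chain[OF real_polynomial_function_grad(1)[OF q] this]
  have "GDERIV (\<lambda>v. q (tilt 2 v a)) v :> grad q (tilt 2 v a) - (2 * D1 q (tilt 2 v a) a / (a \<bullet> a)) *\<^sub>R a"
    by (rule GDERIV_I) (simp add: tilt_def[of 2 _ a] D1_inner inner_simps algebra_simps)
  from partial_GDERIV(1)[OF this] show ?thesis
    by (simp add: grad_def)
qed

lemma partial_partial_reflect:
  assumes q: "real_polynomial_function q"
  shows "partial j (partial i (\<lambda>v. q (tilt 2 v a))) v = partial i (partial j q) (tilt 2 v a)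
      - 2 * a $ i * D1 (partial j q) (tilt 2 v a) a / (a \<bullet> a)
      - 2 * a $ j * D1 (partial i q) (tilt 2 v a) a / (a \<bullet> a)
      + 4 * a $ i * a $ j * D2 q (tilt 2 v a) a / (a \<bullet> a)\<^sup>2"
proof -
  let ?w = "tilt 2 v a"
  note pg = real_polynomial_function_grad(2)
  have e: "partial i (\<lambda>v. q (tilt 2 v a)) =
      (\<lambda>v. partial i q (tilt 2 v a) + (- 2 * a $ i / (a \<bullet> a)) * (\<Sum>l\<in>UNIV. a $ l * partial l q (tilt 2 v a)))"
    by (simp add: partial_reflect[OF q] fun_eq_iff D1_def)
  have pl: "real_polynomial_function (\<lambda>v. \<Sum>l\<in>UNIV. a $ l * partial l q (tilt 2 v a))"
    by (intro real_polynomial_function_sum real_polynomial_function.intros(2,4) poly_tilt pg q) simp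
  have "partial j (\<lambda>v. \<Sum>l\<in>UNIV. a $ l * partial l q (tilt 2 v a)) v =
      (\<Sum>l\<in>UNIV. a $ l * (partial j (partial l q) ?w - 2 * a $ j * D1 (partial l q) ?w a / (a \<bullet> a)))"
    by (subst partial_sum_poly)
      (auto simp: partial_cmult poly_tilt pg q partial_reflect intro!: real_polynomial_function.intros(2,4) poly_tilt pg q)
  also have "\<dots> = (\<Sum>l\<in>UNIV. a $ l * partial l (partial j q) ?w - (2 * a $ j / (a \<bullet> a)) * (a $ l * D1 (partial l q) ?w a))"
    by (intro sum.cong refl) (simp add: partial_commute[OF q, of j] algebra_simps)
  also have "\<dots> = D1 (partial j q) ?w a - (2 * a $ j / (a \<bullet> a)) * D2 q ?w a"
    by (simp only: sum_subtractf sum_distrib_left[symmetric] D1_def[of "partial j q"] D2_def[of q])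
  finally have s: "partial j (\<lambda>v. \<Sum>l\<in>UNIV. a $ l * partial l q (tilt 2 v a)) v = \<dots>" .
  have "partial j (partial i (\<lambda>v. q (tilt 2 v a))) v =
      (partial j (partial i q) ?w - 2 * a $ j * D1 (partial i q) ?w a / (a \<bullet> a))
      + (- 2 * a $ i / (a \<bullet> a)) * (D1 (partial j q) ?w a - (2 * a $ j / (a \<bullet> a)) * D2 q ?w a)"
    unfolding e partial_poly_ops(1)[OF poly_tilt[OF pg[OF q]] real_polynomial_function.intros(4)[OF real_polynomial_function.intros(2) pl]]
      partial_cmult[OF pl] s partial_reflect[OF pg[OF q]] ..
  then show ?thesis
    by (simp add: partial_commute[OF q, of j] power2_eq_square algebra_simps)
qed

text \<open>In the Laplacian the chain-rule terms of the reflection contribute \<open>- 4\<close>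
  and \<open>4\<close> times \<open>D2 p / (a \<bullet> a)\<close>.\<close>

lemma harm_poly_reflect:
  assumes p: "p \<in> harm_poly k"
  shows "(\<lambda>v. p (tilt 2 v a)) \<in> harm_poly k"
proof (cases "a = 0")
  case True
  then show ?thesis using p by (simp add: tilt_def)
next
  case False
  have "tilt 2 (c *\<^sub>R v) a = c *\<^sub>R tilt 2 v a" for c v
    by (simp add: tilt_def algebra_simps)
  moreover have "laplacian (\<lambda>v. p (tilt 2 v a)) v = 0" for v
  proof -
    let ?w = "tilt 2 v a"
    have n: "a \<bullet> a \<noteq> 0" using False by simp
    have "laplacian (\<lambda>v. p (tilt 2 v a)) v = (\<Sum>i\<in>UNIV. partial i (partial i p) ?w
        + (- 4 / (a \<bullet> a)) * (a $ i * D1 (partial i p) ?w a)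
        + (4 * D2 p ?w a / (a \<bullet> a)\<^sup>2) * (a $ i * a $ i))"
      unfolding laplacian_def
      by (intro sum.cong refl) (simp add: partial_partial_reflect[OF harm_poly_poly[OF p]] algebra_simps)
    also have "\<dots> = 0 + (- 4 / (a \<bullet> a)) * D2 p ?w a + (4 * D2 p ?w a / (a \<bullet> a)\<^sup>2) * (a \<bullet> a)"
      by (simp only: sum.distrib sum_distrib_left[symmetric] sum_a_D1 sum_a_a
          sum_partial_partial[OF harm_poly_euler[OF p]])
    finally show ?thesis using n by (simp add: power2_eq_square)
  qed
  ultimately show ?thesis
    using poly_tilt[OF harm_poly_poly[OF p]] by (simp add: harm_poly_def harm_poly_homog[OF p])
qed

section \<open>The reproducing kernel\<close>

lemma nn_integral_lborel_reflect_point: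
  fixes f :: "'a::euclidean_space \<Rightarrow> ennreal"
  assumes f: "f \<in> borel_measurable borel"
  shows "(\<integral>\<^sup>+x. f (t - x) \<partial>lborel) = (\<integral>\<^sup>+x. f x \<partial>lborel)"
proof -
  have "lborel = distr lborel borel (\<lambda>x :: 'a. t + (-1) *\<^sub>R x)"
    using lborel_affine[of "-1" t] by (simp add: density_1)
  then have "(\<integral>\<^sup>+x. f x \<partial>lborel) = (\<integral>\<^sup>+x. f x \<partial>distr lborel borel (\<lambda>x :: 'a. t + (-1) *\<^sub>R x))"
    by simp
  also have "\<dots> = (\<integral>\<^sup>+x. f (t - x) \<partial>lborel)"
    using f by (subst nn_integral_distr) auto
  finally show ?thesis by simp
qed

lemma nn_integral_lborel_translate:
  fixes f :: "'a::euclidean_space \<Rightarrow> ennreal"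
  assumes f: "f \<in> borel_measurable borel"
  shows "(\<integral>\<^sup>+x. f (x - t) \<partial>lborel) = (\<integral>\<^sup>+x. f x \<partial>lborel)"
proof -
  have "(\<integral>\<^sup>+x. f x \<partial>lborel) = (\<integral>\<^sup>+x. f x \<partial>distr lborel borel ((+) (- t)))"
    by (simp add: lborel_distr_plus)
  also have "\<dots> = (\<integral>\<^sup>+x. f (x - t) \<partial>lborel)"
    using f by (subst nn_integral_distr) auto
  finally show ?thesis by simp
qed

text \<open>Uniqueness of translation-invariant measures, by double counting with the unit ball, which
  the reflection preserves.\<close>

lemma nn_integral_reflect:
  fixes f :: "real^'n::finite \<Rightarrow> ennreal"
  assumes f [measurable]: "f \<in> borel_measurable borel"
  shows "(\<integral>\<^sup>+x. f (tilt 2 x a) \<partial>lborel) = (\<integral>\<^sup>+x. f x \<partial>lborel)"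
proof -
  let ?T = "\<lambda>v :: real^'n. tilt 2 v a"
  let ?B = "indicator (ball 0 1) :: real^'n \<Rightarrow> ennreal"
  let ?V = "emeasure lborel (ball 0 1 :: (real^'n) set)"
  have T [measurable]: "?T \<in> borel_measurable borel"
    by (intro borel_measurable_continuous_onI linear_continuous_on tilt_linear)
  have B [measurable]: "?B \<in> borel_measurable borel"
    by (intro borel_measurable_indicator) simp
  have lin: "?T (x - y) = ?T x - ?T y" for x y
    by (rule linear_diff[OF bounded_linear.linear[OF tilt_linear]])
  have V: "(\<integral>\<^sup>+y. ?B (y - c) \<partial>lborel) = ?V" for c
    by (subst nn_integral_lborel_translate[OF B]) simp
  have m1: "(\<lambda>(x, y). f (?T x) * ?B (y - ?T x)) \<in> borel_measurable (lborel \<Otimes>\<^sub>M lborel)"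
    by measurable
  have m2: "(\<lambda>(x, y). f (y - ?T x) * ?B (?T x)) \<in> borel_measurable (lborel \<Otimes>\<^sub>M lborel)"
    by measurable
  have "(\<integral>\<^sup>+x. f (?T x) \<partial>lborel) * ?V = (\<integral>\<^sup>+x. (\<integral>\<^sup>+y. f (?T x) * ?B (y - ?T x) \<partial>lborel) \<partial>lborel)"
    by (simp add: nn_integral_cmult V nn_integral_multc)
  also have "\<dots> = (\<integral>\<^sup>+y. (\<integral>\<^sup>+x. f (?T x) * ?B (y - ?T x) \<partial>lborel) \<partial>lborel)"
    using lborel_pair.Fubini'[OF m1] by simp
  also have "\<dots> = (\<integral>\<^sup>+y. (\<integral>\<^sup>+x. f (y - ?T x) * ?B (?T x) \<partial>lborel) \<partial>lborel)"
  proof (rule nn_integral_cong)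
    fix y :: "real^'n"
    \<comment> \<open>Since \<open>?T\<close> is a linear involution, replacing \<open>x\<close> by
      \<open>?T y - x\<close> exchanges \<open>?T x\<close> and \<open>y - ?T x\<close>.\<close>
    have "(\<integral>\<^sup>+x. f (?T x) * ?B (y - ?T x) \<partial>lborel) =
        (\<integral>\<^sup>+x. f (?T (?T y - x)) * ?B (y - ?T (?T y - x)) \<partial>lborel)"
      by (rule nn_integral_lborel_reflect_point[symmetric]) measurable
    then show "(\<integral>\<^sup>+x. f (?T x) * ?B (y - ?T x) \<partial>lborel) = (\<integral>\<^sup>+x. f (y - ?T x) * ?B (?T x) \<partial>lborel)"
      by (simp add: lin tilt_tilt)
  qed
  also have "\<dots> = (\<integral>\<^sup>+x. (\<integral>\<^sup>+y. f (y - ?T x) * ?B (?T x) \<partial>lborel) \<partial>lborel)"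
    using lborel_pair.Fubini'[OF m2] by simp
  also have "\<dots> = (\<integral>\<^sup>+x. (\<integral>\<^sup>+y. f y \<partial>lborel) * ?B x \<partial>lborel)"
  proof (rule nn_integral_cong)
    fix x :: "real^'n"
    have "(\<integral>\<^sup>+y. f (y - ?T x) * ?B (?T x) \<partial>lborel) = (\<integral>\<^sup>+y. f (y - ?T x) \<partial>lborel) * ?B (?T x)"
      by (rule nn_integral_multc) measurable
    moreover have "?B (?T x) = ?B x"
      by (simp add: indicator_def norm_tilt)
    ultimately show "(\<integral>\<^sup>+y. f (y - ?T x) * ?B (?T x) \<partial>lborel) = (\<integral>\<^sup>+y. f y \<partial>lborel) * ?B x"
      by (simp only: nn_integral_lborel_translate[OF f])
  qed
  also have "\<dots> = (\<integral>\<^sup>+y. f y \<partial>lborel) * ?V"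
    by (subst nn_integral_cmult_indicator) auto
  finally have "(\<integral>\<^sup>+x. f (?T x) \<partial>lborel) * ?V = (\<integral>\<^sup>+y. f y \<partial>lborel) * ?V" .
  moreover have "?V \<noteq> 0" "?V \<noteq> \<infinity>"
  proof -
    have e: "?V = ennreal (unit_ball_vol (real CARD('n)))"
      by (simp add: emeasure_ball)
    have p: "unit_ball_vol (real CARD('n)) > 0"
      by (rule unit_ball_vol_pos) simp
    show "?V \<noteq> 0"
      unfolding e ennreal_eq_0_iff not_le by (rule p)
    show "?V \<noteq> \<infinity>"
      unfolding e by simp
  qed
  ultimately show ?thesis
    by (simp add: mult.commute[of _ ?V] ennreal_mult_cancel_left)
qed

lemma lborel_distr_reflect: "distr lborel borel (\<lambda>v. tilt 2 v a) = (lborel :: (real^'n::finite) measure)"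
proof (rule measure_eqI)
  let ?T = "\<lambda>v :: real^'n. tilt 2 v a"
  have T: "?T \<in> measurable lborel borel"
    by (simp add: borel_measurable_continuous_onI linear_continuous_on tilt_linear)
  fix A assume "A \<in> sets (distr lborel borel ?T)"
  then have A: "A \<in> sets borel" by simp
  have "emeasure (distr lborel borel ?T) A = (\<integral>\<^sup>+x. indicator A x \<partial>distr lborel borel ?T)"
    using A by simp
  also have "\<dots> = (\<integral>\<^sup>+x. indicator A (?T x) \<partial>lborel)"
    using A by (subst nn_integral_distr[OF T]) auto
  also have "\<dots> = emeasure lborel A"
    using A by (subst nn_integral_reflect) auto
  finally show "emeasure (distr lborel borel ?T) A = emeasure lborel A" .
qed simp

section \<open>Integration on the sphere\<close>

text \<open>Written as a density, the scalar factor passes through Bochner integrals.\<close>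

lemma sphere_measure_eq:
  "(sphere_measure :: (real^'n::finite) measure) =
     density (distr (restrict_space lborel (ball 0 1 - {0})) borel (\<lambda>x. x /\<^sub>R norm x)) (\<lambda>_. ennreal (real CARD('n)))"
  unfolding sphere_measure_def
proof (rule measure_eqI)
  fix A :: "(real^'n) set"
  assume "A \<in> sets (scale_measure (of_nat CARD('n))
      (distr (restrict_space lborel (ball 0 1 - {0})) borel (\<lambda>x. x /\<^sub>R norm x)))"
  then show "emeasure (scale_measure (of_nat CARD('n))
      (distr (restrict_space lborel (ball 0 1 - {0})) borel (\<lambda>x. x /\<^sub>R norm x))) A =
    emeasure (density (distr (restrict_space lborel (ball 0 1 - {0})) borel (\<lambda>x. x /\<^sub>R norm x)) (\<lambda>_. ennreal (real CARD('n)))) A"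
    by (simp add: emeasure_density_const ennreal_of_nat_eq_real_of_nat)
qed simp

context
  fixes f :: "real^'n::finite \<Rightarrow> real"
  assumes f: "continuous_on UNIV f"
begin

private lemma fm: "f \<in> borel_measurable borel"
  by (rule borel_measurable_continuous_onI[OF f])

private lemma proj: "(\<lambda>x :: real^'n. x /\<^sub>R norm x) \<in> measurable (restrict_space lborel (ball 0 1 - {0})) borel"
  by (intro measurable_restrict_space1) auto

private lemma integrable_proj:
  "integrable lborel (\<lambda>x :: real^'n. indicator (ball 0 1 - {0}) x * f (x /\<^sub>R norm x))"
proof -
  have "bounded (f ` cball 0 1)"
    by (intro compact_imp_bounded compact_continuous_image continuous_on_subset[OF f]) auto
  then obtain B where B: "\<forall>x\<in>cball 0 1. \<bar>f x\<bar> \<le> B"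
    by (auto simp: bounded_iff)
  show ?thesis
  proof (rule Bochner_Integration.integrable_bound)
    show "integrable lborel (\<lambda>x :: real^'n. indicator (cball 0 1) x *\<^sub>R B)"
      by (rule borel_integrable_compact) auto
    have "(\<lambda>x :: real^'n. x /\<^sub>R norm x) \<in> borel_measurable borel" by simp
    from measurable_compose[OF this fm]
    show "(\<lambda>x :: real^'n. indicator (ball 0 1 - {0}) x * f (x /\<^sub>R norm x)) \<in> borel_measurable lborel"
      by (auto intro!: borel_measurable_times borel_measurable_indicator)
    show "AE x in lborel. norm (indicator (ball 0 1 - {0}) x * f (x /\<^sub>R norm x)) \<le> norm (indicator (cball 0 1) x *\<^sub>R B)"
    proof (rule AE_I2)
      fix x :: "real^'n"
      show "norm (indicator (ball 0 1 - {0}) x * f (x /\<^sub>R norm x)) \<le> norm (indicator (cball 0 1) x *\<^sub>R B)"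
        using B[rule_format, of "x /\<^sub>R norm x"] by (cases "x = 0") (auto simp: indicator_def)
    qed
  qed
qed

lemma integrable_sphere: "integrable sphere_measure f"
proof -
  have "integrable (restrict_space lborel (ball 0 1 - {0})) (\<lambda>x. f (x /\<^sub>R norm x))"
    using integrable_proj by (subst integrable_restrict_space) auto
  then show ?thesis
    unfolding sphere_measure_eq using fm proj
    by (subst integrable_density) (auto simp: integrable_distr_eq)
qed

lemma integral_sphere:
  "(LINT u|sphere_measure. f u) =
    real CARD('n) * (LINT x|lborel. indicator (ball 0 1 - {0}) x * f (x /\<^sub>R norm x))"
proof -
  have "(LINT u|sphere_measure. f u) =
      (LINT u|distr (restrict_space lborel (ball 0 1 - {0})) borel (\<lambda>x. x /\<^sub>R norm x). real CARD('n) *\<^sub>R f u)"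
    unfolding sphere_measure_eq using fm by (subst integral_density) auto
  also have "\<dots> = (LINT x|restrict_space lborel (ball 0 1 - {0}). real CARD('n) *\<^sub>R f (x /\<^sub>R norm x))"
    by (rule integral_distr[OF proj]) (use fm in simp)
  also have "\<dots> = real CARD('n) * (LINT x|lborel. indicator (ball 0 1 - {0}) x * f (x /\<^sub>R norm x))"
    by (subst integral_restrict_space) (auto simp: mult.left_commute[of _ "real CARD('n)"])
  finally show ?thesis .
qed

lemma sphere_integral_0_imp:
  assumes nn: "\<And>x. f x \<ge> 0" and 0: "(LINT u|sphere_measure. f u) = 0" and u: "norm u = 1"
  shows "f u = 0"
proof -
  let ?S = "ball 0 1 - {0} :: (real^'n) set"
  have "(LINT x|lborel. indicator ?S x * f (x /\<^sub>R norm x)) = 0"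
    using 0 integral_sphere by simp
  then have "AE x in lborel. indicator ?S x * f (x /\<^sub>R norm x) = 0"
    using integral_nonneg_eq_0_iff_AE[OF integrable_proj] nn by simp
  then have "AE x in lborel. x \<in> ?S \<longrightarrow> f (x /\<^sub>R norm x) = 0"
    by eventually_elim (auto simp: indicator_def)
  moreover have "continuous_on ?S (\<lambda>x. f (x /\<^sub>R norm x))"
    by (intro continuous_on_compose2[OF f] continuous_intros) auto
  \<comment> \<open>The point \<open>(1 / 2) *\<^sub>R u\<close> lies in the open punctured ball and
    projects to \<open>u\<close>; the almost everywhere statement is upgraded there by
    continuity.\<close>
  ultimately have "f (((1 / 2) *\<^sub>R u) /\<^sub>R norm ((1 / 2) *\<^sub>R u)) = 0"
    using u by (intro AE_lborel_continuous_eq_0[of ?S "\<lambda>x. f (x /\<^sub>R norm x)"]) auto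
  then show ?thesis using u by simp
qed

end

text \<open>The reflection commutes with \<open>x /\<^sub>R norm x\<close> and preserves both the
  punctured ball and Lebesgue measure.\<close>

lemma integral_sphere_reflect:
  fixes f :: "real^'n::finite \<Rightarrow> real"
  assumes f: "continuous_on UNIV f"
  shows "(LINT u|sphere_measure. f (tilt 2 u a)) = (LINT u|sphere_measure. f u)"
proof -
  let ?h = "\<lambda>x :: real^'n. indicator (ball 0 1 - {0}) x * f (x /\<^sub>R norm x)"
  have ct: "continuous_on UNIV (\<lambda>u. tilt 2 u a)"
    by (intro linear_continuous_on tilt_linear)
  have cf: "continuous_on UNIV (\<lambda>u. f (tilt 2 u a))"
    by (rule continuous_on_compose2[OF f ct]) auto
  have hm: "?h \<in> borel_measurable borel"
  proof -
    have "(\<lambda>x :: real^'n. x /\<^sub>R norm x) \<in> borel_measurable borel" by simp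
    from measurable_compose[OF this borel_measurable_continuous_onI[OF f]] show ?thesis
      by (auto intro!: borel_measurable_times borel_measurable_indicator)
  qed
  have lin: "tilt 2 (c *\<^sub>R x) a = c *\<^sub>R tilt 2 x a" for c x
    by (simp add: tilt_def algebra_simps)
  have z: "tilt 2 x a = 0 \<longleftrightarrow> x = 0" for x
    using norm_tilt[of x a] by (metis norm_eq_zero)
  have "(LINT x|lborel. ?h x) = (LINT x|distr lborel borel (\<lambda>v. tilt 2 v a). ?h x)"
    by (simp only: lborel_distr_reflect)
  also have "\<dots> = (LINT x|lborel. ?h (tilt 2 x a))"
    by (rule integral_distr[OF _ hm]) (use borel_measurable_continuous_onI[OF ct] in simp)
  also have "(\<lambda>x. ?h (tilt 2 x a)) = (\<lambda>x. indicator (ball 0 1 - {0}) x * f (tilt 2 (x /\<^sub>R norm x) a))"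
    by (simp add: lin norm_tilt z indicator_def fun_eq_iff)
  finally show ?thesis
    by (simp add: integral_sphere f cf)
qed

lemma harm_poly_continuous: "p \<in> harm_poly k \<Longrightarrow> continuous_on S p"
  using poly_continuous[OF harm_poly_poly continuous_on_id, of p k S] by simp

lemma harm_poly_sphere_0:
  assumes p: "p \<in> harm_poly k" and 0: "(LINT u|sphere_measure. p u * p u) = 0"
  shows "p = (\<lambda>x. 0)"
proof (rule harm_poly_eq_0[OF p])
  have z: "p u = 0" if "norm u = 1" for u
    using sphere_integral_0_imp[of "\<lambda>u. p u * p u" u] 0 that
    by (simp add: continuous_on_mult harm_poly_continuous[OF p])
  fix x
  show "p x = 0"
  proof (cases "x = 0")
    case True
    \<comment> \<open>Valid also for \<open>k = 0\<close>, where \<open>0 ^ 0 = 1\<close>, because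
      \<open>p\<close> vanishes at the unit vector.\<close>
    have "p (0 *\<^sub>R axis undefined 1) = 0 ^ k * p (axis undefined 1)"
      by (rule harm_poly_homog[OF p])
    then show ?thesis using True z[of "axis undefined 1"] by simp
  next
    case False
    have "p (norm x *\<^sub>R (x /\<^sub>R norm x)) = norm x ^ k * p (x /\<^sub>R norm x)"
      by (rule harm_poly_homog[OF p])
    then show ?thesis using False z[of "x /\<^sub>R norm x"] by simp
  qed
qed

section \<open>Existence and uniqueness of the reproducing kernel\<close>

definition is_repr_kernel :: "nat \<Rightarrow> (real^'n::finite \<Rightarrow> real^'n \<Rightarrow> real) \<Rightarrow> bool" where
  "is_repr_kernel k Z \<longleftrightarrow> (\<forall>v. (\<lambda>u. Z u v) \<in> harm_poly k \<and>
     (\<forall>h\<in>harm_poly k. h v = (LINT u|sphere_measure. Z u v * h u)))"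

text \<open>Inner products with harmonic polynomials separate them, so \<open>dual_expansion\<close>
  expands every \<open>h\<close> with coefficients that are inner products with certain
  \<open>r i\<close>; summing \<open>l i v * r i u\<close> gives a kernel.\<close>

lemma ex_repr_kernel: "\<exists>Z :: real^'n::finite \<Rightarrow> real^'n \<Rightarrow> real. is_repr_kernel k Z"
proof -
  let ?H = "harm_poly k :: (real^'n \<Rightarrow> real) set"
  let ?\<phi> = "\<lambda>r p :: real^'n \<Rightarrow> real. LINT u|sphere_measure. r u * p u"
  obtain F where F: "finite F" "F \<subseteq> ?H" "?H \<subseteq> lspan F"
    using harm_poly_finite_span by blast
  have int: "integrable sphere_measure (\<lambda>u. r u * p u)" if "r \<in> ?H" "p \<in> ?H" for r p
    by (intro integrable_sphere continuous_on_mult harm_poly_continuous[of _ k] that)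
  have "\<exists>(N :: nat) \<phi> l. (\<forall>i<N. \<phi> i \<in> ?\<phi> ` ?H \<and> l i \<in> ?H) \<and> (\<forall>p\<in>lspan F. \<forall>x. p x = (\<Sum>i<N. \<phi> i p * l i x))"
  proof (rule dual_expansion[OF lsubspace_harm_poly F(1,2)])
    fix \<phi> f g c assume "\<phi> \<in> ?\<phi> ` ?H" and fg: "f \<in> ?H" "g \<in> ?H"
    then obtain r where r: "r \<in> ?H" "\<phi> = ?\<phi> r" by blast
    have "(LINT u|sphere_measure. r u * (f u + c * g u)) = (LINT u|sphere_measure. r u * f u + c * (r u * g u))"
      by (simp add: algebra_simps)
    also have "\<dots> = (LINT u|sphere_measure. r u * f u) + c * (LINT u|sphere_measure. r u * g u)"
      using int[OF r(1) fg(1)] int[OF r(1) fg(2)] by simp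
    finally show "\<phi> (\<lambda>x. f x + c * g x) = \<phi> f + c * \<phi> g" by (simp add: r(2))
  next
    fix f assume "f \<in> ?H" "\<And>\<phi>. \<phi> \<in> ?\<phi> ` ?H \<Longrightarrow> \<phi> f = 0"
    then show "f = (\<lambda>x. 0)" by (intro harm_poly_sphere_0[of f k]) auto
  qed
  then obtain N :: nat and \<phi> l where N: "\<forall>i<N. \<phi> i \<in> ?\<phi> ` ?H \<and> l i \<in> ?H"
    "\<forall>p\<in>lspan F. \<forall>x. p x = (\<Sum>i<N. \<phi> i p * l i x)" by (elim exE conjE)
  have "\<forall>i. \<exists>r. i < N \<longrightarrow> r \<in> ?H \<and> \<phi> i = ?\<phi> r" using N(1) by blast
  then obtain r where r: "\<And>i. i < N \<Longrightarrow> r i \<in> ?H" "\<And>i. i < N \<Longrightarrow> \<phi> i = ?\<phi> (r i)"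
    by metis
  define Z where "Z u v = (\<Sum>i<N. l i v * r i u)" for u v
  have "(\<lambda>u. Z u v) \<in> ?H" for v
    unfolding Z_def by (rule lsubspace_sum[OF lsubspace_harm_poly]) (use r in auto)
  moreover have "h v = (LINT u|sphere_measure. Z u v * h u)" if h: "h \<in> ?H" for h v
  proof -
    have "(LINT u|sphere_measure. Z u v * h u) = (LINT u|sphere_measure. (\<Sum>i<N. l i v * (r i u * h u)))"
      by (simp add: Z_def sum_distrib_right mult.assoc)
    also have "\<dots> = (\<Sum>i<N. (LINT u|sphere_measure. l i v * (r i u * h u)))"
      by (rule Bochner_Integration.integral_sum) (use int r h in auto)
    also have "\<dots> = (\<Sum>i<N. \<phi> i h * l i v)"
      using r by (intro sum.cong) (auto simp: mult.commute)
    also have "\<dots> = h v"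
      using N(2) F(3) h by auto
    finally show ?thesis by simp
  qed
  ultimately show ?thesis
    unfolding is_repr_kernel_def by blast
qed

text \<open>For fixed \<open>v\<close> the difference of two kernels is harmonic, and both reproduce
  it; it is therefore orthogonal to itself.\<close>

lemma repr_kernel_unique:
  assumes Z: "is_repr_kernel k Z" and Z': "is_repr_kernel k Z'"
  shows "Z = Z'"
proof (intro ext)
  fix u v
  let ?w = "\<lambda>u. Z u v + (-1) * Z' u v"
  have H: "(\<lambda>u. Z u v) \<in> harm_poly k" "(\<lambda>u. Z' u v) \<in> harm_poly k"
    using Z Z' by (auto simp: is_repr_kernel_def)
  have w: "?w \<in> harm_poly k"
    by (rule lsubspaceD[OF lsubspace_harm_poly H])
  have i: "integrable sphere_measure (\<lambda>u. Z u v * ?w u)" "integrable sphere_measure (\<lambda>u. Z' u v * ?w u)"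
    by (intro integrable_sphere continuous_on_mult harm_poly_continuous[OF w] harm_poly_continuous[OF H(1)] harm_poly_continuous[OF H(2)])+
  have "(LINT u|sphere_measure. ?w u * ?w u) = (LINT u|sphere_measure. Z u v * ?w u - Z' u v * ?w u)"
    by (simp add: algebra_simps)
  also have "\<dots> = (LINT u|sphere_measure. Z u v * ?w u) - (LINT u|sphere_measure. Z' u v * ?w u)"
    by (rule Bochner_Integration.integral_diff[OF i])
  also have "\<dots> = ?w v - ?w v"
    using Z[unfolded is_repr_kernel_def, THEN spec, of v, THEN conjunct2, rule_format, OF w]
      Z'[unfolded is_repr_kernel_def, THEN spec, of v, THEN conjunct2, rule_format, OF w] by simp
  finally have "?w = (\<lambda>u. 0)"
    by (intro harm_poly_sphere_0[OF w]) simp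
  from fun_cong[OF this, of u] show "Z u v = Z' u v" by simp
qed

lemma repr_kernel_is: "is_repr_kernel k (repr_kernel k :: real^'n::finite \<Rightarrow> real^'n \<Rightarrow> real)"
proof -
  obtain Z :: "real^'n \<Rightarrow> real^'n \<Rightarrow> real" where Z: "is_repr_kernel k Z"
    using ex_repr_kernel by blast
  have e: "repr_kernel k = (THE Z :: real^'n \<Rightarrow> real^'n \<Rightarrow> real. is_repr_kernel k Z)"
    unfolding repr_kernel_def is_repr_kernel_def ..
  have "is_repr_kernel k (THE Z :: real^'n \<Rightarrow> real^'n \<Rightarrow> real. is_repr_kernel k Z)"
    by (rule theI[of "is_repr_kernel k", OF Z]) (rule repr_kernel_unique[OF _ Z])
  then show ?thesis unfolding e .
qed

lemma repr_kernel_harm: "(\<lambda>u. repr_kernel k u v) \<in> harm_poly k"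
  and repr_kernel_reproduces: "h \<in> harm_poly k \<Longrightarrow> (LINT u|sphere_measure. repr_kernel k u v * h u) = h v"
  using repr_kernel_is[unfolded is_repr_kernel_def, THEN spec, of k v, THEN conjunct1]
    repr_kernel_is[unfolded is_repr_kernel_def, THEN spec, of k v, THEN conjunct2, rule_format, of h]
  by simp_all

text \<open>Invariance of the sphere moves the reflection from the kernel to \<open>h\<close>, which
  stays harmonic and is then reproduced. This evaluates the inner integral of the representation
  formula.\<close>

lemma repr_kernel_reflect:
  fixes h :: "real^'n::finite \<Rightarrow> real"
  assumes h: "h \<in> harm_poly k"
  shows "(LINT u|sphere_measure. repr_kernel k (tilt 2 u a) v * h u) = h (tilt 2 v a)"
proof -
  let ?f = "\<lambda>u. repr_kernel k u v * h (tilt 2 u a)"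
  have hr: "(\<lambda>u. h (tilt 2 u a)) \<in> harm_poly k" by (rule harm_poly_reflect[OF h])
  have "continuous_on UNIV ?f"
    by (intro continuous_on_mult harm_poly_continuous[OF repr_kernel_harm] harm_poly_continuous[OF hr])
  from integral_sphere_reflect[OF this, of a]
  show ?thesis
    using repr_kernel_reproduces[OF hr, of v] by (simp add: tilt_tilt)
qed

section \<open>A smooth test function\<close>

text \<open>A family containing a bump function and closed under directional derivatives, so that
  all orders of differentiability follow by one induction.\<close>

inductive bump :: "(real^'n::finite \<Rightarrow> real) \<Rightarrow> bool" where
  bump_base: "real_polynomial_function P \<Longrightarrow> bump (\<lambda>x. P x * flat j (1 - x \<bullet> x))"
| bump_add: "bump f \<Longrightarrow> bump g \<Longrightarrow> bump (\<lambda>x. f x + g x)"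

lemma differentiable_imp_continuous_on_real:
  fixes f :: "'a::real_normed_vector \<Rightarrow> real"
  assumes "\<And>x. x \<in> S \<Longrightarrow> f differentiable (at x)"
  shows "continuous_on S f"
  by (intro continuous_at_imp_continuous_on ballI differentiable_imp_continuous_within assms)

lemma bump_derivative:
  fixes f :: "real^'n::finite \<Rightarrow> real"
  assumes "bump f"
  shows "(\<forall>x. f differentiable (at x)) \<and> (\<forall>w. bump (\<lambda>x. frechet_derivative f (at x) w))"
  using assms
proof induction
  case (bump_base P j)
  let ?D = "\<lambda>x w. (w \<bullet> grad P x) * flat j (1 - x \<bullet> x) +
      (P x * (-2 * (w \<bullet> x))) * flat (j + 2) (1 - x \<bullet> x) + (P x * (2 * real j * (w \<bullet> x))) * flat (j + 1) (1 - x \<bullet> x)"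
  have d: "((\<lambda>x. P x * flat j (1 - x \<bullet> x)) has_derivative ?D x) (at x)" for x
  proof -
    have "((\<lambda>x :: real^'n. 1 - x \<bullet> x) has_derivative (\<lambda>w. - 2 * (w \<bullet> x))) (at x)"
      by (auto intro!: derivative_eq_intros simp: inner_commute)
    from has_derivative_compose[OF this flat_DERIV[THEN has_field_derivative_imp_has_derivative]]
    have "((\<lambda>x. flat j (1 - x \<bullet> x)) has_derivative (\<lambda>w. (flat (j + 2) (1 - x \<bullet> x) - real j * flat (j + 1) (1 - x \<bullet> x)) * (- 2 * (w \<bullet> x)))) (at x)" .
    from has_derivative_mult[OF real_polynomial_function_grad(1)[OF bump_base, unfolded gderiv_def] this]
    show ?thesis
      by (rule has_derivative_eq_rhs) (auto simp: fun_eq_iff algebra_simps)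
  qed
  have fd: "frechet_derivative (\<lambda>x. P x * flat j (1 - x \<bullet> x)) (at x) = ?D x" for x
    using frechet_derivative_at[OF d] by simp
  have "real_polynomial_function (\<lambda>x. w \<bullet> grad P x)" for w
  proof -
    have "real_polynomial_function (\<lambda>x. \<Sum>i\<in>UNIV. w $ i * partial i P x)"
      by (intro real_polynomial_function_sum real_polynomial_function.intros(2,4)
          real_polynomial_function_grad(2)[OF bump_base]) simp
    then show ?thesis by (simp add: inner_vec_def grad_def)
  qed
  moreover have "real_polynomial_function (\<lambda>x. P x * (c * (w \<bullet> x)))" for c w
    by (intro real_polynomial_function.intros bump_base bounded_linear_inner_right)
  ultimately have "bump (\<lambda>x. ?D x w)" for w
    by (intro bump.intros)
  then show ?case
    using d by (auto simp: fd differentiable_def)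
next
  case (bump_add f g)
  have "frechet_derivative (\<lambda>x. f x + g x) (at x) w = frechet_derivative f (at x) w + frechet_derivative g (at x) w" for x w
  proof -
    have "(f has_derivative frechet_derivative f (at x)) (at x)" "(g has_derivative frechet_derivative g (at x)) (at x)"
      using bump_add frechet_derivative_works by blast+
    from frechet_derivative_at[OF has_derivative_add[OF this]] show ?thesis by metis
  qed
  then show ?case
    using bump_add by (auto intro: bump.bump_add)
qed

lemma bump_Cn_on: "bump f \<Longrightarrow> Cn_on n UNIV f"
proof (induction n arbitrary: f)
  case 0
  then show ?case
    using bump_derivative[OF 0] by (simp add: differentiable_imp_continuous_on_real)
qed (use bump_derivative in auto)

text \<open>Needed for uniqueness of the normalising constant: an identity that holds for all test
  functions must be tested on one that sees the point mass.\<close>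

lemma ex_test_function: "\<exists>\<phi> \<in> test_functions. \<phi> (0 :: real^'n::finite) \<noteq> 0"
proof -
  let ?\<phi> = "\<lambda>x :: real^'n. 1 * flat 0 (1 - x \<bullet> x)"
  have "bump ?\<phi>"
    by (intro bump_base real_polynomial_function.intros)
  moreover have "compact (closure {x. ?\<phi> x \<noteq> 0})"
  proof -
    have "{x. ?\<phi> x \<noteq> 0} \<subseteq> ball 0 1"
      by (auto simp: flat_def dot_square_norm power_less_one_iff split: if_splits)
    then show ?thesis
      using bounded_subset[OF bounded_ball] by (simp only: compact_closure)
  qed
  ultimately have "?\<phi> \<in> test_functions"
    by (auto simp: test_functions_def intro: bump_Cn_on)
  moreover have "?\<phi> 0 \<noteq> 0"
    by (simp add: flat_def)
  ultimately show ?thesis by (intro bexI[of _ ?\<phi>])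
qed

section \<open>Differentiability of the coefficients\<close>

text \<open>The affine map \<open>\<iota>\<close> is the slice that sends \<open>x\<close> to
  \<open>(x, u)\<close> for functions of two variables, and the identity for test functions.\<close>

lemma Cn_on_2_has_partial:
  fixes F :: "'a::euclidean_space \<Rightarrow> real" and \<iota> :: "real^'n::finite \<Rightarrow> 'a"
  assumes F: "Cn_on 2 S F" and \<iota>: "\<And>x. \<iota> x \<in> S" "continuous_on UNIV \<iota>"
    and lin: "\<And>x t j. \<iota> (x + t *\<^sub>R axis j 1) = \<iota> x + t *\<^sub>R w j"
  shows "C2 (\<lambda>x. F (\<iota> x)) (\<lambda>j. partial j (\<lambda>x. F (\<iota> x))) (\<lambda>i j. partial i (partial j (\<lambda>x. F (\<iota> x))))"
proof -
  have key: "has_partial j (\<lambda>x. G (\<iota> x)) (\<lambda>x. frechet_derivative G (at (\<iota> x)) (w j))"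
    if G: "\<And>z. z \<in> S \<Longrightarrow> G differentiable (at z)"
      and c: "continuous_on S (\<lambda>z. frechet_derivative G (at z) (w j))" for G :: "'a \<Rightarrow> real" and j
    unfolding has_partial_def
  proof (intro conjI allI)
    have "continuous_on S G"
      by (rule differentiable_imp_continuous_on_real[OF G])
    then show "continuous_on UNIV (\<lambda>x. G (\<iota> x))"
      by (rule continuous_on_compose2[OF _ \<iota>(2)]) (use \<iota> in auto)
    show "continuous_on UNIV (\<lambda>x. frechet_derivative G (at (\<iota> x)) (w j))"
      by (rule continuous_on_compose2[OF c \<iota>(2)]) (use \<iota> in auto)
    fix x
    have G': "(G has_derivative frechet_derivative G (at (\<iota> x))) (at (\<iota> x))"
      using G[OF \<iota>(1)] frechet_derivative_works by blast
    have "((\<lambda>t. \<iota> x + t *\<^sub>R w j) has_derivative (\<lambda>t. t *\<^sub>R w j)) (at 0)"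
      by (auto intro!: derivative_eq_intros)
    from has_derivative_compose[OF this, of G "frechet_derivative G (at (\<iota> x))"] G'
    have "((\<lambda>t. G (\<iota> x + t *\<^sub>R w j)) has_derivative (\<lambda>t. frechet_derivative G (at (\<iota> x)) (t *\<^sub>R w j))) (at 0)"
      by simp
    then have "((\<lambda>t. G (\<iota> x + t *\<^sub>R w j)) has_real_derivative frechet_derivative G (at (\<iota> x)) (w j)) (at 0)"
      by (rule has_derivative_imp_has_field_derivative)
        (simp add: linear_scale[OF has_derivative_linear[OF G']])
    then show "((\<lambda>t. G (\<iota> (x + t *\<^sub>R axis j 1))) has_real_derivative frechet_derivative G (at (\<iota> x)) (w j)) (at 0)"
      by (simp add: lin)
  qed
  have F': "\<And>z. z \<in> S \<Longrightarrow> F differentiable (at z)"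
    "\<And>z v. z \<in> S \<Longrightarrow> (\<lambda>z. frechet_derivative F (at z) v) differentiable (at z)"
    "\<And>v v'. continuous_on S (\<lambda>z. frechet_derivative (\<lambda>z. frechet_derivative F (at z) v) (at z) v')"
    using F by (auto simp: numeral_2_eq_2)
  have c1: "continuous_on S (\<lambda>z. frechet_derivative F (at z) v)" for v
    by (rule differentiable_imp_continuous_on_real[OF F'(2)])
  have 1: "has_partial j (\<lambda>x. F (\<iota> x)) (\<lambda>x. frechet_derivative F (at (\<iota> x)) (w j))" for j
    by (rule key[OF F'(1) c1])
  have 2: "has_partial i (\<lambda>x. frechet_derivative F (at (\<iota> x)) (w j))
      (\<lambda>x. frechet_derivative (\<lambda>z. frechet_derivative F (at z) (w j)) (at (\<iota> x)) (w i))" for i j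
    by (rule key[OF F'(2,3)])
  show ?thesis
    using 1 2 has_partial_partial[OF 1] has_partial_partial[OF 2] by (auto simp: C2_def)
qed

lemma C2_harm_slice:
  fixes g :: "real^'n::finite \<Rightarrow> real^'n \<Rightarrow> real"
  assumes "g \<in> C2_harm UNIV k" "u \<in> ball 0 1"
  shows "C2 (\<lambda>x. g x u) (\<lambda>j. partial j (\<lambda>x. g x u)) (\<lambda>i j. partial i (partial j (\<lambda>x. g x u)))"
proof -
  have "continuous_on UNIV (\<lambda>x :: real^'n. (x, u))"
    by (intro continuous_intros)
  then show ?thesis
    using Cn_on_2_has_partial[of "UNIV \<times> ball 0 1" "\<lambda>(x, u). g x u" "\<lambda>x. (x, u)" "\<lambda>j. (axis j 1, 0)"] assms
    by (simp add: C2_harm_def)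
qed

lemma C2_test_function:
  assumes "\<phi> \<in> test_functions"
  shows "C2 \<phi> (\<lambda>j. partial j \<phi>) (\<lambda>i j. partial i (partial j \<phi>))"
  using Cn_on_2_has_partial[of UNIV \<phi> "\<lambda>x. x" "\<lambda>j. axis j 1"] assms
  by (simp add: test_functions_def)

section \<open>The operator in coordinates\<close>

text \<open>The facts \<open>1\<close> and \<open>2\<close> are all that is used about the
  derivatives in \<open>x\<close>, so the same expansion serves functions, where
  \<open>c s i j\<close> are second derivatives, and distributions, where they are pairings with
  second derivatives of a test function.\<close>

lemma bosonic_op_expand:
  fixes F :: "'x \<Rightarrow> real^'n::finite \<Rightarrow> real" and l :: "nat \<Rightarrow> real^'n \<Rightarrow> real" and k :: nat
  defines "b \<equiv> 4 / (real CARD('n) + 2 * real k - 2)" and "g \<equiv> 1 / (real CARD('n) + 2 * real k - 4)"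
  assumes l: "\<And>s. real_polynomial_function (l s)"
    and 1: "\<And>j u. d j (d j F) x u = (\<Sum>s<N. c s j j * l s u)"
    and 2: "\<And>i u. d i (Du_Dx d F) x u = (\<Sum>j\<in>UNIV. \<Sum>s<N. c s i j * partial j (l s) u)"
  shows "bosonic_op d k F x u = (\<Sum>s<N. \<Sum>i\<in>UNIV. \<Sum>j\<in>UNIV. c s i j *
      ((if i = j then l s u else 0) - b * (u $ i * partial j (l s) u - g * (u \<bullet> u) * partial i (partial j (l s)) u)))"
proof -
  note lp = real_polynomial_function_grad(2)[OF l]
  have pol: "real_polynomial_function (\<lambda>u. \<Sum>s<N. c s i j * partial j (l s) u)" for i j
    by (intro real_polynomial_function_sum real_polynomial_function.intros(2,4) lp) simp
  have "Du_Dx d (Du_Dx d F) x u = (\<Sum>i\<in>UNIV. partial i (\<lambda>u. d i (Du_Dx d F) x u) u)"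
    unfolding Du_Dx_def[of d "Du_Dx d F"] du_def ..
  also have "\<dots> = (\<Sum>i\<in>UNIV. \<Sum>j\<in>UNIV. \<Sum>s<N. c s i j * partial i (partial j (l s)) u)"
    unfolding 2
    by (simp add: partial_sum_poly pol real_polynomial_function.intros(2,4) lp partial_cmult)
  finally have 3: "Du_Dx d (Du_Dx d F) x u = \<dots>" .
  have 4: "u_Dx d (Du_Dx d F) x u = (\<Sum>i\<in>UNIV. \<Sum>j\<in>UNIV. \<Sum>s<N. c s i j * (u $ i * partial j (l s) u))"
    unfolding u_Dx_def 2 by (simp add: sum_distrib_left mult_ac)
  have 5: "(\<Sum>j\<in>UNIV. d j (d j F) x u) = (\<Sum>i\<in>UNIV. \<Sum>j\<in>UNIV. \<Sum>s<N. c s i j * (if i = j then l s u else 0))"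
    unfolding 1 by (intro sum.cong refl) (simp add: if_distrib[of "(*) _"] sum.swap[of _ "{..<N}"] cong: if_cong)
  have bg: "4 * (norm u)\<^sup>2 * X / ((real CARD('n) + 2 * real k - 2) * (real CARD('n) + 2 * real k - 4)) = b * g * (u \<bullet> u) * X" for X
    by (simp add: b_def g_def dot_square_norm)
  have bb: "4 * X / (real CARD('n) + 2 * real k - 2) = b * X" for X
    by (simp add: b_def)
  have "bosonic_op d k F x u = (\<Sum>i\<in>UNIV. \<Sum>j\<in>UNIV. \<Sum>s<N. c s i j *
      ((if i = j then l s u else 0) - b * (u $ i * partial j (l s) u - g * (u \<bullet> u) * partial i (partial j (l s)) u)))"
    unfolding bosonic_op_def Let_def bg bb 3 4 5
    by (simp add: sum_distrib_left sum_subtractf[symmetric] sum.distrib[symmetric])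
      (simp add: algebra_simps)
  also have "\<dots> = (\<Sum>s<N. \<Sum>i\<in>UNIV. \<Sum>j\<in>UNIV. c s i j *
      ((if i = j then l s u else 0) - b * (u $ i * partial j (l s) u - g * (u \<bullet> u) * partial i (partial j (l s)) u)))"
    by (simp add: sum.swap[of _ "{..<N}"])
  finally show ?thesis .
qed

lemma partial_has_partial_sum:
  fixes N :: nat
  assumes "\<And>s. s < N \<Longrightarrow> has_partial j (f s) (f' s)"
  shows "partial j (\<lambda>x. \<Sum>s<N. f s x * c s) x = (\<Sum>s<N. f' s x * c s)"
proof -
  have "((\<lambda>t. \<Sum>s<N. f s (x + t *\<^sub>R axis j 1) * c s) has_real_derivative (\<Sum>s<N. f' s x * c s)) (at 0)"
    by (intro DERIV_sum DERIV_cmult_right) (use assms in \<open>auto simp: has_partial_def\<close>)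
  then show ?thesis
    unfolding partial_def by (rule DERIV_imp_deriv)
qed

lemma bosonic_laplacian_expand:
  fixes g :: "real^'n::finite \<Rightarrow> real^'n \<Rightarrow> real" and l :: "nat \<Rightarrow> real^'n \<Rightarrow> real" and k :: nat
  defines "b \<equiv> 4 / (real CARD('n) + 2 * real k - 2)" and "gm \<equiv> 1 / (real CARD('n) + 2 * real k - 4)"
  assumes l: "\<And>s. real_polynomial_function (l s)"
    and g: "\<And>x u. g x u = (\<Sum>s<N. G s x * l s u)" and G: "\<And>s. C2 (G s) (G1 s) (G2 s)"
  shows "bosonic_laplacian k g x u = (\<Sum>s<N. \<Sum>i\<in>UNIV. \<Sum>j\<in>UNIV. G2 s i j x *
      ((if i = j then l s u else 0) - b * (u $ i * partial j (l s) u - gm * (u \<bullet> u) * partial i (partial j (l s)) u)))"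
proof -
  have hp: "has_partial j (G s) (G1 s j)" "has_partial i (G1 s j) (G2 s i j)" for i j s
    using G by (auto simp: C2_def)
  have g': "g = (\<lambda>x u. \<Sum>s<N. G s x * l s u)" using g by blast
  have d1: "dx j g = (\<lambda>x u. \<Sum>s<N. G1 s j x * l s u)" for j
    unfolding dx_def g' by (intro ext partial_has_partial_sum hp)
  have d2: "dx i (dx j g) = (\<lambda>x u. \<Sum>s<N. G2 s i j x * l s u)" for i j
    unfolding d1 unfolding dx_def by (intro ext partial_has_partial_sum hp)
  have d3: "Du_Dx dx g = (\<lambda>x u. \<Sum>j\<in>UNIV. \<Sum>s<N. G1 s j x * partial j (l s) u)"
    unfolding Du_Dx_def du_def d1
    by (simp add: partial_sum_poly partial_cmult l real_polynomial_function.intros(2,4))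
  have d4: "dx i (Du_Dx dx g) x u = (\<Sum>j\<in>UNIV. \<Sum>s<N. G2 s i j x * partial j (l s) u)" for i x u
  proof -
    have "((\<lambda>t. \<Sum>j\<in>UNIV. \<Sum>s<N. G1 s j (x + t *\<^sub>R axis i 1) * partial j (l s) u) has_real_derivative
        (\<Sum>j\<in>UNIV. \<Sum>s<N. G2 s i j x * partial j (l s) u)) (at 0)"
      by (intro DERIV_sum DERIV_cmult_right) (use hp in \<open>auto simp: has_partial_def\<close>)
    then show ?thesis
      unfolding d3 unfolding dx_def partial_def by (rule DERIV_imp_deriv)
  qed
  show ?thesis
    unfolding bosonic_laplacian_def b_def gm_def
    by (rule bosonic_op_expand[OF l]) (simp_all add: d2 d4)
qed

section \<open>The fundamental solution and the representation formula\<close>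

lemma smooth0_measurable: "smooth0 f \<Longrightarrow> f \<in> borel_measurable borel"
  by (rule borel_measurable_continuous_countable_exceptions[of "{0}"]) (auto intro: smooth0_continuous)

lemma integrable_singular:
  fixes f \<psi> :: "real^'n::finite \<Rightarrow> real"
  assumes m: "CARD('n) > 2" and f: "smooth0 f" "homog0 (2 - real CARD('n)) f"
    and \<psi>: "continuous_on UNIV \<psi>" "\<And>a. norm a > R \<Longrightarrow> \<psi> a = 0"
  shows "integrable lborel (\<lambda>a. f a * \<psi> a)"
proof -
  obtain C where C: "C \<ge> 0" "\<And>a. a \<noteq> 0 \<Longrightarrow> \<bar>f a\<bar> \<le> C * norm a powr (2 - real CARD('n))"
    using homog0_bound[OF f] by blast
  obtain B where B: "B \<ge> 0" "\<And>a. \<bar>\<psi> a\<bar> \<le> B"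
    using bounded_compact_support[OF \<psi>] by blast
  let ?R = "max R 1"
  show ?thesis
  proof (rule Bochner_Integration.integrable_bound)
    show "integrable lborel (\<lambda>a :: real^'n. (C * B) * (indicator (cball 0 ?R) a * norm a powr (2 - real CARD('n))))"
      by (intro integrable_mult_right integrable_norm_powr m) auto
    show "(\<lambda>a. f a * \<psi> a) \<in> borel_measurable lborel"
      using smooth0_measurable[OF f(1)] borel_measurable_continuous_onI[OF \<psi>(1)] by simp
    show "AE a in lborel. norm (f a * \<psi> a) \<le> norm ((C * B) * (indicator (cball 0 ?R) a * norm a powr (2 - real CARD('n))))"
      using AE_lborel_singleton[of "0 :: real^'n"]
    proof eventually_elim
      case (elim a)
      show ?case
      proof (cases "norm a \<le> ?R")
        case True
        have "\<bar>f a\<bar> * \<bar>\<psi> a\<bar> \<le> (C * norm a powr (2 - real CARD('n))) * B"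
          using C B elim by (intro mult_mono) auto
        then show ?thesis
          using True B C by (simp add: abs_mult mult_ac)
      next
        case False
        then show ?thesis using \<psi>(2)[of a] by simp
      qed
    qed
  qed
qed

section \<open>Constants and boundary kernels\<close>

definition bcoef :: "'n::finite itself \<Rightarrow> nat \<Rightarrow> real" where
  "bcoef _ k = 4 / (real CARD('n) + 2 * real k - 2)"

definition gcoef :: "'n::finite itself \<Rightarrow> nat \<Rightarrow> real" where
  "gcoef _ k = 1 / (real CARD('n) + 2 * real k - 4)"

text \<open>The reciprocal of the normalising constant. As \<open>avg\<close> of 1 is minus half the
  area of the unit sphere, the value is negative in dimensions above 4.\<close>

definition kap :: "'n::finite itself \<Rightarrow> nat \<Rightarrow> real" where
  "kap _ k = 2 * ((real CARD('n) - 2) * (real CARD('n) - 4) * gcoef TYPE('n) k * avg (\<lambda>a :: real^'n. 1))"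

definition defA :: "nat \<Rightarrow> (real^'n::finite \<Rightarrow> real) \<Rightarrow> real^'n \<Rightarrow> real^'n \<Rightarrow> real" where
  "defA k p v = flux_kernel.K (kerA (bcoef TYPE('n) k) (gcoef TYPE('n) k) p v) (fluxA (gcoef TYPE('n) k) p v)"

definition defB :: "nat \<Rightarrow> (real^'n::finite \<Rightarrow> real) \<Rightarrow> real^'n \<Rightarrow> real^'n \<Rightarrow> real" where
  "defB k p v = flux_kernel.K (kerB (bcoef TYPE('n) k) (gcoef TYPE('n) k) p v) (fluxB (gcoef TYPE('n) k) p v)"

context
  fixes p :: "real^'n::finite \<Rightarrow> real" and k :: nat
  assumes p: "p \<in> harm_poly k" and m: "CARD('n) > 4"
begin

private lemma dm: "real CARD('n) + 2 * real k - 4 > 0"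
  using m by simp

private lemma bc: "bcoef TYPE('n) k * (real CARD('n) + 2 * real k - 2) = 4"
proof -
  have "real CARD('n) + 2 * real k - 2 \<noteq> 0" using dm by linarith
  from nonzero_eq_divide_eq[OF this, THEN iffD1, OF refl] show ?thesis
    unfolding bcoef_def .
qed

private lemma gc: "gcoef TYPE('n) k * (real CARD('n) + 2 * real k - 4) = 1"
  using dm by (simp add: gcoef_def)

private lemmas hyps = harm_poly_euler[OF p] bc gc

lemma flux_kernelA: "flux_kernel (kerA (bcoef TYPE('n) k) (gcoef TYPE('n) k) p v) (fluxA (gcoef TYPE('n) k) p v)"
  by (rule flux_kernel.intro)
    (intro smooth0_kerA[OF hyps] smooth0_fluxA[OF hyps] homog0_kerA[OF hyps] div_kerA[OF hyps] div_fluxA[OF hyps]; assumption)+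

lemma flux_kernelB: "flux_kernel (kerB (bcoef TYPE('n) k) (gcoef TYPE('n) k) p v) (fluxB (gcoef TYPE('n) k) p v)"
  by (rule flux_kernel.intro)
    (intro smooth0_kerB[OF hyps] smooth0_fluxB[OF hyps] homog0_kerB[OF hyps] div_kerB[OF hyps] div_fluxB[OF hyps]; assumption)+

lemma integral_defA: "(LINT z|lborel. defA k p v z) = - kap TYPE('n) k * p v"
  unfolding defA_def
  by (subst flux_kernel.integral_K[OF flux_kernelA flux_fluxA[OF hyps]])
    (simp_all add: avg_flux_density[OF harm_poly_euler[OF p] dm gc] kap_def)

text \<open>The same constant as in \<open>integral_defA\<close>, because the two fluxes share
  \<open>flux_density\<close>.\<close>

lemma integral_defB: "(LINT z|lborel. defB k p v z) = - kap TYPE('n) k * p v"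
  unfolding defB_def
  by (subst flux_kernel.integral_K[OF flux_kernelB flux_fluxB[OF hyps]])
    (simp_all add: avg_flux_density[OF harm_poly_euler[OF p] dm gc] kap_def)

lemma kap_nonzero: "kap TYPE('n) k \<noteq> 0"
  using m dm avg_1_neq_0[where 'n = 'n] by (simp add: kap_def gcoef_def)

end

section \<open>The boundary term at infinity\<close>

text \<open>Shifting the variable by \<open>y\<close> divided by the scale moves the dependence on
  \<open>y\<close> from \<open>G\<close>, of which only boundedness is known, to \<open>K\<close>,
  whose increments tend to zero by continuity.\<close>

lemma integral_translate_limit:
  fixes K G :: "real^'n::finite \<Rightarrow> real"
  assumes K: "continuous_on UNIV K" "\<And>z. norm z > 2 \<Longrightarrow> K z = 0"
    and G: "continuous_on UNIV G" "\<And>x. \<bar>G x\<bar> \<le> B"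
  shows "(\<lambda>n. (LINT z|lborel. G (y + real (Suc n) *\<^sub>R z) * K z) - (LINT z|lborel. G (0 + real (Suc n) *\<^sub>R z) * K z))
    \<longlonglongrightarrow> 0"
proof -
  obtain C where C: "C \<ge> 0" "\<And>z. \<bar>K z\<bar> \<le> C"
    using bounded_compact_support[OF K] by blast
  have B: "B \<ge> 0" using G(2)[of 0] by linarith
  let ?h = "\<lambda>n. (1 / real (Suc n)) *\<^sub>R y"
  have h: "norm (?h n) \<le> norm y" for n
    by (simp add: field_simps)
  have h0: "?h \<longlonglongrightarrow> 0"
    using tendsto_scaleR[OF LIMSEQ_inverse_real_of_nat tendsto_const[of y]] by (simp add: inverse_eq_divide)
  have cG: "continuous_on UNIV (\<lambda>z. G (c + r *\<^sub>R z))" for c r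
    by (intro continuous_on_compose2[OF G(1)] continuous_intros) auto
  have cK: "continuous_on UNIV (\<lambda>z. K (z - c))" for c
    by (intro continuous_on_compose2[OF K(1)] continuous_intros) auto
  have K0: "K (z - ?h n) = 0" if "norm z > 2 + norm y" for z n
  proof (rule K(2))
    show "norm (z - ?h n) > 2"
      using norm_triangle_ineq2[of z "?h n"] h[of n] that by linarith
  qed
  have eq: "(LINT z|lborel. G (y + real (Suc n) *\<^sub>R z) * K z) - (LINT z|lborel. G (0 + real (Suc n) *\<^sub>R z) * K z)
      = (LINT z|lborel. G (real (Suc n) *\<^sub>R z) * (K (z - ?h n) - K z))" for n
  proof -
    have "(LINT z|lborel. G (y + real (Suc n) *\<^sub>R z) * K z) =
        (LINT z|lborel. G (y + real (Suc n) *\<^sub>R (- ?h n + z)) * K (- ?h n + z))"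
      by (rule lborel_integral_translate[symmetric])
        (intro borel_measurable_continuous_onI continuous_on_mult cG K(1))
    also have "\<dots> = (LINT z|lborel. G (0 + real (Suc n) *\<^sub>R z) * K (z - ?h n))"
    proof -
      have "y + real (Suc n) *\<^sub>R (- ?h n + z) = 0 + real (Suc n) *\<^sub>R z" for z
        by (simp add: scaleR_diff_right del: of_nat_Suc)
      moreover have "- ?h n + z = z - ?h n" for z by simp
      ultimately show ?thesis by (simp only:)
    qed
    finally have 1: "(LINT z|lborel. G (y + real (Suc n) *\<^sub>R z) * K z) = \<dots>" .
    have "integrable lborel (\<lambda>z. G (0 + real (Suc n) *\<^sub>R z) * K (z - ?h n))"
      by (rule integrable_compact_support[where R = "2 + norm y"])
        (use K0 in \<open>auto intro!: continuous_on_mult cG cK simp del: of_nat_Suc add_0_left\<close>)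
    moreover have "integrable lborel (\<lambda>z. G (0 + real (Suc n) *\<^sub>R z) * K z)"
      by (rule integrable_compact_support[where R = 2])
        (use K in \<open>auto intro!: continuous_on_mult cG simp del: of_nat_Suc add_0_left\<close>)
    ultimately show ?thesis
      unfolding 1 by (simp add: right_diff_distrib del: of_nat_Suc)
  qed
  have "(\<lambda>n. LINT z|lborel. G (real (Suc n) *\<^sub>R z) * (K (z - ?h n) - K z)) \<longlonglongrightarrow> (LINT z :: real^'n|lborel. 0)"
  proof (rule integral_dominated_convergence)
    show "integrable lborel (\<lambda>z :: real^'n. indicator (cball 0 (2 + norm y)) z *\<^sub>R (B * (2 * C)))"
      by (rule borel_integrable_compact) auto
    show "AE z in lborel. norm (G (real (Suc n) *\<^sub>R z) * (K (z - ?h n) - K z))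
        \<le> indicator (cball 0 (2 + norm y)) z *\<^sub>R (B * (2 * C))" for n
    proof (rule AE_I2)
      fix z
      show "norm (G (real (Suc n) *\<^sub>R z) * (K (z - ?h n) - K z)) \<le> indicator (cball 0 (2 + norm y)) z *\<^sub>R (B * (2 * C))"
      proof (cases "norm z \<le> 2 + norm y")
        case True
        have "\<bar>K (z - ?h n) - K z\<bar> \<le> 2 * C"
          using C(2)[of "z - ?h n"] C(2)[of z] by linarith
        then have "\<bar>G (real (Suc n) *\<^sub>R z)\<bar> * \<bar>K (z - ?h n) - K z\<bar> \<le> B * (2 * C)"
          using G(2) B by (intro mult_mono) auto
        then show ?thesis using True by (simp add: abs_mult)
      next
        case False
        then have "K z = 0" "K (z - ?h n) = 0"
          using K(2)[of z] K0[of z n] norm_ge_zero[of y] by auto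
        then show ?thesis using False by simp
      qed
    qed
    show "AE z in lborel. (\<lambda>n. G (real (Suc n) *\<^sub>R z) * (K (z - ?h n) - K z)) \<longlonglongrightarrow> 0"
    proof (rule AE_I2)
      fix z
      have "(\<lambda>n. K (z - ?h n)) \<longlonglongrightarrow> K (z - 0)"
        by (rule continuous_on_tendsto_compose[OF K(1) tendsto_diff[OF tendsto_const h0]]) auto
      then have "(\<lambda>n. K (z - ?h n) - K z) \<longlonglongrightarrow> 0"
        using tendsto_diff[OF _ tendsto_const[of "K z"]] by fastforce
      \<comment> \<open>The values of \<open>G\<close> need not converge; a bounded factor times a
        null sequence suffices.\<close>
      moreover have "Bfun (\<lambda>n. G (real (Suc n) *\<^sub>R z)) sequentially"
        by (rule BfunI[of _ B]) (use G(2) in auto)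
      ultimately show "(\<lambda>n. G (real (Suc n) *\<^sub>R z) * (K (z - ?h n) - K z)) \<longlonglongrightarrow> 0"
        using bounded_bilinear.Bfun_prod_Zfun[OF bounded_bilinear_mult] by (simp add: tendsto_Zfun_iff)
    qed
    show "(\<lambda>z. G (real (Suc n) *\<^sub>R z) * (K (z - ?h n) - K z)) \<in> borel_measurable lborel" for n
    proof -
      have "continuous_on UNIV (\<lambda>z. G (0 + real (Suc n) *\<^sub>R z) * (K (z - ?h n) - K z))"
        by (intro continuous_on_mult continuous_on_diff cG cK K(1))
      then show ?thesis
        by (simp add: borel_measurable_continuous_onI del: of_nat_Suc)
    qed
  qed simp
  then show ?thesis unfolding eq by simp
qed

lemma C2c_harm_support:
  fixes f :: "real^'n::finite \<Rightarrow> real^'n \<Rightarrow> real"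
  assumes "f \<in> C2c_harm k"
  obtains r where "r > 0" "\<And>x u. norm x > r \<Longrightarrow> f x u = 0"
proof -
  let ?S = "{x. \<exists>u\<in>ball 0 1. f x u \<noteq> 0}"
  have "bounded (closure ?S)"
    using assms by (intro compact_imp_bounded) (simp add: C2c_harm_def)
  then obtain r where r: "r > 0" "\<forall>x\<in>closure ?S. norm x \<le> r"
    by (auto simp: bounded_pos)
  have "f x u = 0" if "norm x > r" for x u
  proof -
    have "x \<notin> ?S"
      using r that closure_subset[of ?S] by force
    then have "f x = (\<lambda>u. 0)"
      using assms by (intro harm_poly_eq_0[of "f x" k]) (auto simp: C2c_harm_def C2_harm_def)
    then show ?thesis by simp
  qed
  with r(1) show ?thesis by (rule that)
qed

section \<open>The potential of the data\<close>

text \<open>The double integral of the theorem without its constant, after the sphere integral has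
  been evaluated and \<open>x\<close> replaced by \<open>y + a\<close>.\<close>

definition potential :: "(real^'n::finite \<Rightarrow> real^'n \<Rightarrow> real) \<Rightarrow> real^'n \<Rightarrow> real^'n \<Rightarrow> real" where
  "potential f y v = (LINT a|lborel. norm a powr (2 - real CARD('n)) * f (y + a) (tilt 2 v a))"

text \<open>For \<open>R\<close> this large the cutoff equals 1 wherever the integrand is nonzero,
  so it may be inserted freely and \<open>green_ball\<close> applies to each coefficient of
  \<open>g\<close>.\<close>

lemma potential_representation:
  fixes f g :: "real^'n::finite \<Rightarrow> real^'n \<Rightarrow> real" and l :: "nat \<Rightarrow> real^'n \<Rightarrow> real"
  assumes m: "CARD('n) > 4" and g: "g \<in> C2_harm UNIV k"
    and eq: "\<And>x u. u \<in> ball 0 1 \<Longrightarrow> bosonic_laplacian k g x u = f x u"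
    and f: "\<And>x u. norm x > r \<Longrightarrow> f x u = 0"
    and u: "\<And>s. u s \<in> ball 0 1" and l: "\<And>s. l s \<in> harm_poly k"
    and ul: "\<And>p x. p \<in> harm_poly k \<Longrightarrow> p x = (\<Sum>s<N. p (u s) * l s x)"
    and v: "v \<in> ball 0 1" and R: "R > r + norm y" "R > 0"
  shows "potential f y v = (\<Sum>s<N. (LINT z|lborel. g (y + R *\<^sub>R z) (u s) * defA k (l s) v z)) + kap TYPE('n) k * g y v"
proof -
  let ?G1 = "\<lambda>s j. partial j (\<lambda>x. g x (u s))" and ?G2 = "\<lambda>s i j. partial i (partial j (\<lambda>x. g x (u s)))"
  let ?M = "\<lambda>s. kerA (bcoef TYPE('n) k) (gcoef TYPE('n) k) (l s) v"
  have C2: "C2 (\<lambda>x. g x (u s)) (?G1 s) (?G2 s)" for s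
    by (rule C2_harm_slice[OF g u])
  have gx: "g x \<in> harm_poly k" for x
    using g by (simp add: C2_harm_def)
  have gexp: "g x w = (\<Sum>s<N. g x (u s) * l s w)" for x w
    by (rule ul[OF gx])
  have fk: "flux_kernel (?M s) (fluxA (gcoef TYPE('n) k) (l s) v)" for s
    by (rule flux_kernelA[OF l m])
  define S where "S s a = (\<Sum>i\<in>UNIV. \<Sum>j\<in>UNIV. ?M s i j a * ?G2 s i j (y + a))" for s a
  \<comment> \<open>The equation is used at the reflected vector, which stays in the ball and has
    the length of \<open>v\<close>; the expansion of the operator there is
    \<open>kerA\<close>.\<close>
  have pt: "norm a powr (2 - real CARD('n)) * f (y + a) (tilt 2 v a) = (\<Sum>s<N. S s a)" for a
  proof -
    let ?w = "tilt 2 v a"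
    have w: "?w \<in> ball 0 1" using v by (simp add: norm_tilt)
    have ww: "?w \<bullet> ?w = v \<bullet> v" by (simp add: dot_square_norm norm_tilt)
    have "f (y + a) ?w = (\<Sum>s<N. \<Sum>i\<in>UNIV. \<Sum>j\<in>UNIV. ?G2 s i j (y + a) *
      ((if i = j then l s ?w else 0) - bcoef TYPE('n) k * (?w $ i * partial j (l s) ?w
        - gcoef TYPE('n) k * (v \<bullet> v) * partial i (partial j (l s)) ?w)))"
      unfolding eq[OF w, symmetric] bcoef_def gcoef_def ww[symmetric]
      by (rule bosonic_laplacian_expand[OF harm_poly_poly[OF l] gexp C2])
    then show ?thesis
      by (simp add: S_def kerA_def sum_distrib_left mult_ac)
  qed
  have cR: "cutoff (a /\<^sub>R R) * (norm a powr (2 - real CARD('n)) * f (y + a) (tilt 2 v a)) =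
      norm a powr (2 - real CARD('n)) * f (y + a) (tilt 2 v a)" for a
  proof (cases "norm a < R")
    case True
    then have "norm (a /\<^sub>R R) < 1" using R by (simp add: field_simps)
    then show ?thesis by (simp add: cutoff_small)
  next
    case False
    have "norm a \<le> norm (y + a) + norm y"
      using norm_triangle_ineq4[of "y + a" y] by simp
    then have "norm (y + a) > r" using False R by linarith
    then show ?thesis by (simp add: f)
  qed
  have iS: "integrable lborel (\<lambda>a. cutoff (a /\<^sub>R R) * S s a)" for s
  proof -
    have "integrable lborel (\<lambda>a. ?M s i j a * (cutoff (a /\<^sub>R R) * ?G2 s i j (y + a)))" for i j
    proof (rule integrable_singular[where R = "2 * R"])
      show "smooth0 (?M s i j)" by (rule flux_kernel.smooth_M[OF fk])
      show "homog0 (2 - real CARD('n)) (?M s i j)" by (rule flux_kernel.homog_M[OF fk])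
      show "continuous_on UNIV (\<lambda>a. cutoff (a /\<^sub>R R) * ?G2 s i j (y + a))"
        by (intro continuous_on_mult C2_continuous(3)[OF C2_translate[OF C2]]
            continuous_on_compose2[OF C2_continuous(1)[OF C2_cutoff]] continuous_intros) auto
      fix a :: "real^'n" assume "norm a > 2 * R"
      then have "norm (a /\<^sub>R R) > 2" using R by (simp add: field_simps)
      then show "cutoff (a /\<^sub>R R) * ?G2 s i j (y + a) = 0" by (simp add: cutoff_large)
    qed (use m in simp)
    then have "integrable lborel (\<lambda>a. \<Sum>i\<in>UNIV. \<Sum>j\<in>UNIV. ?M s i j a * (cutoff (a /\<^sub>R R) * ?G2 s i j (y + a)))"
      by (intro Bochner_Integration.integrable_sum)
    then show ?thesis
      by (simp add: S_def sum_distrib_left mult_ac)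
  qed
  have "potential f y v = (LINT a|lborel. (\<Sum>s<N. cutoff (a /\<^sub>R R) * S s a))"
    unfolding potential_def sum_distrib_left[symmetric] pt[symmetric] cR ..
  also have "\<dots> = (\<Sum>s<N. (LINT a|lborel. cutoff (a /\<^sub>R R) * S s a))"
    by (rule Bochner_Integration.integral_sum) (rule iS)
  also have "\<dots> = (\<Sum>s<N. (LINT z|lborel. g (y + R *\<^sub>R z) (u s) * defA k (l s) v z)
      - g y (u s) * (LINT z|lborel. defA k (l s) v z))"
    unfolding S_def defA_def
    by (intro sum.cong refl flux_kernel.green_ball[OF fk C2 R(2)]) (use m in simp)
  also have "\<dots> = (\<Sum>s<N. (LINT z|lborel. g (y + R *\<^sub>R z) (u s) * defA k (l s) v z)) + kap TYPE('n) k * g y v"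
    unfolding integral_defA[OF l m] by (subst gexp[of y v]) (simp add: sum_subtractf sum.distrib sum_distrib_left mult_ac)
  finally show ?thesis .
qed

text \<open>Subtracting \<open>potential_representation\<close> at \<open>0\<close> from the one at
  \<open>y\<close> leaves a difference of outer terms. It does not depend on the scale once that is
  large, yet it tends to zero by \<open>integral_translate_limit\<close>.\<close>

lemma liouville:
  fixes f g :: "real^'n::finite \<Rightarrow> real^'n \<Rightarrow> real"
  assumes m: "CARD('n) > 4" and g: "g \<in> C2_harm UNIV k"
    and bdd: "bounded ((\<lambda>(x, u). g x u) ` (UNIV \<times> ball 0 1))"
    and eq: "\<And>x u. u \<in> ball 0 1 \<Longrightarrow> bosonic_laplacian k g x u = f x u"
    and f: "\<And>x u. norm x > r \<Longrightarrow> f x u = 0"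
    and v: "v \<in> ball 0 1"
  shows "potential f y v - kap TYPE('n) k * g y v = potential f 0 v - kap TYPE('n) k * g 0 v"
proof -
  obtain N :: nat and u :: "nat \<Rightarrow> real^'n" and l where u: "\<And>s. u s \<in> ball 0 1" and l: "\<And>s. l s \<in> harm_poly k"
    and ul: "\<And>p x. p \<in> harm_poly k \<Longrightarrow> p x = (\<Sum>s<N. p (u s) * l s x)"
    by (rule harm_poly_interpolation[where k = k]) (rule that, assumption+)
  obtain B where B: "\<And>x w. w \<in> ball 0 1 \<Longrightarrow> \<bar>g x w\<bar> \<le> B"
    using bdd by (force simp: bounded_iff)
  let ?E = "\<lambda>n y. (\<Sum>s<N. (LINT z|lborel. g (y + real (Suc n) *\<^sub>R z) (u s) * defA k (l s) v z))"
  have fk: "flux_kernel (kerA (bcoef TYPE('n) k) (gcoef TYPE('n) k) (l s) v) (fluxA (gcoef TYPE('n) k) (l s) v)" for s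
    by (rule flux_kernelA[OF l m])
  have "(\<lambda>n. (\<Sum>s<N. (LINT z|lborel. g (y + real (Suc n) *\<^sub>R z) (u s) * defA k (l s) v z)
      - (LINT z|lborel. g (0 + real (Suc n) *\<^sub>R z) (u s) * defA k (l s) v z))) \<longlonglongrightarrow> (\<Sum>s<N. 0)"
  proof (rule tendsto_sum, rule integral_translate_limit)
    show "continuous_on UNIV (defA k (l s) v)" for s
      unfolding defA_def by (rule flux_kernel.continuous_K[OF fk])
    show "norm z > 2 \<Longrightarrow> defA k (l s) v z = 0" for s z
      unfolding defA_def by (rule flux_kernel.K_large[OF fk])
    show "continuous_on UNIV (\<lambda>x. g x (u s))" for s
      by (rule C2_continuous(1)[OF C2_harm_slice[OF g u]])
    show "\<bar>g x (u s)\<bar> \<le> B" for s x by (rule B[OF u])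
  qed
  then have lim: "(\<lambda>n. ?E n y - ?E n 0) \<longlonglongrightarrow> 0"
    by (simp add: sum_subtractf del: of_nat_Suc)
  let ?D = "\<lambda>y. potential f y v - kap TYPE('n) k * g y v"
  obtain n0 :: nat where n0: "real n0 > \<bar>r\<bar> + norm y"
    using reals_Archimedean2 by blast
  have "\<forall>\<^sub>F n in sequentially. ?E n y - ?E n 0 = ?D y - ?D 0"
  proof (rule eventually_sequentiallyI[of n0])
    fix n assume "n \<ge> n0"
    then have n: "real (Suc n) > \<bar>r\<bar> + norm y" using n0 by simp
    have "real (Suc n) > r + norm y" using n by linarith
    moreover have "real (Suc n) > r + norm (0 :: real^'n)"
      using n norm_ge_zero[of y] unfolding norm_zero by linarith
    ultimately have
      "potential f y v = ?E n y + kap TYPE('n) k * g y v" "potential f 0 v = ?E n 0 + kap TYPE('n) k * g 0 v"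
      by (intro potential_representation[OF m g eq f u l ul v]; simp)+
    then show "?E n y - ?E n 0 = ?D y - ?D 0" by simp
  qed
  then have "(\<lambda>n. ?E n y - ?E n 0) \<longlonglongrightarrow> ?D y - ?D 0"
    by (rule tendsto_eventually)
  from LIMSEQ_unique[OF this lim] show ?thesis by simp
qed

text \<open>Interpolating twice, first \<open>f\<close> and then each reflected \<open>l s\<close>,
  separates \<open>v\<close> from \<open>a\<close>; the potential becomes a finite combination of
  the \<open>l t\<close> with integrals as coefficients.\<close>

lemma potential_harm_poly:
  fixes f :: "real^'n::finite \<Rightarrow> real^'n \<Rightarrow> real"
  assumes m: "CARD('n) > 4" and f: "f \<in> C2c_harm k"
  shows "potential f y \<in> harm_poly k"
proof -
  obtain N :: nat and u :: "nat \<Rightarrow> real^'n" and l where u: "\<And>s. u s \<in> ball 0 1" and l: "\<And>s. l s \<in> harm_poly k"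
    and ul: "\<And>p x. p \<in> harm_poly k \<Longrightarrow> p x = (\<Sum>s<N. p (u s) * l s x)"
    by (rule harm_poly_interpolation[where k = k]) (rule that, assumption+)
  obtain r where r: "r > 0" "\<And>x u. norm x > r \<Longrightarrow> f x u = 0"
    using C2c_harm_support[OF f] by blast
  have f2: "f \<in> C2_harm UNIV k" and fx: "f x \<in> harm_poly k" for x
    using f by (auto simp: C2c_harm_def C2_harm_def)
  let ?F = "\<lambda>s t a. (norm a powr (2 - real CARD('n)) * l s (tilt 2 (u t) a)) * f (y + a) (u s)"
  have i: "integrable lborel (?F s t)" for s t
  proof (rule integrable_singular[where R = "r + norm y"])
    show "smooth0 (\<lambda>a. norm a powr (2 - real CARD('n)) * l s (tilt 2 (u t) a))"
      by (intro smooth0_mult smooth0_powr smooth0_tilt harm_poly_poly[OF l])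
    show "homog0 (2 - real CARD('n)) (\<lambda>a. norm a powr (2 - real CARD('n)) * l s (tilt 2 (u t) a))"
      using homog0_mult[OF homog0_powr homog0_tilt] by simp
    show "continuous_on UNIV (\<lambda>a. f (y + a) (u s))"
      by (rule C2_continuous(1)[OF C2_translate[OF C2_harm_slice[OF f2 u]]])
    fix a :: "real^'n" assume "norm a > r + norm y"
    moreover have "norm a \<le> norm (y + a) + norm y"
      using norm_triangle_ineq4[of "y + a" y] by simp
    ultimately show "f (y + a) (u s) = 0" by (intro r(2)) linarith
  qed (use m in simp)
  have pt: "norm a powr (2 - real CARD('n)) * f (y + a) (tilt 2 v a) = (\<Sum>t<N. \<Sum>s<N. ?F s t a * l t v)" for a v
  proof -
    have "f (y + a) (tilt 2 v a) = (\<Sum>s<N. f (y + a) (u s) * l s (tilt 2 v a))"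
      by (rule ul[OF fx])
    also have "\<dots> = (\<Sum>s<N. f (y + a) (u s) * (\<Sum>t<N. l s (tilt 2 (u t) a) * l t v))"
    proof (rule sum.cong[OF refl])
      fix s
      show "f (y + a) (u s) * l s (tilt 2 v a) = f (y + a) (u s) * (\<Sum>t<N. l s (tilt 2 (u t) a) * l t v)"
        using ul[OF harm_poly_reflect[OF l[of s], of a], of v] by (simp only:)
    qed
    also have "\<dots> = (\<Sum>t<N. \<Sum>s<N. f (y + a) (u s) * (l s (tilt 2 (u t) a) * l t v))"
      by (simp only: sum_distrib_left) (rule sum.swap)
    finally show ?thesis by (simp add: sum_distrib_left mult_ac)
  qed
  have "potential f y v = (\<Sum>t<N. (\<Sum>s<N. (LINT a|lborel. ?F s t a)) * l t v)" for v
    unfolding potential_def pt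
    by (simp add: Bochner_Integration.integral_sum i sum_distrib_right)
  then have "potential f y = (\<lambda>v. \<Sum>t<N. (\<Sum>s<N. (LINT a|lborel. ?F s t a)) * l t v)" by blast
  then show ?thesis
    using lsubspace_sum[OF lsubspace_harm_poly, of "{..<N}" l k "\<lambda>t. \<Sum>s<N. (LINT a|lborel. ?F s t a)"] l by simp
qed

section \<open>The distributional equation and the normalising constant\<close>

lemma compact_support_bound:
  fixes \<phi> :: "'a::euclidean_space \<Rightarrow> real"
  assumes "compact (closure {x. \<phi> x \<noteq> 0})"
  obtains r where "r > 0" "\<And>x. norm x > r \<Longrightarrow> \<phi> x = 0"
proof -
  obtain r where r: "r > 0" "\<forall>x\<in>closure {x. \<phi> x \<noteq> 0}. norm x \<le> r"
    using compact_imp_bounded[OF assms] by (auto simp: bounded_pos)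
  show ?thesis
  proof (rule that[OF r(1)])
    fix x :: 'a assume "norm x > r"
    then have "x \<notin> {x. \<phi> x \<noteq> 0}"
      using r(2) closure_subset[of "{x. \<phi> x \<noteq> 0}"] by force
    then show "\<phi> x = 0" by simp
  qed
qed

lemma tilt_minus: "tilt t v (- a) = tilt t v a"
  by (simp add: tilt_def)

text \<open>The kernel is stated with \<open>y - x\<close>, the potential with
  \<open>a = x - y\<close>; the sign is immaterial because norm and reflection are even in
  \<open>a\<close>.\<close>

lemma integral_unnormalized_kernel:
  fixes \<psi> :: "real^'n::finite \<Rightarrow> real"
  assumes "\<psi> \<in> borel_measurable borel"
  shows "(LINT x|lborel. c * unnormalized_kernel k x y u v * \<psi> x) =
    (LINT a|lborel. c * ((norm a powr (2 - real CARD('n)) * repr_kernel k (tilt 2 u a) v) * \<psi> (y + a)))"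
proof -
  let ?F = "\<lambda>a. c * ((norm a powr (2 - real CARD('n)) * repr_kernel k (tilt 2 u a) v) * \<psi> (y + a))"
  have "smooth0 (\<lambda>a. norm a powr (2 - real CARD('n)) * repr_kernel k (tilt 2 u a) v)"
    using smooth0_mult[OF smooth0_powr smooth0_tilt[OF harm_poly_poly[OF repr_kernel_harm]]] .
  from smooth0_measurable[OF this]
  have m: "?F \<in> borel_measurable borel"
    using measurable_compose[OF _ assms, of "\<lambda>a. y + a" borel] by simp
  have "c * unnormalized_kernel k x y u v * \<psi> x = ?F (- y + x)" for x
  proof -
    have "norm (y - x) = norm (- y + x)"
      using norm_minus_commute[of y x] by simp
    moreover have "clifford_reflect (y - x) u = tilt 2 u (- y + x)"
      using tilt_minus[of 2 u "- y + x"] by (simp add: tilt_2)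
    ultimately show ?thesis
      by (simp add: unnormalized_kernel_def mult_ac)
  qed
  then have "(LINT x|lborel. c * unnormalized_kernel k x y u v * \<psi> x) = (LINT x|lborel. ?F (- y + x))"
    by (simp only:)
  also have "\<dots> = (LINT a|lborel. ?F a)"
    by (rule lborel_integral_translate[OF m])
  finally show ?thesis .
qed

text \<open>Interpolation of the reflected kernel in \<open>u\<close> makes the distribution a
  finite sum in which the operator acts on the \<open>l s\<close> only. Resumming afterwards yields
  the operator on the reflected kernel, that is \<open>kerB\<close>, and \<open>green_ball\<close>
  concentrates it at \<open>y\<close>.\<close>

lemma bosonic_laplacian_distr_kernel:
  fixes y u v :: "real^'n::finite"
  assumes m: "CARD('n) > 4" and \<phi>: "\<phi> \<in> test_functions"
  shows "bosonic_laplacian_distr k (\<lambda>\<psi> u. LINT x|lborel. c * unnormalized_kernel k x y u v * \<psi> x) \<phi> u =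
    c * kap TYPE('n) k * (\<phi> y * repr_kernel k u v)"
proof -
  let ?m = "real CARD('n)"
  let ?T = "\<lambda>\<psi> u. LINT x|lborel. c * unnormalized_kernel k x y u v * \<psi> x"
  let ?P = "\<lambda>u. repr_kernel k u v"
  let ?\<phi>2 = "\<lambda>i j. partial i (partial j \<phi>)"
  have P: "?P \<in> harm_poly k" by (rule repr_kernel_harm)
  obtain N :: nat and w :: "nat \<Rightarrow> real^'n" and l where l: "\<And>s. l s \<in> harm_poly k"
    and wl: "\<And>p x. p \<in> harm_poly k \<Longrightarrow> p x = (\<Sum>s<N. p (w s) * l s x)"
    by (rule harm_poly_interpolation[where k = k]) (rule that, assumption+)
  note lp = harm_poly_poly[OF l]
  obtain r where r: "r > 0" "\<And>x. norm x > r \<Longrightarrow> \<phi> x = 0"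
    using compact_support_bound[of \<phi>] \<phi> by (auto simp: test_functions_def)
  have C2: "C2 \<phi> (\<lambda>j. partial j \<phi>) ?\<phi>2" by (rule C2_test_function[OF \<phi>])
  have hp: "has_partial j \<phi> (partial j \<phi>)" "has_partial i (partial j \<phi>) (?\<phi>2 i j)" for i j
    using C2 by (auto simp: C2_def)
  have z2: "?\<phi>2 i j x = 0" if "norm x > r" for i j x
    using has_partial_zero[OF hp(2) has_partial_zero[OF hp(1) r(2)] that] .
  have cont2: "continuous_on UNIV (?\<phi>2 i j)" for i j
    by (rule C2_continuous(3)[OF C2])
  let ?q = "\<lambda>s a. norm a powr (2 - ?m) * ?P (tilt 2 (w s) a)"
  have int: "integrable lborel (\<lambda>a. f a * ?\<phi>2 i j (y + a))"
    if "smooth0 f" "homog0 (2 - ?m) f" for f i j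
  proof (rule integrable_singular[OF _ that, where R = "r + norm y"])
    show "continuous_on UNIV (\<lambda>a. ?\<phi>2 i j (y + a))"
      by (rule C2_continuous(3)[OF C2_translate[OF C2]])
    fix a :: "real^'n" assume "norm a > r + norm y"
    moreover have "norm a \<le> norm (y + a) + norm y"
      using norm_triangle_ineq4[of "y + a" y] by simp
    ultimately show "?\<phi>2 i j (y + a) = 0" by (intro z2) linarith
  qed (use m in simp)
  have iq: "integrable lborel (\<lambda>a. ?q s a * ?\<phi>2 i j (y + a))" for s i j
    using homog0_mult[OF homog0_powr homog0_tilt, of "2 - ?m" ?P 2 "w s"]
    by (intro int smooth0_mult smooth0_powr smooth0_tilt harm_poly_poly[OF P]) simp
  \<comment> \<open>The indices are exchanged because two transposed derivatives act on the test
    function in reverse order.\<close>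
  define C where "C s i j = c * (LINT a|lborel. ?q s a * ?\<phi>2 j i (y + a))" for s i j
  have T: "?T (?\<phi>2 j i) u = (\<Sum>s<N. C s i j * l s u)" for i j u
  proof -
    have "?T (?\<phi>2 j i) u = (LINT a|lborel. c * ((norm a powr (2 - ?m) * ?P (tilt 2 u a)) * ?\<phi>2 j i (y + a)))"
      by (rule integral_unnormalized_kernel[OF borel_measurable_continuous_onI[OF cont2]])
    also have "\<dots> = (LINT a|lborel. (\<Sum>s<N. (c * l s u) * (?q s a * ?\<phi>2 j i (y + a))))"
    proof (rule arg_cong[where f = "integral\<^sup>L lborel"], rule ext)
      fix a
      have e: "?P (tilt 2 u a) = (\<Sum>s<N. ?P (tilt 2 (w s) a) * l s u)"
        by (rule wl[OF harm_poly_reflect[OF P]])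
      show "c * ((norm a powr (2 - ?m) * ?P (tilt 2 u a)) * ?\<phi>2 j i (y + a)) =
          (\<Sum>s<N. (c * l s u) * (?q s a * ?\<phi>2 j i (y + a)))"
        unfolding e by (simp add: sum_distrib_left sum_distrib_right mult_ac)
    qed
    also have "\<dots> = (\<Sum>s<N. (c * l s u) * (LINT a|lborel. ?q s a * ?\<phi>2 j i (y + a)))"
      by (subst Bochner_Integration.integral_sum) (use iq in auto)
    finally show ?thesis by (simp add: C_def mult_ac)
  qed
  let ?A = "\<lambda>s i j. (if i = j then l s u else 0) - bcoef TYPE('n) k * (u $ i * partial j (l s) u
      - gcoef TYPE('n) k * (u \<bullet> u) * partial i (partial j (l s)) u)"
  have "bosonic_laplacian_distr k ?T \<phi> u = (\<Sum>s<N. \<Sum>i\<in>UNIV. \<Sum>j\<in>UNIV. C s i j * ?A s i j)"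
    unfolding bosonic_laplacian_distr_def bcoef_def gcoef_def
  proof (rule bosonic_op_expand[OF lp])
    show "dx_distr j (dx_distr j ?T) \<phi> u = (\<Sum>s<N. C s j j * l s u)" for j u
      unfolding dx_distr_def minus_minus by (rule T)
    show "dx_distr i (Du_Dx dx_distr ?T) \<phi> u = (\<Sum>j\<in>UNIV. \<Sum>s<N. C s i j * partial j (l s) u)" for i u
    proof -
      have pm: "partial j (\<lambda>u. - (\<Sum>s<N. C s i j * l s u)) u = - (\<Sum>s<N. C s i j * partial j (l s) u)" for j
      proof -
        have pol: "real_polynomial_function (\<lambda>u. \<Sum>s<N. C s i j * l s u)"
          by (intro real_polynomial_function_sum real_polynomial_function.intros(2,4) lp) simp
        show ?thesis
          using partial_cmult[OF pol, of j "-1"]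
          by (simp add: partial_sum_poly real_polynomial_function.intros(2,4) lp partial_cmult fun_eq_iff)
      qed
      have "dx_distr i (Du_Dx dx_distr ?T) \<phi> u = - (\<Sum>j\<in>UNIV. partial j (\<lambda>u. - ?T (?\<phi>2 j i) u) u)"
        unfolding dx_distr_def Du_Dx_def du_def ..
      also have "\<dots> = (\<Sum>j\<in>UNIV. \<Sum>s<N. C s i j * partial j (l s) u)"
        unfolding T pm by (simp add: sum_negf)
      finally show ?thesis .
    qed
  qed
  also have "\<dots> = (\<Sum>i\<in>UNIV. \<Sum>j\<in>UNIV. \<Sum>s<N. C s i j * ?A s i j)"
    by (simp add: sum.swap[of _ "{..<N}"])
  also have "\<dots> = (\<Sum>i\<in>UNIV. \<Sum>j\<in>UNIV. c * (LINT a|lborel.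
      kerB (bcoef TYPE('n) k) (gcoef TYPE('n) k) ?P u j i a * ?\<phi>2 j i (y + a)))"
  proof (intro sum.cong refl)
    fix i j
    have "(\<Sum>s<N. C s i j * ?A s i j) = (\<Sum>s<N. (LINT a|lborel. (c * ?A s i j) * (?q s a * ?\<phi>2 j i (y + a))))"
      unfolding integral_mult_right_zero C_def by (simp only: mult_ac)
    also have "\<dots> = (LINT a|lborel. (\<Sum>s<N. (c * ?A s i j) * (?q s a * ?\<phi>2 j i (y + a))))"
      by (rule Bochner_Integration.integral_sum[symmetric]) (use iq in auto)
    also have "(\<lambda>a. \<Sum>s<N. (c * ?A s i j) * (?q s a * ?\<phi>2 j i (y + a))) =
        (\<lambda>a. c * (kerB (bcoef TYPE('n) k) (gcoef TYPE('n) k) ?P u j i a * ?\<phi>2 j i (y + a)))"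
    proof
      fix a
      let ?Q = "\<lambda>u. ?P (tilt 2 u a)"
      have Q: "?Q \<in> harm_poly k" by (rule harm_poly_reflect[OF P])
      have Qe: "?Q = (\<lambda>u. \<Sum>s<N. ?Q (w s) * l s u)"
        by (rule ext) (rule wl[OF Q])
      have Q0: "?Q u = (\<Sum>s<N. ?Q (w s) * l s u)" by (rule wl[OF Q])
      have Q1: "partial j ?Q = (\<lambda>u. \<Sum>s<N. ?Q (w s) * partial j (l s) u)" for j
        by (subst Qe) (simp add: partial_sum_poly real_polynomial_function.intros(2,4) lp partial_cmult)
      have Q2: "partial i (partial j ?Q) = (\<lambda>u. \<Sum>s<N. ?Q (w s) * partial i (partial j (l s)) u)" for i j
        unfolding Q1
        by (simp add: partial_sum_poly real_polynomial_function.intros(2,4) real_polynomial_function_grad(2)[OF lp] partial_cmult)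
      have "(\<Sum>s<N. ?Q (w s) * ?A s i j) = (if i = j then ?Q u else 0)
          - bcoef TYPE('n) k * (u $ i * partial j ?Q u - gcoef TYPE('n) k * (u \<bullet> u) * partial i (partial j ?Q) u)"
        unfolding Q2 unfolding Q1 unfolding Q0
        by (simp add: sum_subtractf sum_distrib_left right_diff_distrib mult_ac)
      also have "partial i (partial j ?Q) u = partial j (partial i ?P) (tilt 2 u a)
          - 2 * a $ j * D1 (partial i ?P) (tilt 2 u a) a / (a \<bullet> a)
          - 2 * a $ i * D1 (partial j ?P) (tilt 2 u a) a / (a \<bullet> a)
          + 4 * a $ j * a $ i * D2 ?P (tilt 2 u a) a / (a \<bullet> a)\<^sup>2"
        by (rule partial_partial_reflect[OF harm_poly_poly[OF P]])
      also have "partial j ?Q u = partial j ?P (tilt 2 u a) - 2 * a $ j * D1 ?P (tilt 2 u a) a / (a \<bullet> a)"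
        by (rule partial_reflect[OF harm_poly_poly[OF P]])
      finally have e: "norm a powr (2 - ?m) * (\<Sum>s<N. ?Q (w s) * ?A s i j) =
          kerB (bcoef TYPE('n) k) (gcoef TYPE('n) k) ?P u j i a"
        unfolding kerB_def by (simp add: eq_commute[of i j])
      show "(\<Sum>s<N. (c * ?A s i j) * (?q s a * ?\<phi>2 j i (y + a))) =
          c * (kerB (bcoef TYPE('n) k) (gcoef TYPE('n) k) ?P u j i a * ?\<phi>2 j i (y + a))"
        unfolding e[symmetric] by (simp only: sum_distrib_left sum_distrib_right mult_ac)
    qed
    finally show "(\<Sum>s<N. C s i j * ?A s i j) = c * (LINT a|lborel.
      kerB (bcoef TYPE('n) k) (gcoef TYPE('n) k) ?P u j i a * ?\<phi>2 j i (y + a))" by simp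
  qed
  also have "\<dots> = c * (LINT a|lborel. (\<Sum>i\<in>UNIV. \<Sum>j\<in>UNIV.
      kerB (bcoef TYPE('n) k) (gcoef TYPE('n) k) ?P u i j a * ?\<phi>2 i j (y + a)))"
  proof -
    note fk = flux_kernelB[OF P m]
    have i: "integrable lborel (\<lambda>a. kerB (bcoef TYPE('n) k) (gcoef TYPE('n) k) ?P u i j a * ?\<phi>2 i j (y + a))" for i j
      by (intro int flux_kernel.smooth_M[OF fk] flux_kernel.homog_M[OF fk])
    show ?thesis
      by (subst sum.swap) (simp add: Bochner_Integration.integral_sum i sum_distrib_left)
  qed
  also have "(LINT a|lborel. (\<Sum>i\<in>UNIV. \<Sum>j\<in>UNIV.
      kerB (bcoef TYPE('n) k) (gcoef TYPE('n) k) ?P u i j a * ?\<phi>2 i j (y + a))) = kap TYPE('n) k * (\<phi> y * ?P u)"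
  proof -
    define R where "R = r + norm y + 1"
    have R: "R > 0" "R > r + norm y" using r norm_ge_zero[of y] unfolding R_def by linarith+
    let ?S = "\<lambda>a. \<Sum>i\<in>UNIV. \<Sum>j\<in>UNIV. kerB (bcoef TYPE('n) k) (gcoef TYPE('n) k) ?P u i j a * ?\<phi>2 i j (y + a)"
    have "cutoff (a /\<^sub>R R) * ?S a = ?S a" for a
    proof (cases "norm a < R")
      case True
      then have "norm (a /\<^sub>R R) < 1" using R by (simp add: field_simps)
      then show ?thesis by (simp add: cutoff_small)
    next
      case False
      have "norm a \<le> norm (y + a) + norm y"
        using norm_triangle_ineq4[of "y + a" y] by simp
      then have "norm (y + a) > r" using False R by linarith
      then show ?thesis by (simp add: z2)
    qed
    then have "(LINT a|lborel. ?S a) = (LINT a|lborel. cutoff (a /\<^sub>R R) * ?S a)"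
      by (simp only:)
    also have "\<dots> = (LINT z|lborel. \<phi> (y + R *\<^sub>R z) * defB k ?P u z) - \<phi> y * (LINT z|lborel. defB k ?P u z)"
      unfolding defB_def by (rule flux_kernel.green_ball[OF flux_kernelB[OF P m] C2 R(1)]) (use m in simp)
    \<comment> \<open>The outer term vanishes: \<open>K\<close> is zero for
      \<open>norm z < 1\<close>, and for larger \<open>z\<close> the point
      \<open>y + R *\<^sub>R z\<close> has left the support of \<open>\<phi>\<close>.\<close>
    also have "(\<lambda>z. \<phi> (y + R *\<^sub>R z) * defB k ?P u z) = (\<lambda>z. 0)"
    proof
      fix z
      show "\<phi> (y + R *\<^sub>R z) * defB k ?P u z = 0"
      proof (cases "norm z < 1")
        case True
        then show ?thesis
          unfolding defB_def by (simp add: flux_kernel.K_small[OF flux_kernelB[OF P m]])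
      next
        case False
        then have "R * 1 \<le> R * norm z" using R by (intro mult_left_mono) auto
        moreover have "R * norm z \<le> norm (y + R *\<^sub>R z) + norm y"
          using norm_triangle_ineq4[of "y + R *\<^sub>R z" y] R by simp
        ultimately have "norm (y + R *\<^sub>R z) > r" using R by linarith
        then show ?thesis by (simp add: r(2))
      qed
    qed
    finally show ?thesis
      by (simp add: integral_defB[OF P m])
  qed
  finally show ?thesis by (simp add: mult.assoc)
qed

text \<open>Evaluating the equation where neither test function nor kernel vanishes forces
  \<open>c\<close> to be the reciprocal of \<open>kap\<close>. The assumption \<open>ne\<close>
  supplies such a point; with a vanishing kernel every \<open>c\<close> would satisfy the
  equation.\<close>

lemma norm_const_eq:
  assumes m: "CARD('n::finite) > 4" and ne: "\<exists>h \<in> harm_poly k. \<exists>v :: real^'n. h v \<noteq> 0"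
  shows "norm_const TYPE('n) k = 1 / kap TYPE('n) k"
proof -
  obtain h and v0 :: "real^'n" where h: "h \<in> harm_poly k" "h v0 \<noteq> 0" using ne by blast
  have "\<exists>u0 :: real^'n. repr_kernel k u0 v0 \<noteq> 0"
  proof (rule ccontr)
    assume "\<nexists>u0 :: real^'n. repr_kernel k u0 v0 \<noteq> 0"
    then have "h v0 = 0"
      using repr_kernel_reproduces[OF h(1), of v0] by simp
    then show False using h by simp
  qed
  then obtain u0 :: "real^'n" where Z: "repr_kernel k u0 v0 \<noteq> 0" by blast
  obtain \<phi> :: "real^'n \<Rightarrow> real" where \<phi>: "\<phi> \<in> test_functions" "\<phi> 0 \<noteq> 0"
    using ex_test_function by blast
  have kap0: "kap TYPE('n) k \<noteq> 0" by (rule kap_nonzero[OF h(1) m])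
  have iff: "is_fundamental_solution k (\<lambda>x y u v :: real^'n. c * unnormalized_kernel k x y u v) \<longleftrightarrow>
      c = 1 / kap TYPE('n) k" for c
  proof
    assume "is_fundamental_solution k (\<lambda>x y u v :: real^'n. c * unnormalized_kernel k x y u v)"
    then have "c * kap TYPE('n) k * (\<phi> 0 * repr_kernel k u0 v0) = \<phi> 0 * repr_kernel k u0 v0"
      unfolding is_fundamental_solution_def bosonic_laplacian_distr_kernel[OF m \<phi>(1), symmetric]
      using \<phi>(1) by blast
    then have "c * kap TYPE('n) k = 1" using Z \<phi>(2) by simp
    then show "c = 1 / kap TYPE('n) k" using kap0 by (simp add: field_simps)
  next
    assume "c = 1 / kap TYPE('n) k"
    then show "is_fundamental_solution k (\<lambda>x y u v :: real^'n. c * unnormalized_kernel k x y u v)"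
      unfolding is_fundamental_solution_def using bosonic_laplacian_distr_kernel[OF m, of _ k c] kap0
      by (simp only: nonzero_divide_eq_eq) simp
  qed
  show ?thesis
    unfolding norm_const_def iff by simp
qed

section \<open>The representation formula\<close>

text \<open>For fixed \<open>x\<close> the sphere integral is \<open>repr_kernel_reflect\<close>;
  joint continuity of \<open>f\<close> on the product with the ball gives the measurability needed
  for the translation.\<close>

lemma integral_fundamental_solution:
  fixes f :: "real^'n::finite \<Rightarrow> real^'n \<Rightarrow> real"
  assumes f: "f \<in> C2_harm UNIV k" and v: "v \<in> ball 0 1"
  shows "(LINT x|lborel. LINT u|sphere_measure. fundamental_solution k x y u v * f x u) =
    norm_const TYPE('n) k * potential f y v"
proof -
  let ?c = "norm_const TYPE('n) k"
  let ?F = "\<lambda>a. ?c * (norm a powr (2 - real CARD('n)) * f (y + a) (tilt 2 v a))"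
  have fx: "f x \<in> harm_poly k" for x
    using f by (simp add: C2_harm_def)
  have "(LINT u|sphere_measure. fundamental_solution k x y u v * f x u) = ?F (- y + x)" for x
  proof -
    have n: "norm (y - x) = norm (- y + x)"
      using norm_minus_commute[of y x] by simp
    have r: "clifford_reflect (y - x) u = tilt 2 u (- y + x)" for u
      using tilt_minus[of 2 u "- y + x"] by (simp add: tilt_2)
    have "(LINT u|sphere_measure. fundamental_solution k x y u v * f x u) =
        (LINT u|sphere_measure. (?c * norm (- y + x) powr (2 - real CARD('n))) * (repr_kernel k (tilt 2 u (- y + x)) v * f x u))"
      unfolding fundamental_solution_def unnormalized_kernel_def n r by (simp only: mult.assoc)
    then show ?thesis
      by (simp add: repr_kernel_reflect[OF fx])
  qed
  then have "(LINT x|lborel. LINT u|sphere_measure. fundamental_solution k x y u v * f x u) = (LINT x|lborel. ?F (- y + x))"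
    by (simp only:)
  also have "\<dots> = (LINT a|lborel. ?F a)"
  proof (rule lborel_integral_translate)
    have "continuous_on (UNIV \<times> ball 0 1) (\<lambda>(x, u). f x u)"
      using f by (auto simp: C2_harm_def numeral_2_eq_2 intro!: differentiable_imp_continuous_on_real)
    moreover have "continuous_on (- {0}) (\<lambda>a. (y + a, tilt 2 v a))"
      unfolding tilt_def by (intro continuous_intros) auto
    ultimately have "continuous_on (- {0}) (\<lambda>a. (\<lambda>(x, u). f x u) (y + a, tilt 2 v a))"
      by (rule continuous_on_compose2) (use v in \<open>auto simp: norm_tilt\<close>)
    then have "continuous_on (- {0}) (\<lambda>a. f (y + a) (tilt 2 v a))" by simp
    then have "continuous_on (- {0}) ?F"
      by (rule continuous_on_mult[OF continuous_on_const
            continuous_on_mult[OF smooth0_continuous[OF smooth0_powr]]])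
    then show "?F \<in> borel_measurable borel"
      by (rule borel_measurable_continuous_countable_exceptions[rotated]) simp
  qed
  finally show ?thesis by (simp add: potential_def)
qed

theorem theorem3p4:
  fixes k :: nat and f g :: "real^'n::finite \<Rightarrow> real^'n \<Rightarrow> real"
  assumes "k \<ge> 1"
    and "CARD('n) > 4"
    and "f \<in> C2c_harm k"
    and "g \<in> C2_harm UNIV k"
    and "bounded ((\<lambda>(x, u). g x u) ` (UNIV \<times> ball 0 1))"
    and "\<forall>x. \<forall>u\<in>ball 0 1. bosonic_laplacian k g x u = f x u"
  shows "\<exists>h\<in>harm_poly k. \<forall>y. \<forall>v\<in>ball 0 1.
    g y v = (LINT x|lborel. LINT u|sphere_measure. fundamental_solution k x y u v * f x u) + h v"
proof -
  have f2: "f \<in> C2_harm UNIV k" and fx: "f x \<in> harm_poly k" for x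
    using assms(3) by (auto simp: C2c_harm_def C2_harm_def)
  have gx: "g x \<in> harm_poly k" for x
    using assms(4) by (simp add: C2_harm_def)
  show ?thesis
  proof (cases "\<exists>h \<in> harm_poly k. \<exists>v :: real^'n. h v \<noteq> 0")
    \<comment> \<open>Without nonzero harmonic polynomials the constant would be undetermined, but
      then \<open>f\<close> and \<open>g\<close> vanish and any value serves. The split avoids
      exhibiting a nonzero one.\<close>
    case False
    then have "f x u = 0" "g x u = 0" for x u
      using fx gx by auto
    then show ?thesis
      using lsubspace_0[OF lsubspace_harm_poly, of k] by (intro bexI[of _ "\<lambda>x. 0"]) auto
  next
    case True
    let ?\<kappa> = "kap TYPE('n) k"
    have nc: "norm_const TYPE('n) k = 1 / ?\<kappa>"
      by (rule norm_const_eq[OF assms(2) True])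
    have \<kappa>: "?\<kappa> \<noteq> 0" by (rule kap_nonzero[OF fx assms(2)])
    obtain r where r: "r > 0" "\<And>x u. norm x > r \<Longrightarrow> f x u = 0"
      using C2c_harm_support[OF assms(3)] by blast
    \<comment> \<open>The remainder that \<open>liouville\<close> shows to be independent of
      \<open>y\<close>, evaluated at \<open>y = 0\<close>.\<close>
    define h where "h v = g 0 v + (- (1 / ?\<kappa>)) * potential f 0 v" for v
    have "h \<in> harm_poly k"
      unfolding h_def
      by (rule lsubspaceD[OF lsubspace_harm_poly gx potential_harm_poly[OF assms(2,3)]])
    moreover have "g y v = (LINT x|lborel. LINT u|sphere_measure. fundamental_solution k x y u v * f x u) + h v"
      if v: "v \<in> ball 0 1" for y v
    proof -
      have "potential f y v - ?\<kappa> * g y v = potential f 0 v - ?\<kappa> * g 0 v"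
        by (rule liouville[OF assms(2,4,5) _ r(2) v]) (use assms(6) in auto)
      then show ?thesis
        unfolding integral_fundamental_solution[OF f2 v] nc h_def using \<kappa> by (simp add: field_simps)
    qed
    ultimately show ?thesis by blast
  qed
qed

end
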